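(* Let $\Bbbk$ be a field of characteristic $0$, let $q\ge 0$ be an integer, and let $H^{\bullet}$ be a connected, commutative graded $\Bbbk$-algebra. Suppose $e_1,\dots ,e_r$ is a $q$-regular sequence of homogeneous elements of positive even degrees in $H^{\bullet}$. Then the Hirsch extension $A=H \otimes_{\tau} \bigwedge (t_1,\dots ,t_r)$ with $d=0$ on $H$ and $dt_{\alpha}=\tau (t_{\alpha})=e_{\alpha}$ has the same $q$-type as the cdga $(H/\sum_{\alpha} e_{\alpha} H,\ d=0)$. In particular, $A$ is $q$-formal.
   Context: Commutative graded algebras are graded-commutative and non-negatively graded; connected means $H^0=\Bbbk$. A cdga is a commutative graded algebra with a degree $+1$ differential satisfying the graded Leibniz rule. A sequence $e_1,\dots,e_r$ of homogeneous elements of $H$ with $\deg e_\alpha=n_\alpha>0$ is $q$-regular if, for each $\alpha$, multiplication by the class of $e_\alpha$ on the quotient algebra $\overline{H}_\alpha=H/\sum_{\beta<\alpha}e_\beta H$ is injective on $\overline{H}_\alpha^{\,i}$ for all $i\le q-n_\alpha+2$. In the Hirsch extension $A$, the underlying algebra is $H\otimes\bigwedge(t_1,\dots,t_r)$, with $t_\alpha$ an exterior generator of odd degree $\deg(e_\alpha)-1$. A $q$-equivalence is a cdga map inducing isomorphisms in cohomology in degrees $\le q$ and a monomorphism in degree $q+1$. Two cdgas have the same $q$-type if they are connected by a zig-zag of $q$-equivalences. A cdga $A$ is $q$-formal if it has the same $q$-type as $(H^{\bullet}(A),d=0)$. *)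

theory Defs
  imports "HOL-Algebra.Module" "HOL-Algebra.QuotRing"
begin

section \<open>Commutative graded algebras and cdgas\<close>

record ('k, 'a) graded_alg = "('k, 'a) module" +
  grade :: "nat \<Rightarrow> 'a set"

record ('k, 'a) cdga = "('k, 'a) graded_alg" +
  differential :: "'a \<Rightarrow> 'a"

definition sgn_pow :: "('a, 'm) ring_scheme \<Rightarrow> nat \<Rightarrow> 'a \<Rightarrow> 'a" where
  "sgn_pow A m x = (if even m then x else \<ominus>\<^bsub>A\<^esub> x)"

definition is_decomposition ::
    "('k, 'a, 'm) graded_alg_scheme \<Rightarrow> 'a \<Rightarrow> (nat \<Rightarrow> 'a) \<Rightarrow> bool" where
  "is_decomposition A x c \<longleftrightarrow>
     (\<forall>i. c i \<in> grade A i) \<and> finite {i. c i \<noteq> \<zero>\<^bsub>A\<^esub>} \<and>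
     x = finsum A c {i. c i \<noteq> \<zero>\<^bsub>A\<^esub>}"

text \<open>
  A graded algebra is the internal direct sum of its homogeneous components. The locale
  \<open>algebra\<close> of HOL-Algebra is not used, since it requires the multiplication to be commutative,
  not graded-commutative.
\<close>

locale comm_graded_algebra =
  field K + module K A + ring A for K (structure) and A (structure) +
  assumes smult_mult_left:
      "\<lbrakk>a \<in> carrier K; x \<in> carrier A; y \<in> carrier A\<rbrakk>
        \<Longrightarrow> (a \<odot>\<^bsub>A\<^esub> x) \<otimes>\<^bsub>A\<^esub> y = a \<odot>\<^bsub>A\<^esub> (x \<otimes>\<^bsub>A\<^esub> y)"
    and smult_mult_right:
      "\<lbrakk>a \<in> carrier K; x \<in> carrier A; y \<in> carrier A\<rbrakk>
        \<Longrightarrow> x \<otimes>\<^bsub>A\<^esub> (a \<odot>\<^bsub>A\<^esub> y) = a \<odot>\<^bsub>A\<^esub> (x \<otimes>\<^bsub>A\<^esub> y)"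
    and grade_submodule: "submodule (grade A i) K A"
    and decomposition: "x \<in> carrier A \<Longrightarrow> \<exists>!c. is_decomposition A x c"
    and one_grade: "\<one>\<^bsub>A\<^esub> \<in> grade A 0"
    and mult_grade:
      "\<lbrakk>x \<in> grade A i; y \<in> grade A j\<rbrakk> \<Longrightarrow> x \<otimes>\<^bsub>A\<^esub> y \<in> grade A (i + j)"
    and graded_commute:
      "\<lbrakk>x \<in> grade A i; y \<in> grade A j\<rbrakk> \<Longrightarrow> x \<otimes>\<^bsub>A\<^esub> y = sgn_pow A (i * j) (y \<otimes>\<^bsub>A\<^esub> x)"

definition connected_alg ::
    "('k, 'z) ring_scheme \<Rightarrow> ('k, 'a, 'm) graded_alg_scheme \<Rightarrow> bool" where
  "connected_alg K A \<longleftrightarrow> bij_betw (\<lambda>a. a \<odot>\<^bsub>A\<^esub> \<one>\<^bsub>A\<^esub>) (carrier K) (grade A 0)"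

locale is_cdga = comm_graded_algebra K A for K (structure) and A (structure) +
  assumes d_closed: "x \<in> carrier A \<Longrightarrow> differential A x \<in> carrier A"
    and d_add:
      "\<lbrakk>x \<in> carrier A; y \<in> carrier A\<rbrakk>
        \<Longrightarrow> differential A (x \<oplus>\<^bsub>A\<^esub> y) = differential A x \<oplus>\<^bsub>A\<^esub> differential A y"
    and d_smult:
      "\<lbrakk>a \<in> carrier K; x \<in> carrier A\<rbrakk>
        \<Longrightarrow> differential A (a \<odot>\<^bsub>A\<^esub> x) = a \<odot>\<^bsub>A\<^esub> differential A x"
    and d_grade: "x \<in> grade A i \<Longrightarrow> differential A x \<in> grade A (Suc i)"
    and d_d: "x \<in> carrier A \<Longrightarrow> differential A (differential A x) = \<zero>\<^bsub>A\<^esub>"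
    and leibniz:
      "\<lbrakk>x \<in> grade A i; y \<in> carrier A\<rbrakk>
        \<Longrightarrow> differential A (x \<otimes>\<^bsub>A\<^esub> y) =
            (differential A x \<otimes>\<^bsub>A\<^esub> y) \<oplus>\<^bsub>A\<^esub> sgn_pow A i (x \<otimes>\<^bsub>A\<^esub> differential A y)"

definition cdga_hom ::
    "('k, 'z) ring_scheme \<Rightarrow> ('k, 'a, 'm) cdga_scheme \<Rightarrow> ('k, 'b, 'n) cdga_scheme \<Rightarrow> ('a \<Rightarrow> 'b) set"
  where
  "cdga_hom K A B =
     {f \<in> ring_hom A B.
        (\<forall>a\<in>carrier K. \<forall>x\<in>carrier A. f (a \<odot>\<^bsub>A\<^esub> x) = a \<odot>\<^bsub>B\<^esub> f x) \<and>
        (\<forall>i. f ` grade A i \<subseteq> grade B i) \<and>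
        (\<forall>x\<in>carrier A. f (differential A x) = differential B (f x))}"

section \<open>Quotients and cohomology\<close>

text \<open>
  The ring structure is that of the quotient ring \<open>A Quot I\<close>; the remaining fields are induced
  from \<open>A\<close>. The union defining the scalar multiplication is a union of equal cosets.
\<close>

definition quot_alg ::
    "('k, 'a, 'm) graded_alg_scheme \<Rightarrow> 'a set \<Rightarrow> ('k, 'a set) graded_alg" where
  "quot_alg A I =
     \<lparr>carrier = carrier (A Quot I), mult = mult (A Quot I), one = one (A Quot I),
      zero = zero (A Quot I), add = add (A Quot I),
      smult = (\<lambda>a X. \<Union>x\<in>X. I +>\<^bsub>A\<^esub> (a \<odot>\<^bsub>A\<^esub> x)),
      grade = (\<lambda>i. (\<lambda>x. I +>\<^bsub>A\<^esub> x) ` grade A i)\<rparr>"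

definition with_zero_diff ::
    "('k, 'a, 'm) graded_alg_scheme \<Rightarrow> ('k, 'a) cdga" where
  "with_zero_diff A =
     \<lparr>carrier = carrier A, mult = mult A, one = one A, zero = zero A, add = add A,
      smult = smult A, grade = grade A, differential = (\<lambda>_. \<zero>\<^bsub>A\<^esub>)\<rparr>"

definition cocycles :: "('k, 'a, 'm) cdga_scheme \<Rightarrow> 'a set" where
  "cocycles A = {x \<in> carrier A. differential A x = \<zero>\<^bsub>A\<^esub>}"

definition coboundaries :: "('k, 'a, 'm) cdga_scheme \<Rightarrow> 'a set" where
  "coboundaries A = differential A ` carrier A"

definition cohomology :: "('k, 'a, 'm) cdga_scheme \<Rightarrow> ('k, 'a set) graded_alg" where
  "cohomology A =
     quot_alg (A\<lparr>carrier := cocycles A, grade := (\<lambda>i. cocycles A \<inter> grade A i)\<rparr>)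
       (coboundaries A)"

text \<open>
  The map \<open>[x] \<mapsto> [f x]\<close> on cohomology classes; again a union of equal cosets.
\<close>

definition cohomology_map ::
    "('k, 'b, 'n) cdga_scheme \<Rightarrow> ('a \<Rightarrow> 'b) \<Rightarrow> 'a set \<Rightarrow> 'b set" where
  "cohomology_map B f X = (\<Union>x\<in>X. coboundaries B +>\<^bsub>B\<^esub> f x)"

section \<open>Equality of q-types and q-formality\<close>

definition q_equivalence ::
    "('k, 'z) ring_scheme \<Rightarrow> nat \<Rightarrow> ('k, 'a, 'm) cdga_scheme \<Rightarrow> ('k, 'b, 'n) cdga_scheme
      \<Rightarrow> ('a \<Rightarrow> 'b) \<Rightarrow> bool" where
  "q_equivalence K q A B f \<longleftrightarrow>
     f \<in> cdga_hom K A B \<and>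
     (\<forall>i\<le>q. bij_betw (cohomology_map B f) (grade (cohomology A) i) (grade (cohomology B) i)) \<and>
     inj_on (cohomology_map B f) (grade (cohomology A) (Suc q))"

definition q_linked ::
    "('k, 'z) ring_scheme \<Rightarrow> nat \<Rightarrow> ('k, 'a, 'm) cdga_scheme \<Rightarrow> ('k, 'b, 'n) cdga_scheme \<Rightarrow> bool"
  where
  "q_linked K q A B \<longleftrightarrow>
     is_cdga K A \<and> is_cdga K B \<and>
     ((\<exists>f. q_equivalence K q A B f) \<or> (\<exists>f. q_equivalence K q B A f))"

text \<open>
  A zig-zag of q-equivalences from \<open>A\<close> to \<open>B\<close>. HOL cannot quantify over the types carrying the
  intermediate cdgas, so these are taken on one fixed type, which is large enough for this to be
  no restriction: lists over \<open>'k + 'a + 'b\<close> have cardinality at least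
  \<open>\<kappa> = max(\<aleph>\<^sub>0, |K|, |A|, |B|)\<close>. A zig-zag is a structure for a countable many-sorted first-order
  language (one sort for each degree of each cdga), and being a zig-zag of q-equivalences is a
  first-order condition. So by the downward Loewenheim-Skolem theorem any zig-zag from \<open>A\<close> to
  \<open>B\<close> contains one, still with ends \<open>A\<close> and \<open>B\<close>, whose intermediate cdgas have cardinality at
  most \<open>\<kappa>\<close>.
\<close>

definition same_q_type ::
    "('k, 'z) ring_scheme \<Rightarrow> nat \<Rightarrow> ('k, 'a, 'm) cdga_scheme \<Rightarrow> ('k, 'b, 'n) cdga_scheme \<Rightarrow> bool"
  where
  "same_q_type K q A B \<longleftrightarrow>
     q_linked K q A B \<or>
     (\<exists>C D :: ('k, ('k + 'a + 'b) list) cdga.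
        q_linked K q A C \<and> (q_linked K q)\<^sup>*\<^sup>* C D \<and> q_linked K q D B)"

definition q_formal ::
    "('k, 'z) ring_scheme \<Rightarrow> nat \<Rightarrow> ('k, 'a, 'm) cdga_scheme \<Rightarrow> bool" where
  "q_formal K q A \<longleftrightarrow> same_q_type K q A (with_zero_diff (cohomology A))"

section \<open>q-regular sequences\<close>

definition sum_ideal ::
    "('k, 'a, 'm) graded_alg_scheme \<Rightarrow> (nat \<Rightarrow> 'a) \<Rightarrow> nat set \<Rightarrow> 'a set" where
  "sum_ideal H e J = {finsum H (\<lambda>\<beta>. e \<beta> \<otimes>\<^bsub>H\<^esub> h \<beta>) J | h. h \<in> J \<rightarrow> carrier H}"

text \<open>
  The degrees \<open>n \<alpha>\<close> are given along with the \<open>e \<alpha>\<close>, since the degree of a homogeneous element is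
  not determined by it if it is zero.
\<close>

definition q_regular ::
    "('k, 'a, 'm) graded_alg_scheme \<Rightarrow> nat \<Rightarrow> nat \<Rightarrow> (nat \<Rightarrow> 'a) \<Rightarrow> (nat \<Rightarrow> nat) \<Rightarrow> bool" where
  "q_regular H q r e n \<longleftrightarrow>
     (\<forall>\<alpha>\<in>{1..r}.
        0 < n \<alpha> \<and> e \<alpha> \<in> grade H (n \<alpha>) \<and>
        (let I = sum_ideal H e {1..<\<alpha>}; Q = quot_alg H I in
          \<forall>i. int i \<le> int q - int (n \<alpha>) + 2 \<longrightarrow>
            inj_on (\<lambda>X. (I +>\<^bsub>H\<^esub> e \<alpha>) \<otimes>\<^bsub>Q\<^esub> X) (grade Q i)))"

section \<open>The Hirsch extension\<close>

definition hom_part :: "('k, 'a, 'm) graded_alg_scheme \<Rightarrow> 'a \<Rightarrow> nat \<Rightarrow> 'a" where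
  "hom_part A x = (THE c. is_decomposition A x c)"

text \<open>
  The linear map given by \<open>x \<mapsto> (-1)\<^bsup>m |x|\<^esup> x\<close> on homogeneous \<open>x\<close>.
\<close>

definition koszul :: "('k, 'a, 'm) graded_alg_scheme \<Rightarrow> nat \<Rightarrow> 'a \<Rightarrow> 'a" where
  "koszul A m x =
     finsum A (\<lambda>i. sgn_pow A (m * i) (hom_part A x i)) {i. hom_part A x i \<noteq> \<zero>\<^bsub>A\<^esub>}"

text \<open>
  The exterior algebra on \<open>t\<^sub>1, \<dots>, t\<^sub>r\<close> has as basis the monomials
  \<open>t\<^sub>S = t\<^bsub>s(1)\<^esub> \<cdots> t\<^bsub>s(k)\<^esub>\<close> for \<open>S = {s(1) < \<dots> < s(k)} \<subseteq> {1..r}\<close>. So an element of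
  \<open>H \<otimes> \<And>(t\<^sub>1, \<dots>, t\<^sub>r)\<close> is represented by the function \<open>f\<close> on the subsets of \<open>{1..r}\<close> which gives
  the coefficients in \<open>\<Sum>\<^sub>S f S \<otimes> t\<^sub>S\<close>.
\<close>

definition mon_degree :: "(nat \<Rightarrow> nat) \<Rightarrow> nat set \<Rightarrow> nat" where
  "mon_degree n S = (\<Sum>s\<in>S. n s - 1)"

text \<open>
  For disjoint \<open>S\<close> and \<open>T\<close> one has \<open>t\<^sub>S t\<^sub>T = (-1)\<^bsup>inversions S T\<^esup> t\<^bsub>S \<union> T\<^esub>\<close>, since the \<open>t\<^sub>s\<close>
  anticommute.
\<close>

definition inversions :: "nat set \<Rightarrow> nat set \<Rightarrow> nat" where
  "inversions S T = card {(s, t). s \<in> S \<and> t \<in> T \<and> t < s}"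

text \<open>
  The product is that of the graded tensor product:
  \<open>(h \<otimes> t\<^sub>S) (h' \<otimes> t\<^sub>T) = (-1)\<^bsup>|t\<^sub>S| |h'|\<^esup> h h' \<otimes> t\<^sub>S t\<^sub>T\<close>, where \<open>t\<^sub>S t\<^sub>T = 0\<close> unless
  \<open>S\<close> and \<open>T\<close> are disjoint. The differential is the derivation with \<open>d h = 0\<close> for \<open>h\<close> in \<open>H\<close> and
  \<open>d t\<^sub>s = e\<^sub>s\<close>; as the \<open>e\<^sub>s\<close> have even degree, the Leibniz rule gives
  \<open>d (h \<otimes> t\<^sub>S) = (-1)\<^bsup>|h|\<^esup> \<Sum>\<^bsub>s \<in> S\<^esub> (-1)\<^bsup>|{u \<in> S. u < s}|\<^esup> h e\<^sub>s \<otimes> t\<^bsub>S - {s}\<^esub>\<close>.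
  Below, the coefficient of \<open>t\<^sub>U\<close> is collected in both formulas.
\<close>

definition hirsch_extension ::
    "('k, 'a, 'm) graded_alg_scheme \<Rightarrow> nat \<Rightarrow> (nat \<Rightarrow> 'a) \<Rightarrow> (nat \<Rightarrow> nat)
      \<Rightarrow> ('k, nat set \<Rightarrow> 'a) cdga" where
  "hirsch_extension H r e n =
     \<lparr>carrier = Pow {1..r} \<rightarrow>\<^sub>E carrier H,
      mult = (\<lambda>f g. \<lambda>U\<in>Pow {1..r}.
        finsum H (\<lambda>S. sgn_pow H (inversions S (U - S))
                        (f S \<otimes>\<^bsub>H\<^esub> koszul H (mon_degree n S) (g (U - S)))) (Pow U)),
      one = (\<lambda>U\<in>Pow {1..r}. if U = {} then \<one>\<^bsub>H\<^esub> else \<zero>\<^bsub>H\<^esub>),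
      zero = (\<lambda>U\<in>Pow {1..r}. \<zero>\<^bsub>H\<^esub>),
      add = (\<lambda>f g. \<lambda>U\<in>Pow {1..r}. f U \<oplus>\<^bsub>H\<^esub> g U),
      smult = (\<lambda>a f. \<lambda>U\<in>Pow {1..r}. a \<odot>\<^bsub>H\<^esub> f U),
      grade = (\<lambda>i. {f \<in> Pow {1..r} \<rightarrow>\<^sub>E carrier H.
        \<forall>U\<in>Pow {1..r}. if mon_degree n U \<le> i then f U \<in> grade H (i - mon_degree n U)
                       else f U = \<zero>\<^bsub>H\<^esub>}),
      differential = (\<lambda>f. \<lambda>U\<in>Pow {1..r}.
        finsum H (\<lambda>s. sgn_pow H (card {u \<in> U. u < s})
                        (koszul H 1 (f (insert s U)) \<otimes>\<^bsub>H\<^esub> e s)) ({1..r} - U))\<rparr>"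

end

theory Submission
  imports Defs
begin

text \<open>
  Write \<open>I\<close> for the ideal generated by the \<open>e\<^sub>\<alpha>\<close>. Adjoining the \<open>t\<^sub>\<alpha>\<close> one at a time, q-regularity
  shows that every cocycle of \<open>A\<close> of degree at most \<open>q + 1\<close> whose coefficient of \<open>t\<^sub>\<emptyset> = 1\<close> lies in
  \<open>I\<close> is a coboundary. Hence the projection \<open>A \<rightarrow> H/I\<close> killing all \<open>t\<^sub>\<alpha>\<close> is a q-equivalence. As
  \<open>I\<close> consists of coboundaries, this projection can be followed by the map from \<open>H/I\<close> to the
  cohomology of \<open>A\<close> induced by the inclusion of \<open>H\<close>, and the composite is a q-equivalence for the
  same reason. So no zig-zags are needed.
\<close>

section \<open>Graded algebras and the Koszul sign involution\<close>

text \<open>The bound \<open>q - n + 2\<close> in q-regularity is \<open>(q + 1) - (n - 1)\<close>: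
  in a cocycle \<open>a + b t\<close> of degree at most \<open>q + 1\<close>, the coefficient
  \<open>b\<close> has at most that degree, so regularity is available where the induction asks for
  it. Surjectivity of the cohomology of \<open>A\<close> onto \<open>H/I\<close> costs nothing,
  since elements of \<open>H\<close> are cocycles; regularity is spent on injectivity. The laborious
  point is that elements of \<open>A\<close> are functions on subsets of \<open>{1..r}\<close>, with
  signs from inversions and degrees, a form unsuited to checking associativity or the Leibniz rule.
  These are verified for pairs \<open>(a, b)\<close> over an arbitrary cdga and carried over by a
  bijection that respects all operations. In the computations the sign of a homogeneous element
  becomes the linear involution \<open>koszul\<close>, so that formulas hold for inhomogeneous
  elements too. Evenness of the degrees enters twice: it makes the \<open>e\<close>'s central, and
  it makes the \<open>t\<close>'s odd, so that the degree of a monomial has the parity of its number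
  of factors.\<close>

context abelian_group
begin

lemma sgn_pow_closed [simp, intro]: "x \<in> carrier G \<Longrightarrow> sgn_pow G m x \<in> carrier G"
  by (simp add: sgn_pow_def)

lemma sgn_pow_zero [simp]: "sgn_pow G m \<zero> = \<zero>"
  by (simp add: sgn_pow_def)

lemma sgn_pow_sgn_pow:
  "x \<in> carrier G \<Longrightarrow> sgn_pow G m (sgn_pow G k x) = sgn_pow G (m + k) x"
  by (simp add: sgn_pow_def)

lemma sgn_pow_add:
  "\<lbrakk>x \<in> carrier G; y \<in> carrier G\<rbrakk> \<Longrightarrow> sgn_pow G m (x \<oplus> y) = sgn_pow G m x \<oplus> sgn_pow G m y"
  by (simp add: sgn_pow_def minus_add)

lemma sgn_pow_finsum:
  assumes "finite F" "c \<in> F \<rightarrow> carrier G"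
  shows "sgn_pow G m (finsum G c F) = finsum G (\<lambda>i. sgn_pow G m (c i)) F"
  using assms by (induction F rule: finite_induct) (auto simp: sgn_pow_add Pi_def)

text \<open>The definitions of \<open>is_decomposition\<close> and \<open>koszul\<close> sum over
  the exact support; this allows any finite set containing it, so that several sums can be compared
  over a common index set.\<close>

lemma finsum_support:
  assumes "finite F" "c \<in> F \<rightarrow> carrier G" "\<And>i. i \<notin> F \<Longrightarrow> c i = \<zero>"
  shows "finsum G c {i. c i \<noteq> \<zero>} = finsum G c F"
proof (rule add.finprod_mono_neutral_cong_left)
  show "{i. c i \<noteq> \<zero>} \<subseteq> F" using assms(3) by blast
qed (use assms in auto)

end

lemma sgn_pow_cong: "even m = even k \<Longrightarrow> sgn_pow A m x = sgn_pow A k x"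
  by (simp add: sgn_pow_def)

context ring
begin

lemma sgn_pow_l_mult:
  "\<lbrakk>x \<in> carrier R; y \<in> carrier R\<rbrakk> \<Longrightarrow> sgn_pow R m x \<otimes> y = sgn_pow R m (x \<otimes> y)"
  by (simp add: sgn_pow_def l_minus)

lemma sgn_pow_r_mult:
  "\<lbrakk>x \<in> carrier R; y \<in> carrier R\<rbrakk> \<Longrightarrow> x \<otimes> sgn_pow R m y = sgn_pow R m (x \<otimes> y)"
  by (simp add: sgn_pow_def r_minus)

end

text \<open>Existence and uniqueness of decompositions become separate goals. Existence may use any
  finite index set; uniqueness is reduced, by subtracting two decompositions, to the vanishing of
  the terms of a homogeneous sum equal to zero. Closure of the components under negation comes from
  the scalar -1.\<close>

lemma comm_graded_algebraI:
  fixes K (structure) and A (structure)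
  assumes K: "field K" and A: "ring A"
    and smult_closed: "\<And>a x. \<lbrakk>a \<in> carrier K; x \<in> carrier A\<rbrakk> \<Longrightarrow> a \<odot>\<^bsub>A\<^esub> x \<in> carrier A"
    and smult_l_distr: "\<And>a b x. \<lbrakk>a \<in> carrier K; b \<in> carrier K; x \<in> carrier A\<rbrakk>
      \<Longrightarrow> (a \<oplus> b) \<odot>\<^bsub>A\<^esub> x = a \<odot>\<^bsub>A\<^esub> x \<oplus>\<^bsub>A\<^esub> b \<odot>\<^bsub>A\<^esub> x"
    and smult_r_distr: "\<And>a x y. \<lbrakk>a \<in> carrier K; x \<in> carrier A; y \<in> carrier A\<rbrakk>
      \<Longrightarrow> a \<odot>\<^bsub>A\<^esub> (x \<oplus>\<^bsub>A\<^esub> y) = a \<odot>\<^bsub>A\<^esub> x \<oplus>\<^bsub>A\<^esub> a \<odot>\<^bsub>A\<^esub> y"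
    and smult_assoc: "\<And>a b x. \<lbrakk>a \<in> carrier K; b \<in> carrier K; x \<in> carrier A\<rbrakk>
      \<Longrightarrow> (a \<otimes> b) \<odot>\<^bsub>A\<^esub> x = a \<odot>\<^bsub>A\<^esub> (b \<odot>\<^bsub>A\<^esub> x)"
    and smult_one: "\<And>x. x \<in> carrier A \<Longrightarrow> \<one> \<odot>\<^bsub>A\<^esub> x = x"
    and mult_left: "\<And>a x y. \<lbrakk>a \<in> carrier K; x \<in> carrier A; y \<in> carrier A\<rbrakk>
      \<Longrightarrow> (a \<odot>\<^bsub>A\<^esub> x) \<otimes>\<^bsub>A\<^esub> y = a \<odot>\<^bsub>A\<^esub> (x \<otimes>\<^bsub>A\<^esub> y)"
    and mult_right: "\<And>a x y. \<lbrakk>a \<in> carrier K; x \<in> carrier A; y \<in> carrier A\<rbrakk>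
      \<Longrightarrow> x \<otimes>\<^bsub>A\<^esub> (a \<odot>\<^bsub>A\<^esub> y) = a \<odot>\<^bsub>A\<^esub> (x \<otimes>\<^bsub>A\<^esub> y)"
    and grade_sub: "\<And>i. grade A i \<subseteq> carrier A"
    and grade_zero: "\<And>i. \<zero>\<^bsub>A\<^esub> \<in> grade A i"
    and grade_add: "\<And>i x y. \<lbrakk>x \<in> grade A i; y \<in> grade A i\<rbrakk> \<Longrightarrow> x \<oplus>\<^bsub>A\<^esub> y \<in> grade A i"
    and grade_smult: "\<And>i a x. \<lbrakk>a \<in> carrier K; x \<in> grade A i\<rbrakk> \<Longrightarrow> a \<odot>\<^bsub>A\<^esub> x \<in> grade A i"
    and dec_ex: "\<And>x. x \<in> carrier A
      \<Longrightarrow> \<exists>F c. finite F \<and> (\<forall>i. c i \<in> grade A i) \<and> (\<forall>i. i \<notin> F \<longrightarrow> c i = \<zero>\<^bsub>A\<^esub>) \<and> x = finsum A c F"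
    and dec_unique: "\<And>F c i. \<lbrakk>finite F; \<And>i. c i \<in> grade A i; finsum A c F = \<zero>\<^bsub>A\<^esub>; i \<in> F\<rbrakk>
      \<Longrightarrow> c i = \<zero>\<^bsub>A\<^esub>"
    and one: "\<one>\<^bsub>A\<^esub> \<in> grade A 0"
    and mult: "\<And>i j x y. \<lbrakk>x \<in> grade A i; y \<in> grade A j\<rbrakk> \<Longrightarrow> x \<otimes>\<^bsub>A\<^esub> y \<in> grade A (i + j)"
    and comm: "\<And>i j x y. \<lbrakk>x \<in> grade A i; y \<in> grade A j\<rbrakk>
      \<Longrightarrow> x \<otimes>\<^bsub>A\<^esub> y = sgn_pow A (i * j) (y \<otimes>\<^bsub>A\<^esub> x)"
  shows "comm_graded_algebra K A"
proof -
  interpret K: field K by fact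
  interpret A: ring A by fact
  have mod: "module K A"
    by (rule moduleI) (auto intro: assms K.is_cring A.abelian_group_axioms)
  interpret module K A by fact
  have minus: "\<ominus>\<^bsub>A\<^esub> x \<in> grade A i" if "x \<in> grade A i" for x i
  proof -
    have "x \<in> carrier A" using that grade_sub by blast
    then have "\<ominus>\<^bsub>A\<^esub> x = (\<ominus> \<one>) \<odot>\<^bsub>A\<^esub> x" using smult_l_minus[of \<one> x] by (simp add: smult_one)
    then show ?thesis using that grade_smult by simp
  qed
  show ?thesis
  proof (intro comm_graded_algebra.intro comm_graded_algebra_axioms.intro)
    fix x assume x: "x \<in> carrier A"
    obtain F c where F: "finite F" "\<forall>i. c i \<in> grade A i" "\<forall>i. i \<notin> F \<longrightarrow> c i = \<zero>\<^bsub>A\<^esub>" "x = finsum A c F"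
      using dec_ex[OF x] by metis
    have "is_decomposition A x c"
      unfolding is_decomposition_def
    proof (intro conjI)
      show "finite {i. c i \<noteq> \<zero>\<^bsub>A\<^esub>}" using F by (metis (mono_tags, lifting) mem_Collect_eq finite_subset subsetI)
      show "x = finsum A c {i. c i \<noteq> \<zero>\<^bsub>A\<^esub>}"
        using F grade_sub by (subst A.finsum_support[of F]) auto
    qed (use F in auto)
    moreover have "b = c" if b: "is_decomposition A x b" for b
    proof
      fix i
      \<comment> \<open>Contains both supports, so the two sums can be subtracted termwise, and also
        \<open>i\<close> itself, so that \<open>dec_unique\<close> can be applied at
        \<open>i\<close> in every case.\<close>
      let ?G = "F \<union> {i. b i \<noteq> \<zero>\<^bsub>A\<^esub>} \<union> {i}"
      have bg: "\<And>i. b i \<in> grade A i" and bf: "finite {i. b i \<noteq> \<zero>\<^bsub>A\<^esub>}"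
        and bx: "x = finsum A b {i. b i \<noteq> \<zero>\<^bsub>A\<^esub>}"
        using b unfolding is_decomposition_def by auto
      have bc: "\<And>i. b i \<in> carrier A" and cc: "\<And>i. c i \<in> carrier A"
        using bg F(2) grade_sub by blast+
      have xb: "finsum A b ?G = x"
        unfolding bx by (rule A.finsum_support[symmetric]) (use bf F bc in auto)
      have xc: "finsum A c ?G = x"
        unfolding F(4)
        by (rule A.add.finprod_mono_neutral_cong_left[symmetric]) (use bf F cc in auto)
      have "finsum A (\<lambda>i. b i \<oplus>\<^bsub>A\<^esub> \<ominus>\<^bsub>A\<^esub> c i) ?G
          = finsum A b ?G \<oplus>\<^bsub>A\<^esub> finsum A (\<lambda>i. \<ominus>\<^bsub>A\<^esub> c i) ?G"
        by (rule A.finsum_addf) (use bc cc in auto)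
      also have "finsum A (\<lambda>i. \<ominus>\<^bsub>A\<^esub> c i) ?G = \<ominus>\<^bsub>A\<^esub> finsum A c ?G"
        using A.sgn_pow_finsum[of ?G c 1] bf F(1) cc by (simp add: sgn_pow_def)
      finally have "finsum A (\<lambda>i. b i \<oplus>\<^bsub>A\<^esub> \<ominus>\<^bsub>A\<^esub> c i) ?G = \<zero>\<^bsub>A\<^esub>"
        unfolding xb xc using A.r_neg[OF x] by simp
      then have "b i \<oplus>\<^bsub>A\<^esub> \<ominus>\<^bsub>A\<^esub> c i = \<zero>\<^bsub>A\<^esub>"
        by (rule dec_unique[rotated 2]) (use F(1) bf in \<open>auto intro: bg F(2)[rule_format] minus grade_add\<close>)
      then show "b i = c i" using bc[of i] cc[of i]
        by (metis A.add.inv_closed A.minus_equality A.minus_minus)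
    qed
    ultimately show "\<exists>!c. is_decomposition A x c" by blast
  next
    show "submodule (grade A i) K A" for i
      by (rule submoduleI) (use grade_sub grade_zero minus grade_add grade_smult in auto)
  qed (rule K A mod mult_left mult_right one mult comm; assumption)+
qed

text \<open>The parameters are exchanged so that the algebra is the first structure: operations
  without a subscript now mean those of \<open>A\<close> and not those of the field.\<close>

locale graded = comm_graded_algebra K A for A (structure) and K
begin

lemma grade_carrier [simp]: "x \<in> grade A i \<Longrightarrow> x \<in> carrier A"
  using submoduleE(1)[OF grade_submodule] by blast

lemma grade_add [intro]: "\<lbrakk>x \<in> grade A i; y \<in> grade A i\<rbrakk> \<Longrightarrow> x \<oplus> y \<in> grade A i"
  using submoduleE(5)[OF grade_submodule] by blast

lemma grade_minus [intro]: "x \<in> grade A i \<Longrightarrow> \<ominus> x \<in> grade A i"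
  using submoduleE(3)[OF grade_submodule] by blast

lemma grade_smult [intro]: "\<lbrakk>a \<in> carrier K; x \<in> grade A i\<rbrakk> \<Longrightarrow> a \<odot> x \<in> grade A i"
  using submoduleE(4)[OF grade_submodule] by blast

lemma grade_zero [simp, intro]: "\<zero> \<in> grade A i"
  using submoduleE(2)[OF grade_submodule, of i] grade_minus grade_add
  by (metis all_not_in_conv grade_carrier r_neg)

lemma grade_sgn_pow [intro]: "x \<in> grade A i \<Longrightarrow> sgn_pow A m x \<in> grade A i"
  by (auto simp: sgn_pow_def)

lemma is_decomposition_hom_part:
  "x \<in> carrier A \<Longrightarrow> is_decomposition A x (hom_part A x)"
  unfolding hom_part_def using theI'[OF decomposition] .

lemma hom_part_grade [simp, intro]: "x \<in> carrier A \<Longrightarrow> hom_part A x i \<in> grade A i"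
  using is_decomposition_hom_part unfolding is_decomposition_def by blast

lemma hom_part_closed [simp, intro]: "x \<in> carrier A \<Longrightarrow> hom_part A x i \<in> carrier A"
  using hom_part_grade grade_carrier by blast

lemma finite_hom_part: "x \<in> carrier A \<Longrightarrow> finite {i. hom_part A x i \<noteq> \<zero>}"
  using is_decomposition_hom_part unfolding is_decomposition_def by blast

text \<open>The way to compute \<open>hom_part\<close>, which is defined by a definite description:
  exhibit a candidate that vanishes outside a finite set.\<close>

lemma hom_part_unique:
  assumes "finite F" "\<And>i. c i \<in> grade A i" "\<And>i. i \<notin> F \<Longrightarrow> c i = \<zero>" "x = finsum A c F"
  shows "hom_part A x = c"
proof -
  have c: "c i \<in> carrier A" for i using assms(2) grade_carrier by blast
  then have x: "x \<in> carrier A" using assms(4) by (simp add: finsum_closed)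
  have "is_decomposition A x c"
    unfolding is_decomposition_def
  proof (intro conjI)
    show "finite {i. c i \<noteq> \<zero>}" using assms(1,3) by (metis (mono_tags, lifting) mem_Collect_eq finite_subset subsetI)
    show "x = finsum A c {i. c i \<noteq> \<zero>}"
      using assms c by (subst finsum_support[of F]) auto
  qed (use assms in auto)
  then show ?thesis using decomposition[OF x] is_decomposition_hom_part[OF x] by blast
qed

lemma finsum_hom_part:
  assumes "x \<in> carrier A" "finite F" "{i. hom_part A x i \<noteq> \<zero>} \<subseteq> F"
  shows "finsum A (hom_part A x) F = x"
proof -
  have "finsum A (hom_part A x) {i. hom_part A x i \<noteq> \<zero>} = finsum A (hom_part A x) F"
    by (rule finsum_support) (use assms in auto)
  then show ?thesis
    using is_decomposition_hom_part[OF assms(1)] unfolding is_decomposition_def by simp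
qed

lemma hom_part_homogeneous:
  assumes "x \<in> grade A i"
  shows "hom_part A x = (\<lambda>j. if j = i then x else \<zero>)"
  by (rule hom_part_unique[of "{i}"]) (use assms in auto)

lemma hom_part_zero [simp]: "hom_part A \<zero> i = \<zero>"
  using hom_part_homogeneous[OF grade_zero, of 0] by simp

text \<open>Cut off outside \<open>F\<close>, the family \<open>c\<close> is the decomposition of
  its own sum, hence of zero. This is directness in the form that
  \<open>comm_graded_algebraI\<close> asks of a new algebra.\<close>

lemma homogeneous_sum_zero:
  assumes "finite F" "\<And>i. i \<in> F \<Longrightarrow> c i \<in> grade A i" "finsum A c F = \<zero>" "i \<in> F"
  shows "c i = \<zero>"
proof -
  have c: "c i \<in> carrier A" if "i \<in> F" for i
    using assms(2) that grade_carrier by blast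
  have "hom_part A (finsum A c F) = (\<lambda>i. if i \<in> F then c i else \<zero>)"
    by (rule hom_part_unique[of F])
      (use assms(1,2) c in \<open>auto intro!: finsum_cong'\<close>)
  then show ?thesis using assms(3,4) by (auto dest: fun_cong[of _ _ i])
qed

lemma hom_part_add:
  assumes "x \<in> carrier A" "y \<in> carrier A"
  shows "hom_part A (x \<oplus> y) i = hom_part A x i \<oplus> hom_part A y i"
proof -
  let ?F = "{i. hom_part A x i \<noteq> \<zero>} \<union> {i. hom_part A y i \<noteq> \<zero>}"
  have F: "finite ?F" using assms finite_hom_part by simp
  have "hom_part A (x \<oplus> y) = (\<lambda>i. hom_part A x i \<oplus> hom_part A y i)"
  proof (rule hom_part_unique[OF F])
    show "x \<oplus> y = (\<Oplus>i\<in>?F. hom_part A x i \<oplus> hom_part A y i)"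
      using assms F by (subst finsum_addf) (auto simp: finsum_hom_part)
  qed (use assms in auto)
  then show ?thesis by simp
qed

lemma hom_part_finsum:
  assumes "finite F" "c \<in> F \<rightarrow> carrier A"
  shows "hom_part A (finsum A c F) i = (\<Oplus>j\<in>F. hom_part A (c j) i)"
  using assms
proof (induction F rule: finite_induct)
  case (insert j F)
  then have "c j \<in> carrier A" "c \<in> F \<rightarrow> carrier A" "(\<lambda>j. hom_part A (c j) i) \<in> F \<rightarrow> carrier A"
    by auto
  with insert show ?case by (simp add: finsum_insert hom_part_add finsum_closed)
qed simp

text \<open>Reduces additive identities to homogeneous elements, on which \<open>koszul\<close> is
  just a sign. A general element is the finite sum of its components.\<close>

lemma homogeneous_induct [consumes 1, case_names homogeneous add]:
  assumes x: "x \<in> carrier A"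
    and hom: "\<And>i x. x \<in> grade A i \<Longrightarrow> P x"
    and add: "\<And>x y. \<lbrakk>x \<in> carrier A; y \<in> carrier A; P x; P y\<rbrakk> \<Longrightarrow> P (x \<oplus> y)"
  shows "P x"
proof -
  have "P (finsum A (hom_part A x) F)" if "finite F" for F
    using that
  proof (induction F rule: finite_induct)
    case empty
    show ?case using hom[of \<zero> 0] by simp
  next
    case (insert i F)
    then show ?case
      using x by (auto simp: finsum_insert intro!: add hom[of "hom_part A x i" i] finsum_closed)
  qed
  then show ?thesis using finsum_hom_part[OF x finite_hom_part[OF x]] finite_hom_part[OF x] by force
qed

lemma koszul_eq_finsum:
  assumes "x \<in> carrier A" "finite F" "{i. hom_part A x i \<noteq> \<zero>} \<subseteq> F"
  shows "koszul A m x = finsum A (\<lambda>i. sgn_pow A (m * i) (hom_part A x i)) F"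
  unfolding koszul_def
  by (rule add.finprod_mono_neutral_cong_left) (use assms in auto)

lemma koszul_closed [simp, intro]: "x \<in> carrier A \<Longrightarrow> koszul A m x \<in> carrier A"
  by (simp add: koszul_def finsum_closed)

lemma koszul_homogeneous: "x \<in> grade A i \<Longrightarrow> koszul A m x = sgn_pow A (m * i) x"
  by (subst koszul_eq_finsum[of x "{i}"]) (auto simp: hom_part_homogeneous)

lemma koszul_add:
  assumes "x \<in> carrier A" "y \<in> carrier A"
  shows "koszul A m (x \<oplus> y) = koszul A m x \<oplus> koszul A m y"
proof -
  let ?F = "{i. hom_part A x i \<noteq> \<zero>} \<union> {i. hom_part A y i \<noteq> \<zero>}"
  have F: "finite ?F" using assms finite_hom_part by simp
  have sub: "{i. hom_part A (x \<oplus> y) i \<noteq> \<zero>} \<subseteq> ?F" using assms by (auto simp: hom_part_add)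
  show ?thesis
    using assms F sub
    by (simp add: koszul_eq_finsum[of _ ?F] hom_part_add sgn_pow_add finsum_addf Pi_def)
qed

lemma koszul_even: "x \<in> carrier A \<Longrightarrow> even m \<Longrightarrow> koszul A m x = x"
  by (simp add: koszul_def sgn_pow_def finsum_hom_part finite_hom_part)

lemma koszul_odd: "odd m \<Longrightarrow> koszul A m x = koszul A 1 x"
  by (simp add: koszul_def sgn_pow_def)

lemma koszul_grade: "x \<in> grade A i \<Longrightarrow> koszul A m x \<in> grade A i"
  using koszul_homogeneous grade_sgn_pow by metis

lemma koszul_zero [simp]: "koszul A m \<zero> = \<zero>"
  using koszul_homogeneous[OF grade_zero, of m 0] by simp

lemma koszul_one [simp]: "koszul A m \<one> = \<one>"
  using koszul_homogeneous[OF one_grade, of m] by (simp add: sgn_pow_def)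

lemma koszul_minus: "x \<in> carrier A \<Longrightarrow> koszul A m (\<ominus> x) = \<ominus> koszul A m x"
  using koszul_add[of "\<ominus> x" x m] by (metis a_inv_closed koszul_closed koszul_zero l_neg minus_equality)

lemma koszul_sgn_pow: "x \<in> carrier A \<Longrightarrow> koszul A m (sgn_pow A k x) = sgn_pow A k (koszul A m x)"
  by (simp add: sgn_pow_def koszul_minus)

lemma koszul_koszul: "x \<in> carrier A \<Longrightarrow> koszul A m (koszul A k x) = koszul A (m + k) x"
proof (induction x rule: homogeneous_induct)
  case (homogeneous i x)
  then show ?case
    by (simp add: koszul_homogeneous koszul_homogeneous[OF grade_sgn_pow] sgn_pow_sgn_pow algebra_simps)
qed (simp add: koszul_add)

lemma koszul_involution [simp]: "x \<in> carrier A \<Longrightarrow> koszul A (Suc 0) (koszul A (Suc 0) x) = x"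
  by (simp add: koszul_koszul koszul_even)

lemma koszul_smult:
  assumes "a \<in> carrier K"
  shows "x \<in> carrier A \<Longrightarrow> koszul A m (a \<odot> x) = a \<odot> koszul A m x"
proof (induction x rule: homogeneous_induct)
  case (homogeneous i x)
  then show ?case using assms koszul_homogeneous[OF grade_smult[OF assms homogeneous]]
    by (simp add: koszul_homogeneous sgn_pow_def smult_r_minus)
qed (use assms in \<open>simp add: koszul_add smult_r_distr\<close>)

text \<open>Degrees add in products, so the sign with exponent \<open>m\<close> times the degree is
  multiplicative; additivity in each factor does the rest.\<close>

lemma koszul_mult:
  assumes y: "y \<in> carrier A"
  shows "x \<in> carrier A \<Longrightarrow> koszul A m (x \<otimes> y) = koszul A m x \<otimes> koszul A m y"
proof (induction x rule: homogeneous_induct)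
  case (homogeneous i x)
  show ?case using y
  proof (induction y rule: homogeneous_induct)
    case (homogeneous j y)
    then show ?case using \<open>x \<in> grade A i\<close> mult_grade[of x i y j]
      by (simp add: koszul_homogeneous sgn_pow_l_mult sgn_pow_r_mult sgn_pow_sgn_pow algebra_simps)
  qed (use \<open>x \<in> grade A i\<close> in \<open>simp add: koszul_add r_distr\<close>)
qed (use y in \<open>simp add: koszul_add l_distr\<close>)

text \<open>The exponent \<open>i * j\<close> is even whatever \<open>i\<close> is. This makes the
  elements \<open>e\<close> central, so the ideals they generate are two-sided.\<close>

lemma graded_commute_even:
  assumes "y \<in> grade A j" "even j"
  shows "x \<in> carrier A \<Longrightarrow> x \<otimes> y = y \<otimes> x"
proof (induction x rule: homogeneous_induct)
  case (homogeneous i x)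
  then show ?case using graded_commute[of x i y j] assms by (simp add: sgn_pow_def)
qed (use assms in \<open>simp add: r_distr l_distr\<close>)

lemma hom_part_mult_homogeneous:
  assumes "y \<in> grade A j" "x \<in> carrier A"
  shows "hom_part A (y \<otimes> x) i = (if j \<le> i then y \<otimes> hom_part A x (i - j) else \<zero>)"
  using assms(2)
proof (induction x rule: homogeneous_induct)
  case (homogeneous k x)
  then show ?case using hom_part_homogeneous[OF mult_grade[OF assms(1), of x k]] assms
    by (auto simp: hom_part_homogeneous)
qed (use assms in \<open>simp add: hom_part_add r_distr\<close>)

end

section \<open>Images and quotients of graded algebras\<close>

text \<open>One transfer principle for quotients, for changes of record and for the passage from
  pairs to functions. The identities of \<open>A\<close> pass to the image at once; only uniqueness
  of decompositions can fail there, and it is saved by the assumption that the kernel is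
  homogeneous.\<close>

lemma comm_graded_algebra_image:
  assumes "comm_graded_algebra K A"
    and carrier: "f ` carrier A = carrier B"
    and grade: "\<And>i. f ` grade A i = grade B i"
    and zero: "f \<zero>\<^bsub>A\<^esub> = \<zero>\<^bsub>B\<^esub>" and one: "f \<one>\<^bsub>A\<^esub> = \<one>\<^bsub>B\<^esub>"
    and add: "\<And>x y. \<lbrakk>x \<in> carrier A; y \<in> carrier A\<rbrakk> \<Longrightarrow> f (x \<oplus>\<^bsub>A\<^esub> y) = f x \<oplus>\<^bsub>B\<^esub> f y"
    and mult: "\<And>x y. \<lbrakk>x \<in> carrier A; y \<in> carrier A\<rbrakk> \<Longrightarrow> f (x \<otimes>\<^bsub>A\<^esub> y) = f x \<otimes>\<^bsub>B\<^esub> f y"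
    and smult: "\<And>a x. \<lbrakk>a \<in> carrier K; x \<in> carrier A\<rbrakk> \<Longrightarrow> f (a \<odot>\<^bsub>A\<^esub> x) = a \<odot>\<^bsub>B\<^esub> f x"
    and kernel: "\<And>x i. \<lbrakk>x \<in> carrier A; f x = \<zero>\<^bsub>B\<^esub>\<rbrakk> \<Longrightarrow> f (hom_part A x i) = \<zero>\<^bsub>B\<^esub>"
  shows "comm_graded_algebra K B"
proof -
  interpret graded A K by (rule graded.intro) fact
  have closed: "f x \<in> carrier B" if "x \<in> carrier A" for x
    using that carrier by blast
  have gclosed: "f x \<in> grade B i" if "x \<in> grade A i" for x i
    using that grade by blast
  have pre: "\<exists>x. x \<in> carrier A \<and> y = f x" if "y \<in> carrier B" for y
    using that carrier by blast
  \<comment> \<open>Oriented so that simplification gathers an expression of \<open>B\<close> in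
    images into \<open>f\<close> of an expression of \<open>A\<close>, where the axioms are
    known.\<close>
  note hom = zero[symmetric] one[symmetric] add[symmetric] mult[symmetric] smult[symmetric]
  have group: "abelian_group B"
  proof (rule abelian_groupI)
    show "\<zero>\<^bsub>B\<^esub> \<in> carrier B" using zero closed by (metis zero_closed)
    fix x y assume "x \<in> carrier B" "y \<in> carrier B"
    then obtain x' y' where x': "x' \<in> carrier A" "x = f x'" and y': "y' \<in> carrier A" "y = f y'"
      using pre by meson
    show "x \<oplus>\<^bsub>B\<^esub> y \<in> carrier B" "\<zero>\<^bsub>B\<^esub> \<oplus>\<^bsub>B\<^esub> x = x"
      using x' y' by (simp_all add: closed hom)
    show "x \<oplus>\<^bsub>B\<^esub> y = y \<oplus>\<^bsub>B\<^esub> x"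
      using x' y' by (simp add: hom a_comm)
    have "f (\<ominus>\<^bsub>A\<^esub> x') \<oplus>\<^bsub>B\<^esub> x = \<zero>\<^bsub>B\<^esub>" using x' by (simp add: hom l_neg)
    then show "\<exists>y\<in>carrier B. y \<oplus>\<^bsub>B\<^esub> x = \<zero>\<^bsub>B\<^esub>" using x' closed by blast
    fix z assume "z \<in> carrier B"
    then obtain z' where z': "z' \<in> carrier A" "z = f z'" using pre by meson
    then show "(x \<oplus>\<^bsub>B\<^esub> y) \<oplus>\<^bsub>B\<^esub> z = x \<oplus>\<^bsub>B\<^esub> (y \<oplus>\<^bsub>B\<^esub> z)"
      using x' y' by (simp add: hom a_assoc)
  qed
  interpret B: abelian_group B by fact
  have "monoid B"
  proof (rule monoidI)
    show "\<one>\<^bsub>B\<^esub> \<in> carrier B" using one closed by (metis one_closed)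
    fix x y assume "x \<in> carrier B" "y \<in> carrier B"
    then obtain x' y' where x': "x' \<in> carrier A" "x = f x'" and y': "y' \<in> carrier A" "y = f y'"
      using pre by meson
    show "x \<otimes>\<^bsub>B\<^esub> y \<in> carrier B" "\<one>\<^bsub>B\<^esub> \<otimes>\<^bsub>B\<^esub> x = x" "x \<otimes>\<^bsub>B\<^esub> \<one>\<^bsub>B\<^esub> = x"
      using x' y' by (simp_all add: closed hom)
    fix z assume "z \<in> carrier B"
    then obtain z' where z': "z' \<in> carrier A" "z = f z'" using pre by meson
    then show "(x \<otimes>\<^bsub>B\<^esub> y) \<otimes>\<^bsub>B\<^esub> z = x \<otimes>\<^bsub>B\<^esub> (y \<otimes>\<^bsub>B\<^esub> z)"
      using x' y' by (simp add: hom m_assoc)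
  qed
  then have ring: "ring B"
  proof (rule ringI[OF group])
    fix x y z assume "x \<in> carrier B" "y \<in> carrier B" "z \<in> carrier B"
    then obtain x' y' z' where x': "x' \<in> carrier A" "x = f x'" and y': "y' \<in> carrier A" "y = f y'"
      and z': "z' \<in> carrier A" "z = f z'"
      using pre by meson
    then show "(x \<oplus>\<^bsub>B\<^esub> y) \<otimes>\<^bsub>B\<^esub> z = x \<otimes>\<^bsub>B\<^esub> z \<oplus>\<^bsub>B\<^esub> y \<otimes>\<^bsub>B\<^esub> z"
        "z \<otimes>\<^bsub>B\<^esub> (x \<oplus>\<^bsub>B\<^esub> y) = z \<otimes>\<^bsub>B\<^esub> x \<oplus>\<^bsub>B\<^esub> z \<otimes>\<^bsub>B\<^esub> y"
      by (simp_all add: hom l_distr r_distr)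
  qed
  have neg: "f (\<ominus>\<^bsub>A\<^esub> x) = \<ominus>\<^bsub>B\<^esub> f x" if "x \<in> carrier A" for x
    using that by (intro B.minus_equality[symmetric]) (simp_all add: hom closed l_neg)
  have sgn: "f (sgn_pow A m x) = sgn_pow B m (f x)" if "x \<in> carrier A" for m x
    using that by (simp add: sgn_pow_def neg)
  have fsum: "f (finsum A c F) = finsum B (\<lambda>i. f (c i)) F" if "finite F" "c \<in> F \<rightarrow> carrier A"
    for c and F :: "nat set"
    using that
    by (induction F rule: finite_induct)
       (auto simp: zero finsum_insert add Pi_def finsum_closed closed)
  show ?thesis
  proof (rule comm_graded_algebraI)
    show "grade B i \<subseteq> carrier B" for i
      using closed unfolding grade[symmetric] by auto
    show "\<zero>\<^bsub>B\<^esub> \<in> grade B i" for i using gclosed zero by (metis grade_zero)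
    show "\<one>\<^bsub>B\<^esub> \<in> grade B 0" using gclosed one by (metis one_grade)
    show "x \<oplus>\<^bsub>B\<^esub> y \<in> grade B i" if "x \<in> grade B i" "y \<in> grade B i" for i x y
      using that unfolding grade[symmetric] by (auto simp: hom)
    show "a \<odot>\<^bsub>B\<^esub> x \<in> grade B i" if "a \<in> carrier K" "x \<in> grade B i" for i a x
      using that unfolding grade[symmetric] by (auto simp: hom)
    show "x \<otimes>\<^bsub>B\<^esub> y \<in> grade B (i + j)" if "x \<in> grade B i" "y \<in> grade B j" for i j x y
      using that unfolding grade[symmetric] by (auto simp: hom mult_grade)
    show "x \<otimes>\<^bsub>B\<^esub> y = sgn_pow B (i * j) (y \<otimes>\<^bsub>B\<^esub> x)" if "x \<in> grade B i" "y \<in> grade B j" for i j x y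
      using that unfolding grade[symmetric]
      by (auto simp: hom sgn[symmetric] graded_commute[of _ i _ j])
  next
    fix x assume "x \<in> carrier B"
    then obtain x' where x': "x' \<in> carrier A" "x = f x'" using pre by meson
    let ?F = "{i. hom_part A x' i \<noteq> \<zero>\<^bsub>A\<^esub>}"
    have "finite ?F \<and> (\<forall>i. f (hom_part A x' i) \<in> grade B i) \<and>
        (\<forall>i. i \<notin> ?F \<longrightarrow> f (hom_part A x' i) = \<zero>\<^bsub>B\<^esub>) \<and> x = finsum B (\<lambda>i. f (hom_part A x' i)) ?F"
      using x' fsum[of ?F "hom_part A x'"] finsum_hom_part[of x' ?F]
      by (auto simp: finite_hom_part zero gclosed)
    then show "\<exists>F c. finite F \<and> (\<forall>i. c i \<in> grade B i) \<and> (\<forall>i. i \<notin> F \<longrightarrow> c i = \<zero>\<^bsub>B\<^esub>) \<and> x = finsum B c F"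
      by (intro exI[of _ ?F] exI[of _ "\<lambda>i. f (hom_part A x' i)"])
  next
    fix F c and i :: nat
    assume F: "finite F" "\<And>i. c i \<in> grade B i" "finsum B c F = \<zero>\<^bsub>B\<^esub>" "i \<in> F"
    \<comment> \<open>Homogeneous lifts \<open>b\<close> of the terms \<open>c\<close>: their sum
      lies in the kernel, and homogeneity of the kernel puts each component \<open>b i\<close> with
      \<open>i\<close> in \<open>F\<close> there as well.\<close>
    have "\<forall>i. \<exists>x. x \<in> grade A i \<and> f x = c i" using F(2) grade by (metis imageE)
    then obtain b where b: "\<And>i. b i \<in> grade A i" "\<And>i. f (b i) = c i" by metis
    then have bc: "b i \<in> carrier A" for i using grade_carrier by blast
    have "f (finsum A b F) = \<zero>\<^bsub>B\<^esub>" using fsum[OF F(1), of b] b bc F by simp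
    then have "f (hom_part A (finsum A b F) i) = \<zero>\<^bsub>B\<^esub>" by (intro kernel finsum_closed) (auto simp: bc)
    moreover have "hom_part A (finsum A b F) = (\<lambda>i. if i \<in> F then b i else \<zero>\<^bsub>A\<^esub>)"
      by (rule hom_part_unique[of F]) (use F(1) b bc in \<open>auto intro!: finsum_cong'\<close>)
    ultimately show "c i = \<zero>\<^bsub>B\<^esub>" using F(4) b by simp
  next
    fix a b x assume a: "a \<in> carrier K" and b: "b \<in> carrier K" and "x \<in> carrier B"
    then obtain x' where x': "x' \<in> carrier A" "x = f x'" using pre by meson
    then show "(a \<oplus>\<^bsub>K\<^esub> b) \<odot>\<^bsub>B\<^esub> x = a \<odot>\<^bsub>B\<^esub> x \<oplus>\<^bsub>B\<^esub> b \<odot>\<^bsub>B\<^esub> x"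
      "(a \<otimes>\<^bsub>K\<^esub> b) \<odot>\<^bsub>B\<^esub> x = a \<odot>\<^bsub>B\<^esub> (b \<odot>\<^bsub>B\<^esub> x)"
      using a b by (simp_all add: hom smult_l_distr smult_assoc1)
  next
    show "a \<odot>\<^bsub>B\<^esub> x \<in> carrier B" if "a \<in> carrier K" "x \<in> carrier B" for a x
      using that pre[of x] closed by (auto simp: hom)
    show "\<one>\<^bsub>K\<^esub> \<odot>\<^bsub>B\<^esub> x = x" if "x \<in> carrier B" for x
      using that pre[of x] by (auto simp: hom)
  next
    fix a x y assume a: "a \<in> carrier K" and "x \<in> carrier B" "y \<in> carrier B"
    then obtain x' y' where x': "x' \<in> carrier A" "x = f x'" and y': "y' \<in> carrier A" "y = f y'"
      using pre by meson
    then show "a \<odot>\<^bsub>B\<^esub> (x \<oplus>\<^bsub>B\<^esub> y) = a \<odot>\<^bsub>B\<^esub> x \<oplus>\<^bsub>B\<^esub> a \<odot>\<^bsub>B\<^esub> y"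
      "(a \<odot>\<^bsub>B\<^esub> x) \<otimes>\<^bsub>B\<^esub> y = a \<odot>\<^bsub>B\<^esub> (x \<otimes>\<^bsub>B\<^esub> y)" "x \<otimes>\<^bsub>B\<^esub> (a \<odot>\<^bsub>B\<^esub> y) = a \<odot>\<^bsub>B\<^esub> (x \<otimes>\<^bsub>B\<^esub> y)"
      using a by (simp_all add: hom smult_r_distr smult_mult_left smult_mult_right)
  qed (use ring field_axioms in auto)
qed

lemma is_cdga_image:
  fixes A :: "('k, 'a, 'm) cdga_scheme" and B :: "('k, 'b, 'n) cdga_scheme"
  assumes "is_cdga K A"
    and carrier: "f ` carrier A = carrier B"
    and grade: "\<And>i. f ` grade A i = grade B i"
    and zero: "f \<zero>\<^bsub>A\<^esub> = \<zero>\<^bsub>B\<^esub>" and one: "f \<one>\<^bsub>A\<^esub> = \<one>\<^bsub>B\<^esub>"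
    and add: "\<And>x y. \<lbrakk>x \<in> carrier A; y \<in> carrier A\<rbrakk> \<Longrightarrow> f (x \<oplus>\<^bsub>A\<^esub> y) = f x \<oplus>\<^bsub>B\<^esub> f y"
    and mult: "\<And>x y. \<lbrakk>x \<in> carrier A; y \<in> carrier A\<rbrakk> \<Longrightarrow> f (x \<otimes>\<^bsub>A\<^esub> y) = f x \<otimes>\<^bsub>B\<^esub> f y"
    and smult: "\<And>a x. \<lbrakk>a \<in> carrier K; x \<in> carrier A\<rbrakk> \<Longrightarrow> f (a \<odot>\<^bsub>A\<^esub> x) = a \<odot>\<^bsub>B\<^esub> f x"
    and kernel: "\<And>x i. \<lbrakk>x \<in> carrier A; f x = \<zero>\<^bsub>B\<^esub>\<rbrakk> \<Longrightarrow> f (hom_part A x i) = \<zero>\<^bsub>B\<^esub>"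
    and diff: "\<And>x. x \<in> carrier A \<Longrightarrow> f (differential A x) = differential B (f x)"
  shows "is_cdga K B"
proof -
  interpret is_cdga K A by fact
  interpret A: graded A K by (rule graded.intro) unfold_locales
  have "comm_graded_algebra K B"
    by (rule comm_graded_algebra_image[of K A f]) (fact assms comm_graded_algebra_axioms)+
  then interpret B: graded B K by (rule graded.intro)
  have closed: "f x \<in> carrier B" if "x \<in> carrier A" for x
    using that carrier by blast
  note hom = zero[symmetric] add[symmetric] mult[symmetric] smult[symmetric] diff[symmetric]
  have neg: "f (\<ominus>\<^bsub>A\<^esub> x) = \<ominus>\<^bsub>B\<^esub> f x" if "x \<in> carrier A" for x
    using that by (intro B.minus_equality[symmetric]) (simp_all add: hom closed l_neg)
  have sgn: "sgn_pow B m (f x) = f (sgn_pow A m x)" if "x \<in> carrier A" for m x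
    using that by (simp add: sgn_pow_def neg)
  show ?thesis
  proof (intro is_cdga.intro is_cdga_axioms.intro)
    show "differential B (x \<otimes>\<^bsub>B\<^esub> y) = (differential B x \<otimes>\<^bsub>B\<^esub> y) \<oplus>\<^bsub>B\<^esub> sgn_pow B i (x \<otimes>\<^bsub>B\<^esub> differential B y)"
      if "x \<in> grade B i" "y \<in> carrier B" for x y i
      using that unfolding grade[symmetric] carrier[symmetric]
      by (auto simp: hom sgn leibniz d_closed)
    show "differential B x \<in> grade B (Suc i)" if "x \<in> grade B i" for x i
      using that unfolding grade[symmetric] by (auto simp: hom d_grade)
  qed (use B.comm_graded_algebra_axioms in \<open>auto simp: carrier[symmetric] hom d_closed d_add d_smult d_d\<close>)
qed

locale homogeneous_ideal = graded A K + ideal I A for A (structure) and K and I +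
  assumes hom_part_mem: "x \<in> I \<Longrightarrow> hom_part A x i \<in> I"
begin

text \<open>A scalar acts as multiplication by \<open>a \<odot> \<one>\<close>, so a ring ideal is
  automatically a subspace.\<close>

lemma smult_mem: "\<lbrakk>a \<in> carrier K; x \<in> I\<rbrakk> \<Longrightarrow> a \<odot> x \<in> I"
  using I_l_closed[of x "a \<odot> \<one>"] smult_mult_left[of a \<one> x] a_Hcarr by simp

lemma coset_eq_iff: "\<lbrakk>x \<in> carrier A; y \<in> carrier A\<rbrakk> \<Longrightarrow> I +> x = I +> y \<longleftrightarrow> x \<ominus> y \<in> I"
  using quotient_eq_iff_same_a_r_cos[OF ideal_axioms] by simp

lemma coset_eq_self_iff: "x \<in> carrier A \<Longrightarrow> I +> x = I \<longleftrightarrow> x \<in> I"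
  using coset_eq_iff[of x \<zero>] a_coset_add_zero[OF a_subset] by (simp add: minus_eq)

text \<open>Evaluates the union by which \<open>quot_alg\<close> defines its scalar multiplication:
  changing the representative by an element of \<open>I\<close> changes the multiple by an element
  of \<open>I\<close>, so all cosets in the union agree, and there is at least one.\<close>

lemma quot_smult:
  assumes "a \<in> carrier K" "x \<in> carrier A"
  shows "(\<Union>y\<in>I +> x. I +> a \<odot> y) = I +> a \<odot> x"
proof -
  have "I +> a \<odot> y = I +> a \<odot> x" if y: "y \<in> I +> x" for y
  proof -
    obtain h where h: "h \<in> I" "y = h \<oplus> x" using y by (auto simp: a_r_coset_def r_coset_def)
    have "a \<odot> y \<ominus> a \<odot> x = a \<odot> h"
      using h assms a_Hcarr[of h] by (simp add: smult_r_distr minus_eq a_assoc r_neg)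
    then show ?thesis
      using h assms a_Hcarr[of h] smult_mem by (subst coset_eq_iff) auto
  qed
  moreover have "x \<in> I +> x" using a_rcos_self assms by simp
  ultimately show ?thesis by blast
qed

lemma comm_graded_algebra_quot: "comm_graded_algebra K (quot_alg A I)"
proof (rule comm_graded_algebra_image)
  show "comm_graded_algebra K A" by unfold_locales
  show "(+>) I ` carrier A = carrier (quot_alg A I)"
    by (auto simp: quot_alg_def FactRing_def A_RCOSETS_def')
  show "(+>) I ` grade A i = grade (quot_alg A I) i" for i
    by (simp add: quot_alg_def)
  show "I +> \<zero> = \<zero>\<^bsub>quot_alg A I\<^esub>"
    by (simp add: quot_alg_def FactRing_def a_coset_add_zero[OF a_subset])
  show "I +> a \<odot> x = a \<odot>\<^bsub>quot_alg A I\<^esub> (I +> x)" if "a \<in> carrier K" "x \<in> carrier A" for a x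
    using quot_smult[OF that] by (simp add: quot_alg_def)
  show "I +> hom_part A x i = \<zero>\<^bsub>quot_alg A I\<^esub>" if "x \<in> carrier A" "I +> x = \<zero>\<^bsub>quot_alg A I\<^esub>" for x i
    using that hom_part_mem by (simp add: quot_alg_def FactRing_def coset_eq_self_iff)
qed (use ring_hom_mult[OF rcos_ring_hom] ring_hom_add[OF rcos_ring_hom] ring_hom_one[OF rcos_ring_hom]
      in \<open>simp_all add: quot_alg_def\<close>)

end

lemma with_zero_diff_simps [simp]:
  "carrier (with_zero_diff A) = carrier A" "mult (with_zero_diff A) = mult A"
  "one (with_zero_diff A) = one A" "zero (with_zero_diff A) = zero A"
  "add (with_zero_diff A) = add A" "smult (with_zero_diff A) = smult A"
  "grade (with_zero_diff A) = grade A" "differential (with_zero_diff A) x = \<zero>\<^bsub>A\<^esub>"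
  by (simp_all add: with_zero_diff_def)

lemma is_cdga_with_zero_diff:
  assumes "comm_graded_algebra K A"
  shows "is_cdga K (with_zero_diff A)"
proof -
  interpret graded A K by (rule graded.intro) fact
  have "comm_graded_algebra K (with_zero_diff A)"
    by (rule comm_graded_algebra_image[OF assms, of id]) auto
  then interpret W: graded "with_zero_diff A" K by (rule graded.intro)
  show ?thesis
    using W.sgn_pow_zero by unfold_locales auto
qed

section \<open>Cohomology of a cdga\<close>

locale cdga = is_cdga K A for A (structure) and K

sublocale cdga \<subseteq> graded A K
  by (rule graded.intro) (rule comm_graded_algebra_axioms)

context cdga
begin

abbreviation d :: "'c \<Rightarrow> 'c" where "d \<equiv> differential A"

lemma d_zero [simp]: "d \<zero> = \<zero>"
  using d_grade[OF grade_zero] d_add[of \<zero> \<zero>] d_closed[of \<zero>] by (metis l_zero zero_closed add.r_cancel_one)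

lemma d_minus: "x \<in> carrier A \<Longrightarrow> d (\<ominus> x) = \<ominus> d x"
  using d_add[of "\<ominus> x" x] d_closed by (metis a_inv_closed d_zero l_neg minus_equality)

lemma d_sgn_pow: "x \<in> carrier A \<Longrightarrow> d (sgn_pow A m x) = sgn_pow A m (d x)"
  by (simp add: sgn_pow_def d_minus)

text \<open>The differential raises degrees by one, so the sign involution anticommutes with
  it.\<close>

lemma koszul_d: "x \<in> carrier A \<Longrightarrow> koszul A (Suc 0) (d x) = \<ominus> d (koszul A (Suc 0) x)"
proof (induction x rule: homogeneous_induct)
  case (homogeneous i x)
  then show ?case using d_closed[of x]
    by (simp add: koszul_homogeneous koszul_homogeneous[OF d_grade] d_sgn_pow) (simp add: sgn_pow_def)
qed (simp add: d_add koszul_add d_closed minus_add)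

text \<open>The Leibniz rule without reference to a degree: the sign has moved into the involution,
  so \<open>x\<close> may be inhomogeneous.\<close>

lemma d_mult:
  assumes y: "y \<in> carrier A"
  shows "x \<in> carrier A \<Longrightarrow> d (x \<otimes> y) = (d x \<otimes> y) \<oplus> (koszul A (Suc 0) x \<otimes> d y)"
proof (induction x rule: homogeneous_induct)
  case (homogeneous i x)
  then show ?case using y
    by (simp add: koszul_homogeneous leibniz sgn_pow_l_mult d_closed)
next
  case (add u v)
  then show ?case using y
    by (simp add: koszul_add d_add l_distr d_closed a_ac)
qed

text \<open>Components of cocycles and of coboundaries are again such because of this shift. Index 0
  is split off since \<open>i - 1\<close> is truncated there.\<close>

lemma hom_part_d: "x \<in> carrier A \<Longrightarrow> hom_part A (d x) i = (if i = 0 then \<zero> else d (hom_part A x (i - 1)))"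
proof (induction x rule: homogeneous_induct)
  case (homogeneous j x)
  then show ?case
    by (auto simp: hom_part_homogeneous hom_part_homogeneous[OF d_grade])
qed (simp add: d_add hom_part_add d_closed)

lemma cocycles_hom_part:
  assumes "x \<in> cocycles A"
  shows "hom_part A x i \<in> cocycles A"
  using assms hom_part_d[of x "Suc i"] by (simp add: cocycles_def)

lemma cocycles_carrier: "x \<in> cocycles A \<Longrightarrow> x \<in> carrier A"
  by (simp add: cocycles_def)

lemma coboundaries_subset_cocycles: "coboundaries A \<subseteq> cocycles A"
  by (auto simp: cocycles_def coboundaries_def d_closed d_d)

text \<open>The subalgebra occurring in the definition of \<open>cohomology\<close>. It shares its
  operations with \<open>A\<close>, but \<open>finsum\<close> and negation depend on the carrier and
  have to be compared with those of \<open>A\<close> separately.\<close>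

abbreviation cocycle_alg where
  "cocycle_alg \<equiv> A\<lparr>carrier := cocycles A, grade := (\<lambda>i. cocycles A \<inter> grade A i)\<rparr>"

lemma ring_cocycle_alg: "ring cocycle_alg"
proof (rule ringI)
  show "abelian_group cocycle_alg"
  proof (rule abelian_groupI)
    fix x assume "x \<in> carrier cocycle_alg"
    then show "\<exists>y\<in>carrier cocycle_alg. y \<oplus>\<^bsub>cocycle_alg\<^esub> x = \<zero>\<^bsub>cocycle_alg\<^esub>"
      by (intro bexI[of _ "\<ominus> x"]) (auto simp: cocycles_def d_minus l_neg)
  qed (auto simp: cocycles_def d_add a_ac)
  show "monoid cocycle_alg"
    using d_mult[of \<one> \<one>] d_closed[of \<one>]
    by (intro monoidI) (auto simp: cocycles_def d_mult m_assoc)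
qed (auto simp: cocycles_def l_distr r_distr)

lemma finsum_cocycle_alg:
  assumes "finite F" "c \<in> F \<rightarrow> cocycles A"
  shows "finsum cocycle_alg c F = finsum A c F"
proof -
  interpret Z: ring cocycle_alg by (rule ring_cocycle_alg)
  show ?thesis
    using assms
  proof (induction F rule: finite_induct)
    case (insert i F)
    then have "c \<in> F \<rightarrow> carrier cocycle_alg" "c i \<in> carrier cocycle_alg"
      "c \<in> F \<rightarrow> carrier A" "c i \<in> carrier A"
      by (auto dest: cocycles_carrier)
    then show ?case
      using insert Z.finsum_insert[OF insert(1,2), of c] finsum_insert[OF insert(1,2), of c] by auto
  qed simp
qed

lemma sgn_pow_cocycle_alg:
  assumes "x \<in> cocycles A"
  shows "sgn_pow cocycle_alg m x = sgn_pow A m x"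
proof -
  interpret Z: ring cocycle_alg by (rule ring_cocycle_alg)
  have "\<ominus>\<^bsub>cocycle_alg\<^esub> x = \<ominus> x"
    by (rule Z.minus_equality) (use assms in \<open>auto simp: cocycles_def d_minus l_neg\<close>)
  then show ?thesis by (simp add: sgn_pow_def)
qed

lemma comm_graded_algebra_cocycle_alg: "comm_graded_algebra K cocycle_alg"
proof (rule comm_graded_algebraI)
  show "ring cocycle_alg" by (rule ring_cocycle_alg)
  interpret Z: ring cocycle_alg by (rule ring_cocycle_alg)
  fix x assume "x \<in> carrier cocycle_alg"
  then have x: "x \<in> cocycles A" "x \<in> carrier A" by (auto dest: cocycles_carrier)
  let ?F = "{i. hom_part A x i \<noteq> \<zero>}"
  show "\<exists>F c. finite F \<and> (\<forall>i. c i \<in> grade cocycle_alg i) \<and> (\<forall>i. i \<notin> F \<longrightarrow> c i = \<zero>\<^bsub>cocycle_alg\<^esub>)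
      \<and> x = finsum cocycle_alg c F"
    by (intro exI[of _ ?F] exI[of _ "hom_part A x"])
      (use x in \<open>auto simp: finite_hom_part cocycles_hom_part finsum_cocycle_alg finsum_hom_part\<close>)
next
  fix F c and i :: nat
  assume F: "finite F" "\<And>i. c i \<in> grade cocycle_alg i" "finsum cocycle_alg c F = \<zero>\<^bsub>cocycle_alg\<^esub>" "i \<in> F"
  then have c: "c i \<in> cocycles A" "c i \<in> grade A i" "c i \<in> carrier A" for i
    using cocycles_carrier by auto
  have "finsum A c F = \<zero>" using F c by (simp add: finsum_cocycle_alg)
  then show "c i = \<zero>\<^bsub>cocycle_alg\<^esub>" using homogeneous_sum_zero[of F c i] F c by simp
next
  fix i j x y assume "x \<in> grade cocycle_alg i" "y \<in> grade cocycle_alg j"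
  then show "x \<otimes>\<^bsub>cocycle_alg\<^esub> y = sgn_pow cocycle_alg (i * j) (y \<otimes>\<^bsub>cocycle_alg\<^esub> x)"
    using graded_commute[of x i y j]
    by (subst sgn_pow_cocycle_alg) (auto simp: cocycles_def d_mult)
next
  have "d \<one> = \<zero>" using d_mult[of \<one> \<one>] d_closed[of \<one>] by simp
  then show "\<one>\<^bsub>cocycle_alg\<^esub> \<in> grade cocycle_alg 0"
    by (simp add: cocycles_def one_grade)
qed (auto simp: cocycles_def smult_l_distr smult_r_distr smult_assoc1 smult_mult_left smult_mult_right
    d_add d_mult d_smult mult_grade grade_add grade_smult field_axioms)

text \<open>For a cocycle \<open>x\<close>, the product \<open>d w \<otimes> x\<close> is
  \<open>d (w \<otimes> x)\<close>. On the other side \<open>x \<otimes> d w\<close> is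
  \<open>d (koszul A (Suc 0) x \<otimes> w)\<close>: the twisted \<open>x\<close> is again a
  cocycle, and the sign in the Leibniz rule untwists it.\<close>

lemma homogeneous_ideal_coboundaries: "homogeneous_ideal cocycle_alg K (coboundaries A)"
proof -
  interpret Z: graded cocycle_alg K
    by (rule graded.intro) (rule comm_graded_algebra_cocycle_alg)
  have inv: "inv\<^bsub>add_monoid cocycle_alg\<^esub> x = \<ominus> x" if "x \<in> cocycles A" for x
    using sgn_pow_cocycle_alg[OF that, of 1] by (simp add: sgn_pow_def a_inv_def)
  have "ideal (coboundaries A) cocycle_alg"
  proof (rule idealI)
    show "ring cocycle_alg" by (rule ring_cocycle_alg)
    show "subgroup (coboundaries A) (add_monoid cocycle_alg)"
    proof (rule subgroup.intro)
      show "inv\<^bsub>add_monoid cocycle_alg\<^esub> x \<in> coboundaries A" if "x \<in> coboundaries A" for x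
        using that coboundaries_subset_cocycles inv[of x]
        by (auto simp: coboundaries_def d_minus[symmetric])
      show "\<one>\<^bsub>add_monoid cocycle_alg\<^esub> \<in> coboundaries A"
        using d_zero by (auto simp: coboundaries_def intro: rev_image_eqI[of \<zero>])
    qed (use coboundaries_subset_cocycles in \<open>auto simp: coboundaries_def d_add[symmetric]\<close>)
  next
    fix a x assume "a \<in> coboundaries A" "x \<in> carrier cocycle_alg"
    then obtain w where w: "w \<in> carrier A" "a = d w" and x: "x \<in> carrier A" "d x = \<zero>"
      by (auto simp: coboundaries_def cocycles_def)
    have "\<ominus> d (koszul A (Suc 0) x) = \<zero>"
      using x koszul_d[of x] by simp
    then have "d (koszul A (Suc 0) x) = \<zero>"
      using x d_closed[of "koszul A (Suc 0) x"] by (metis koszul_closed minus_minus minus_zero)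
    then have "x \<otimes> a = d (koszul A (Suc 0) x \<otimes> w)"
      using w x d_closed by (simp add: d_mult)
    then show "x \<otimes>\<^bsub>cocycle_alg\<^esub> a \<in> coboundaries A"
      using w x by (auto simp: coboundaries_def)
    have "a \<otimes> x = d (w \<otimes> x)"
      using w x d_closed by (simp add: d_mult)
    then show "a \<otimes>\<^bsub>cocycle_alg\<^esub> x \<in> coboundaries A"
      using w x by (auto simp: coboundaries_def)
  qed
  moreover have "hom_part cocycle_alg x i \<in> coboundaries A" if mem: "x \<in> coboundaries A" for x i
  proof -
    obtain w where w: "w \<in> carrier A" "x = d w" using mem by (auto simp: coboundaries_def)
    have x: "x \<in> cocycles A" "x \<in> carrier A"
      using mem coboundaries_subset_cocycles cocycles_carrier by auto
    let ?F = "{i. hom_part A x i \<noteq> \<zero>}"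
    have "hom_part cocycle_alg x = hom_part A x"
      by (rule Z.hom_part_unique[of ?F])
        (use x in \<open>auto simp: finite_hom_part cocycles_hom_part finsum_cocycle_alg finsum_hom_part\<close>)
    then show ?thesis
      using w hom_part_d[of w i] by (auto simp: coboundaries_def intro: rev_image_eqI[of \<zero>])
  qed
  ultimately show ?thesis
    by (intro homogeneous_ideal.intro homogeneous_ideal_axioms.intro Z.graded_axioms)
qed

lemma comm_graded_algebra_cohomology: "comm_graded_algebra K (cohomology A)"
  unfolding cohomology_def
  by (rule homogeneous_ideal.comm_graded_algebra_quot[OF homogeneous_ideal_coboundaries])

lemma coset_cocycle_alg: "I +>\<^bsub>cocycle_alg\<^esub> x = I +> x"
  by (simp add: a_r_coset_def r_coset_def)

lemma coboundaries_coset_eq_iff: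
  assumes "x \<in> cocycles A" "y \<in> cocycles A"
  shows "coboundaries A +> x = coboundaries A +> y \<longleftrightarrow> x \<ominus> y \<in> coboundaries A"
proof -
  interpret Z: homogeneous_ideal cocycle_alg K "coboundaries A"
    by (rule homogeneous_ideal_coboundaries)
  show ?thesis
    using Z.coset_eq_iff[of x y] assms sgn_pow_cocycle_alg[of y 1]
    by (simp add: coset_cocycle_alg sgn_pow_def a_minus_def)
qed

lemma grade_cohomology:
  "grade (cohomology A) i = (\<lambda>x. coboundaries A +> x) ` (cocycles A \<inter> grade A i)"
  by (simp add: cohomology_def quot_alg_def coset_cocycle_alg)

text \<open>
  For a target with zero differential, a class is sent to a singleton coset, so the map on
  cohomology is \<open>f\<close> itself on cocycles.
\<close>

lemma q_equivalence_zero_diffI: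
  assumes B: "comm_graded_algebra K B" and f: "f \<in> cdga_hom K A (with_zero_diff B)"
    and surj: "\<And>i y. \<lbrakk>i \<le> q; y \<in> grade B i\<rbrakk> \<Longrightarrow> \<exists>x\<in>cocycles A \<inter> grade A i. f x = y"
    and inj: "\<And>i x. \<lbrakk>i \<le> Suc q; x \<in> cocycles A \<inter> grade A i; f x = \<zero>\<^bsub>B\<^esub>\<rbrakk> \<Longrightarrow> x \<in> coboundaries A"
  shows "q_equivalence K q A (with_zero_diff B) f"
proof -
  interpret B: graded B K by (rule graded.intro) fact
  have fg: "f x \<in> grade B i" if "x \<in> grade A i" for i x
    using f that unfolding cdga_hom_def by fastforce
  have fh: "f \<in> ring_hom A B" and fd: "\<And>x. x \<in> carrier A \<Longrightarrow> f (d x) = \<zero>\<^bsub>B\<^esub>"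
    using f by (auto simp: cdga_hom_def ring_hom_def)
  note fc = ring_hom_closed[OF fh] and fa = ring_hom_add[OF fh]
  have fneg: "f (\<ominus> x) = \<ominus>\<^bsub>B\<^esub> f x" if "x \<in> carrier A" for x
    using that fa[of "\<ominus> x" x] fa[of \<zero> \<zero>] fc[of \<zero>]
    by (intro B.minus_equality[symmetric]) (simp_all add: fc l_neg)
  have cobB: "coboundaries (with_zero_diff B) = {\<zero>\<^bsub>B\<^esub>}"
    by (auto simp: coboundaries_def)
  have map: "cohomology_map (with_zero_diff B) f (coboundaries A +> x) = {f x}"
    if x: "x \<in> carrier A" for x
  proof -
    let ?W = "with_zero_diff B" and ?X = "coboundaries A +> x"
    have "coboundaries ?W +>\<^bsub>?W\<^esub> f y = {f x}" if y: "y \<in> ?X" for y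
    proof -
      obtain w where "w \<in> carrier A" "y = d w \<oplus> x"
        using y by (auto simp: a_r_coset_def r_coset_def coboundaries_def)
      then have "f y = f x" using x by (simp add: fa d_closed fd fc)
      then show ?thesis using x fc by (simp add: cobB a_r_coset_def r_coset_def)
    qed
    then have "(\<Union>y\<in>?X. coboundaries ?W +>\<^bsub>?W\<^esub> f y) = (\<Union>y\<in>?X. {f x})"
      by (intro SUP_cong refl)
    \<comment> \<open>The coset is nonempty, so the union of the constant family is
      \<open>{f x}\<close> and not the empty set.\<close>
    moreover have "x \<in> ?X"
      using x d_zero by (auto simp: a_r_coset_def r_coset_def coboundaries_def intro!: bexI[of _ \<zero>])
    ultimately show ?thesis
      unfolding cohomology_map_def by auto
  qed
  \<comment> \<open>Covers both the injectivity of the isomorphisms in degrees at most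
    \<open>q\<close> and the monomorphism in degree \<open>Suc q\<close>.\<close>
  have inj_on: "inj_on (cohomology_map (with_zero_diff B) f) (grade (cohomology A) i)"
    if i: "i \<le> Suc q" for i
  proof (rule inj_onI)
    fix X Y assume X: "X \<in> grade (cohomology A) i" and Y: "Y \<in> grade (cohomology A) i"
      and eq: "cohomology_map (with_zero_diff B) f X = cohomology_map (with_zero_diff B) f Y"
    obtain x y where x: "x \<in> cocycles A" "x \<in> grade A i" "X = coboundaries A +> x"
      and y: "y \<in> cocycles A" "y \<in> grade A i" "Y = coboundaries A +> y"
      using X Y unfolding grade_cohomology by blast
    have "f x = f y" using eq x y by (simp add: map)
    then have "f (x \<ominus> y) = \<zero>\<^bsub>B\<^esub>"
      using x y by (simp add: minus_eq fa fneg fc B.r_neg)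
    moreover have "x \<ominus> y \<in> cocycles A \<inter> grade A i"
      using x y by (auto simp: minus_eq cocycles_def d_add d_minus)
    ultimately have "x \<ominus> y \<in> coboundaries A" using inj i by blast
    then show "X = Y" using x y coboundaries_coset_eq_iff by simp
  qed
  have gr: "grade (cohomology (with_zero_diff B)) i = (\<lambda>y. {y}) ` grade B i" for i
  proof -
    interpret W: cdga "with_zero_diff B" K
      by (rule cdga.intro) (rule is_cdga_with_zero_diff[OF B])
    have "grade (cohomology (with_zero_diff B)) i
        = (\<lambda>x. {\<zero>\<^bsub>B\<^esub>} +>\<^bsub>with_zero_diff B\<^esub> x) ` (carrier B \<inter> grade B i)"
      unfolding W.grade_cohomology cobB by (simp add: cocycles_def)
    also have "\<dots> = (\<lambda>y. {y}) ` grade B i"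
      by (auto simp: a_r_coset_def r_coset_def image_iff)
    finally show ?thesis .
  qed
  have "cohomology_map (with_zero_diff B) f ` grade (cohomology A) i
      = grade (cohomology (with_zero_diff B)) i" if i: "i \<le> q" for i
  proof
    show "cohomology_map (with_zero_diff B) f ` grade (cohomology A) i
        \<subseteq> grade (cohomology (with_zero_diff B)) i"
      unfolding gr grade_cohomology by (auto simp: map fg)
    show "grade (cohomology (with_zero_diff B)) i
        \<subseteq> cohomology_map (with_zero_diff B) f ` grade (cohomology A) i"
    proof
      fix Y assume "Y \<in> grade (cohomology (with_zero_diff B)) i"
      then obtain y where y: "y \<in> grade B i" "Y = {y}" unfolding gr by blast
      then obtain x where "x \<in> cocycles A \<inter> grade A i" "f x = y" using surj i by blast
      then show "Y \<in> cohomology_map (with_zero_diff B) f ` grade (cohomology A) i"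
        using y map[of x] unfolding grade_cohomology by force
    qed
  qed
  then show ?thesis
    using f inj_on by (auto simp: q_equivalence_def bij_betw_def)
qed

end

section \<open>Adjoining one odd generator\<close>

text \<open>
  A pair \<open>(a, b)\<close> stands for \<open>a + b t\<close>, where \<open>t\<close> has odd degree \<open>m\<close> and \<open>d t = e\<close>. Since
  \<open>t a = (-1)\<^bsup>|a|\<^esup> a t\<close>, the Koszul sign involution enters the product and the differential.
\<close>

definition adjoin_odd :: "('k, 'a, 'm) cdga_scheme \<Rightarrow> nat \<Rightarrow> 'a \<Rightarrow> ('k, 'a \<times> 'a) cdga" where
  "adjoin_odd A m e =
     \<lparr>carrier = carrier A \<times> carrier A,
      mult = (\<lambda>(a, b) (a', b'). (a \<otimes>\<^bsub>A\<^esub> a', a \<otimes>\<^bsub>A\<^esub> b' \<oplus>\<^bsub>A\<^esub> b \<otimes>\<^bsub>A\<^esub> koszul A (Suc 0) a')),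
      one = (\<one>\<^bsub>A\<^esub>, \<zero>\<^bsub>A\<^esub>),
      zero = (\<zero>\<^bsub>A\<^esub>, \<zero>\<^bsub>A\<^esub>),
      add = (\<lambda>(a, b) (a', b'). (a \<oplus>\<^bsub>A\<^esub> a', b \<oplus>\<^bsub>A\<^esub> b')),
      smult = (\<lambda>k (a, b). (k \<odot>\<^bsub>A\<^esub> a, k \<odot>\<^bsub>A\<^esub> b)),
      grade = (\<lambda>i. grade A i \<times> (if m \<le> i then grade A (i - m) else {\<zero>\<^bsub>A\<^esub>})),
      differential = (\<lambda>(a, b).
        (differential A a \<oplus>\<^bsub>A\<^esub> koszul A (Suc 0) b \<otimes>\<^bsub>A\<^esub> e, differential A b))\<rparr>"

lemma adjoin_odd_simps [simp]:
  "carrier (adjoin_odd A m e) = carrier A \<times> carrier A"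
  "(a, b) \<otimes>\<^bsub>adjoin_odd A m e\<^esub> (a', b') = (a \<otimes>\<^bsub>A\<^esub> a', a \<otimes>\<^bsub>A\<^esub> b' \<oplus>\<^bsub>A\<^esub> b \<otimes>\<^bsub>A\<^esub> koszul A (Suc 0) a')"
  "\<one>\<^bsub>adjoin_odd A m e\<^esub> = (\<one>\<^bsub>A\<^esub>, \<zero>\<^bsub>A\<^esub>)"
  "\<zero>\<^bsub>adjoin_odd A m e\<^esub> = (\<zero>\<^bsub>A\<^esub>, \<zero>\<^bsub>A\<^esub>)"
  "(a, b) \<oplus>\<^bsub>adjoin_odd A m e\<^esub> (a', b') = (a \<oplus>\<^bsub>A\<^esub> a', b \<oplus>\<^bsub>A\<^esub> b')"
  "k \<odot>\<^bsub>adjoin_odd A m e\<^esub> (a, b) = (k \<odot>\<^bsub>A\<^esub> a, k \<odot>\<^bsub>A\<^esub> b)"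
  "grade (adjoin_odd A m e) i = grade A i \<times> (if m \<le> i then grade A (i - m) else {\<zero>\<^bsub>A\<^esub>})"
  "differential (adjoin_odd A m e) (a, b)
    = (differential A a \<oplus>\<^bsub>A\<^esub> koszul A (Suc 0) b \<otimes>\<^bsub>A\<^esub> e, differential A b)"
  by (simp_all add: adjoin_odd_def)

text \<open>In \<open>a + b t\<close> of degree \<open>i\<close> the coefficient \<open>b\<close>
  has degree \<open>i - m\<close>. This turns a sum over total degrees into one over degrees of
  \<open>b\<close>, where decompositions in \<open>A\<close> apply.\<close>

lemma (in abelian_monoid) finsum_shift:
  fixes g :: "nat \<Rightarrow> 'a"
  assumes "finite F" "\<And>i. g i \<in> carrier G" "\<And>i. i < m \<Longrightarrow> g i = \<zero>"
  shows "finsum G g F = (\<Oplus>j\<in>{j. j + m \<in> F}. g (j + m))"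
proof -
  let ?S = "{j. j + m \<in> F}"
  have "finsum G g F = finsum G g ((\<lambda>j. j + m) ` ?S)"
  proof (rule add.finprod_mono_neutral_cong_right)
    show "g i = \<zero>" if "i \<in> F - (\<lambda>j. j + m) ` ?S" for i
      using that assms(3)[of i] by (cases "m \<le> i") (auto simp: image_iff dest: spec[of _ "i - m"])
  qed (use assms in auto)
  also have "\<dots> = (\<Oplus>j\<in>?S. g (j + m))"
    by (rule finsum_reindex) (use assms in \<open>auto simp: inj_on_def\<close>)
  finally show ?thesis .
qed

context cdga
begin

text \<open>Oddness of \<open>m\<close> makes the degree of \<open>e\<close> even and hence
  \<open>e\<close> central; closedness of \<open>e\<close> is what the vanishing of
  \<open>d (d t)\<close> requires.\<close>

context
  fixes m :: nat and e :: 'c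
  assumes odd: "odd m" and e: "e \<in> grade A (Suc m)" and de: "d e = \<zero>"
begin

abbreviation \<sigma> where "\<sigma> \<equiv> koszul A (Suc 0)"

abbreviation "E \<equiv> adjoin_odd A m e"

lemma e_closed [simp]: "e \<in> carrier A"
  using e grade_carrier by blast

lemma e_comm: "x \<in> carrier A \<Longrightarrow> x \<otimes> e = e \<otimes> x"
  using graded_commute_even[OF e] odd by simp

lemma koszul_e [simp]: "koszul A k e = e"
  using koszul_homogeneous[OF e] odd by (simp add: sgn_pow_def)

text \<open>As \<open>m\<close> is odd, \<open>i - m\<close> has the parity of \<open>Suc i\<close>.
  The coefficient is zero if \<open>i < m\<close>, where truncated subtraction would give a wrong
  parity.\<close>

lemma koszul_shifted:
  assumes "b \<in> (if m \<le> i then grade A (i - m) else {\<zero>})"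
  shows "\<sigma> b = sgn_pow A (Suc i) b"
  using assms odd koszul_homogeneous[of b "i - m"]
  by (auto split: if_splits intro!: sgn_pow_cong)

lemma commute_shifted:
  assumes a: "a \<in> grade A i" and b: "b \<in> (if m \<le> j then grade A (j - m) else {\<zero>})"
  shows "a \<otimes> b = sgn_pow A (i * Suc j) (b \<otimes> a)"
proof (cases "m \<le> j")
  case True
  then have "a \<otimes> b = sgn_pow A (i * (j - m)) (b \<otimes> a)"
    using graded_commute[of a i b "j - m"] assms by simp
  also have "\<dots> = sgn_pow A (i * Suc j) (b \<otimes> a)"
    using True odd by (intro sgn_pow_cong) auto
  finally show ?thesis .
qed (use assms in simp)

lemma shifted_closed: "b \<in> (if m \<le> i then grade A (i - m) else {\<zero>}) \<Longrightarrow> b \<in> carrier A"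
  by (auto split: if_splits)

text \<open>Associativity rests on the multiplicativity of the sign involution, distributivity on
  its additivity.\<close>

lemma ring_adjoin_odd: "ring E"
proof (rule ringI)
  show "abelian_group E"
  proof (rule abelian_groupI)
    fix x assume "x \<in> carrier E"
    then show "\<exists>y\<in>carrier E. y \<oplus>\<^bsub>E\<^esub> x = \<zero>\<^bsub>E\<^esub>"
      by (intro bexI[of _ "(\<ominus> fst x, \<ominus> snd x)"]) (auto simp: l_neg)
  qed (auto simp: a_ac)
  show "monoid E"
    by (rule monoidI)
      (auto simp: m_assoc l_distr r_distr a_ac koszul_mult)
qed (auto simp: l_distr r_distr a_ac koszul_add)

lemma finsum_adjoin_odd:
  assumes "finite F" "c \<in> F \<rightarrow> carrier E"
  shows "finsum E c F = (finsum A (\<lambda>i. fst (c i)) F, finsum A (\<lambda>i. snd (c i)) F)"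
proof -
  interpret E: ring E by (rule ring_adjoin_odd)
  show ?thesis
    using assms
  proof (induction F rule: finite_induct)
    case (insert i F)
    obtain a b where ab: "c i = (a, b)" "a \<in> carrier A" "b \<in> carrier A" using insert.prems by (cases "c i") auto
    have cl: "(\<lambda>i. fst (c i)) \<in> F \<rightarrow> carrier A" "(\<lambda>i. snd (c i)) \<in> F \<rightarrow> carrier A" using insert.prems by (auto simp: Pi_def mem_Times_iff)
    have "finsum E c (insert i F) = c i \<oplus>\<^bsub>E\<^esub> finsum E c F"
      using insert by (intro E.finsum_insert) auto
    also have "finsum E c F = (finsum A (\<lambda>i. fst (c i)) F, finsum A (\<lambda>i. snd (c i)) F)"
      using insert by auto
    also have "c i \<oplus>\<^bsub>E\<^esub> \<dots> = (finsum A (\<lambda>i. fst (c i)) (insert i F), finsum A (\<lambda>i. snd (c i)) (insert i F))"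
      using insert.hyps ab cl by (simp add: finsum_insert)
    finally show ?case .
  qed simp
qed

lemma sgn_pow_adjoin_odd:
  assumes "a \<in> carrier A" "b \<in> carrier A"
  shows "sgn_pow E k (a, b) = (sgn_pow A k a, sgn_pow A k b)"
proof -
  interpret E: ring E by (rule ring_adjoin_odd)
  have "\<ominus>\<^bsub>E\<^esub> (a, b) = (\<ominus> a, \<ominus> b)"
    by (rule E.minus_equality) (use assms in \<open>auto simp: l_neg\<close>)
  then show ?thesis by (simp add: sgn_pow_def)
qed

lemma comm_graded_algebra_adjoin_odd: "comm_graded_algebra K E"
proof (rule comm_graded_algebraI)
  show "ring E" by (rule ring_adjoin_odd)
  show "field K" by (rule field_axioms)
next
  fix x assume "x \<in> carrier E"
  then obtain a b where x: "x = (a, b)" "a \<in> carrier A" "b \<in> carrier A" by auto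
  let ?Fa = "{i. hom_part A a i \<noteq> \<zero>}" and ?Fb = "{i. hom_part A b i \<noteq> \<zero>}"
  \<comment> \<open>The degrees occurring in \<open>a + b t\<close>: those of \<open>a\<close>, and
    those of \<open>b\<close> raised by \<open>m\<close>.\<close>
  let ?F = "?Fa \<union> (\<lambda>j. j + m) ` ?Fb"
  let ?b = "\<lambda>i. if m \<le> i then hom_part A b (i - m) else \<zero>"
  let ?c = "\<lambda>i. (hom_part A a i, ?b i)"
  have fin: "finite ?F" using x finite_hom_part by simp
  have inj: "inj (\<lambda>j. j + m)" by (simp add: inj_on_def)
  have finj: "finite {j. j + m \<in> ?F}"
    using finite_vimageI[OF fin inj] unfolding vimage_def .
  have "finsum A (hom_part A a) ?F = a"
    by (rule finsum_hom_part) (use x fin in auto)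
  moreover have "finsum A ?b ?F = (\<Oplus>j\<in>{j. j + m \<in> ?F}. ?b (j + m))"
    by (rule finsum_shift) (use x fin in auto)
  moreover have "(\<Oplus>j\<in>{j. j + m \<in> ?F}. ?b (j + m)) = b"
    using finsum_hom_part[of b "{j. j + m \<in> ?F}"] x finj by auto
  ultimately have "x = finsum E ?c ?F"
    using x fin by (subst finsum_adjoin_odd) auto
  moreover have "?c i = \<zero>\<^bsub>E\<^esub>" if "i \<notin> ?F" for i
    using that by (auto simp: image_iff dest: spec[of _ "i - m"])
  ultimately show "\<exists>F c. finite F \<and> (\<forall>i. c i \<in> grade E i) \<and> (\<forall>i. i \<notin> F \<longrightarrow> c i = \<zero>\<^bsub>E\<^esub>) \<and> x = finsum E c F"
    using x fin by (intro exI[of _ ?F] exI[of _ ?c]) auto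
next
  fix F c and i :: nat
  assume F: "finite F" "\<And>i. c i \<in> grade E i" "finsum E c F = \<zero>\<^bsub>E\<^esub>" "i \<in> F"
  have c: "fst (c i) \<in> grade A i" "snd (c i) \<in> (if m \<le> i then grade A (i - m) else {\<zero>})" for i
    using F(2)[of i] by (simp_all add: mem_Times_iff)
  then have cl: "fst (c i) \<in> carrier A" "snd (c i) \<in> carrier A" for i
    using grade_carrier shifted_closed by blast+
  have s: "finsum A (\<lambda>i. fst (c i)) F = \<zero>" "finsum A (\<lambda>i. snd (c i)) F = \<zero>"
    using F cl by (simp_all add: finsum_adjoin_odd Pi_def mem_Times_iff)
  have c0: "snd (c i) = \<zero>" if "i < m" for i
    using c(2)[of i] that by simp
  have cm: "snd (c (j + m)) \<in> grade A j" for j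
    using c(2)[of "j + m"] by simp
  have "fst (c i) = \<zero>"
    using homogeneous_sum_zero[of F "\<lambda>i. fst (c i)" i] F s c by simp
  moreover have "snd (c i) = \<zero>"
  proof (cases "m \<le> i")
    case True
    let ?S = "{j. j + m \<in> F}"
    have fin: "finite ?S"
      using finite_vimageI[OF F(1), of "\<lambda>j. j + m"] by (simp add: vimage_def inj_on_def)
    have "(\<Oplus>j\<in>?S. snd (c (j + m))) = \<zero>"
      using s(2) finsum_shift[of F "\<lambda>i. snd (c i)" m] F(1) cl(2) c0 by simp
    then have "snd (c (i - m + m)) = \<zero>"
      using homogeneous_sum_zero[OF fin, of "\<lambda>j. snd (c (j + m))" "i - m"] cm F(4) True by simp
    then show ?thesis using True by simp
  qed (use c(2)[of i] in simp)
  ultimately show "c i = \<zero>\<^bsub>E\<^esub>" by (simp add: prod_eq_iff)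
next
  fix i j x y assume x: "x \<in> grade E i" and y: "y \<in> grade E j"
  obtain a b where a: "x = (a, b)" "a \<in> grade A i" "a \<in> carrier A"
    and b: "b \<in> (if m \<le> i then grade A (i - m) else {\<zero>})" "b \<in> carrier A"
    using x shifted_closed[of _ i] by auto
  obtain a' b' where a': "y = (a', b')" "a' \<in> grade A j" "a' \<in> carrier A"
    and b': "b' \<in> (if m \<le> j then grade A (j - m) else {\<zero>})" "b' \<in> carrier A"
    using y shifted_closed[of _ j] by auto
  show "x \<otimes>\<^bsub>E\<^esub> y \<in> grade E (i + j)"
    using a a' b b' mult_grade[of a i a' j] mult_grade[of a i b' "j - m"]
      mult_grade[OF _ koszul_grade, of b "i - m" a' j]
    by (auto split: if_splits intro!: grade_add)
  have ab': "a \<otimes> b' = sgn_pow A (i * Suc j) (b' \<otimes> a)"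
    by (rule commute_shifted) (use a b' in auto)
  have ba': "a' \<otimes> b = sgn_pow A (j * Suc i) (b \<otimes> a')"
    by (rule commute_shifted) (use a' b in auto)
  \<comment> \<open>Moving \<open>t\<close> across \<open>a'\<close> costs the sign of exponent
    \<open>j\<close>; exchanging \<open>b\<close> and \<open>a'\<close> costs exponent
    \<open>j * Suc i\<close>, as \<open>b\<close> has the parity of \<open>Suc i\<close>. Together
    this is \<open>i * j\<close> modulo 2.\<close>
  have *: "b \<otimes> \<sigma> a' = sgn_pow A (i * j) (a' \<otimes> b)"
    unfolding ba' using a a' b b'
    by (simp add: koszul_homogeneous[OF a'(2)] sgn_pow_r_mult sgn_pow_sgn_pow)
      (intro sgn_pow_cong, auto)
  have **: "sgn_pow A (i * j) (b' \<otimes> \<sigma> a) = a \<otimes> b'"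
    unfolding ab' using a a' b b'
    by (simp add: koszul_homogeneous[OF a(2)] sgn_pow_r_mult sgn_pow_sgn_pow)
      (intro sgn_pow_cong, auto)
  show "x \<otimes>\<^bsub>E\<^esub> y = sgn_pow E (i * j) (y \<otimes>\<^bsub>E\<^esub> x)"
    using a a' b b' *[symmetric] ** graded_commute[of a i a' j]
    by (simp add: sgn_pow_adjoin_odd sgn_pow_add) (simp add: a_comm)
next
  fix k x y assume "k \<in> carrier K" "x \<in> carrier E" "y \<in> carrier E"
  then show "x \<otimes>\<^bsub>E\<^esub> (k \<odot>\<^bsub>E\<^esub> y) = k \<odot>\<^bsub>E\<^esub> (x \<otimes>\<^bsub>E\<^esub> y)"
    "(k \<odot>\<^bsub>E\<^esub> x) \<otimes>\<^bsub>E\<^esub> y = k \<odot>\<^bsub>E\<^esub> (x \<otimes>\<^bsub>E\<^esub> y)"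
    by (auto simp: smult_mult_left smult_mult_right smult_r_distr koszul_smult)
qed (auto simp: smult_l_distr smult_r_distr smult_assoc1 one_grade intro: grade_add grade_smult split: if_splits)

lemma is_cdga_adjoin_odd: "is_cdga K E"
proof (rule is_cdga.intro[OF comm_graded_algebra_adjoin_odd is_cdga_axioms.intro])
  fix x assume "x \<in> carrier E"
  then obtain a b where x: "x = (a, b)" "a \<in> carrier A" "b \<in> carrier A" by auto
  then show "differential E x \<in> carrier E" by (simp add: d_closed)
  \<comment> \<open>What remains of the square is \<open>d (\<sigma> b) \<otimes> e\<close> plus
    \<open>\<sigma> (d b) \<otimes> e\<close>, and these cancel since \<open>\<sigma>\<close>
    anticommutes with \<open>d\<close>.\<close>
  show "differential E (differential E x) = \<zero>\<^bsub>E\<^esub>"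
    using x by (simp add: d_closed d_add d_mult d_d de koszul_d l_minus l_neg r_neg)
next
  fix x y assume "x \<in> carrier E" "y \<in> carrier E"
  then show "differential E (x \<oplus>\<^bsub>E\<^esub> y) = differential E x \<oplus>\<^bsub>E\<^esub> differential E y"
    by (auto simp: d_closed d_add koszul_add l_distr a_ac)
next
  fix k x assume "k \<in> carrier K" "x \<in> carrier E"
  then show "differential E (k \<odot>\<^bsub>E\<^esub> x) = k \<odot>\<^bsub>E\<^esub> differential E x"
    by (auto simp: d_closed d_smult koszul_smult smult_r_distr smult_mult_left)
next
  fix x i assume "x \<in> grade E i"
  then obtain a b where x: "x = (a, b)" "a \<in> grade A i"
    and b: "b \<in> (if m \<le> i then grade A (i - m) else {\<zero>})" by auto
  show "differential E x \<in> grade E (Suc i)"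
  proof (cases "m \<le> i")
    case True
    then have "\<sigma> b \<otimes> e \<in> grade A (Suc i)"
      using mult_grade[OF koszul_grade e, of b "i - m" "Suc 0"] b by simp
    then show ?thesis
      using x b True d_grade[of b "i - m"] by (auto simp: d_grade Suc_diff_le)
  next
    case False
    then show ?thesis using x b by (auto simp: d_grade)
  qed
next
  fix x y i assume x: "x \<in> grade E i" and y: "y \<in> carrier E"
  obtain a b where a: "x = (a, b)" "a \<in> grade A i" "a \<in> carrier A"
    and b: "b \<in> (if m \<le> i then grade A (i - m) else {\<zero>})" "b \<in> carrier A"
    using x shifted_closed[of _ i] by auto
  obtain a' b' where y: "y = (a', b')" "a' \<in> carrier A" "b' \<in> carrier A"
    using y by auto
  have ka: "\<sigma> a = sgn_pow A i a" using koszul_homogeneous[OF a(2), of "Suc 0"] by simp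
  have kb: "\<sigma> b = sgn_pow A (Suc i) b" by (rule koszul_shifted[OF b(1)])
  \<comment> \<open>After expansion the two sides of the Leibniz rule differ only in the position of
    the central element \<open>e\<close> and in signs, which the case distinction on the parity of
    \<open>i\<close> makes explicit.\<close>
  have be: "b \<otimes> (a' \<otimes> e) = b \<otimes> (e \<otimes> a')" "b \<otimes> (e \<otimes> b') = b \<otimes> (b' \<otimes> e)"
    using e_comm y by simp_all
  note simps = a(1,3) b(2) y d_closed d_mult d_add koszul_mult koszul_add koszul_d ka kb
    l_distr r_distr l_minus r_minus m_assoc be minus_add sgn_pow_adjoin_odd
  show "differential E (x \<otimes>\<^bsub>E\<^esub> y)
      = (differential E x \<otimes>\<^bsub>E\<^esub> y) \<oplus>\<^bsub>E\<^esub> sgn_pow E i (x \<otimes>\<^bsub>E\<^esub> differential E y)"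
  proof (cases "even i")
    case True
    then show ?thesis
      by (simp add: simps) (simp add: sgn_pow_def simps a_ac r_neg1 r_neg2)
  next
    case False
    then show ?thesis
      by (simp add: simps) (simp add: sgn_pow_def simps a_ac r_neg1 r_neg2)
  qed
qed

end

end

section \<open>The Hirsch extension as an iterated extension\<close>

lemma hirsch_extension_simps:
  "carrier (hirsch_extension H r e n) = Pow {1..r} \<rightarrow>\<^sub>E carrier H"
  "f \<otimes>\<^bsub>hirsch_extension H r e n\<^esub> g = (\<lambda>U\<in>Pow {1..r}.
        finsum H (\<lambda>S. sgn_pow H (inversions S (U - S))
                        (f S \<otimes>\<^bsub>H\<^esub> koszul H (mon_degree n S) (g (U - S)))) (Pow U))"
  "\<one>\<^bsub>hirsch_extension H r e n\<^esub> = (\<lambda>U\<in>Pow {1..r}. if U = {} then \<one>\<^bsub>H\<^esub> else \<zero>\<^bsub>H\<^esub>)"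
  "\<zero>\<^bsub>hirsch_extension H r e n\<^esub> = (\<lambda>U\<in>Pow {1..r}. \<zero>\<^bsub>H\<^esub>)"
  "f \<oplus>\<^bsub>hirsch_extension H r e n\<^esub> g = (\<lambda>U\<in>Pow {1..r}. f U \<oplus>\<^bsub>H\<^esub> g U)"
  "a \<odot>\<^bsub>hirsch_extension H r e n\<^esub> f = (\<lambda>U\<in>Pow {1..r}. a \<odot>\<^bsub>H\<^esub> f U)"
  "grade (hirsch_extension H r e n) i = {f \<in> Pow {1..r} \<rightarrow>\<^sub>E carrier H.
        \<forall>U\<in>Pow {1..r}. if mon_degree n U \<le> i then f U \<in> grade H (i - mon_degree n U)
                       else f U = \<zero>\<^bsub>H\<^esub>}"
  "differential (hirsch_extension H r e n) f = (\<lambda>U\<in>Pow {1..r}.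
        finsum H (\<lambda>s. sgn_pow H (card {u \<in> U. u < s})
                        (koszul H 1 (f (insert s U)) \<otimes>\<^bsub>H\<^esub> e s)) ({1..r} - U))"
  by (simp_all add: hirsch_extension_def)

section \<open>Signs and degrees of exterior monomials\<close>

lemma inversions_empty [simp]: "inversions {} T = 0" "inversions S {} = 0"
  by (simp_all add: inversions_def)

text \<open>No pair \<open>(s, p)\<close> is an inversion when \<open>p\<close> exceeds all of
  \<open>S\<close>: the last generator can be appended on the right without a sign.\<close>

lemma inversions_insert_right:
  assumes "\<And>s. s \<in> S \<Longrightarrow> s < p"
  shows "inversions S (insert p T) = inversions S T"
proof -
  have "{(s, t). s \<in> S \<and> t \<in> insert p T \<and> t < s} = {(s, t). s \<in> S \<and> t \<in> T \<and> t < s}"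
    using assms by force
  then show ?thesis by (simp add: inversions_def)
qed

text \<open>The generator \<open>p\<close> exceeds all of \<open>T\<close> and so forms an inversion
  with each of its elements; this is the cost of moving the last generator across the monomial of
  \<open>T\<close>.\<close>

lemma inversions_insert_left:
  assumes "\<And>t. t \<in> T \<Longrightarrow> t < p" "finite S" "finite T" "p \<notin> S"
  shows "inversions (insert p S) T = inversions S T + card T"
proof -
  let ?X = "{(s, t). s \<in> S \<and> t \<in> T \<and> t < s}"
  have "{(s, t). s \<in> insert p S \<and> t \<in> T \<and> t < s} = ?X \<union> {p} \<times> T"
    using assms by force
  moreover have "card (?X \<union> {p} \<times> T) = card ?X + card ({p} \<times> T)"
  proof (rule card_Un_disjoint)
    show "finite ?X" by (rule finite_subset[of _ "S \<times> T"]) (use assms in auto)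
  qed (use assms in auto)
  ultimately show ?thesis by (simp add: inversions_def card_cartesian_product)
qed

lemma mon_degree_empty [simp]: "mon_degree n {} = 0"
  by (simp add: mon_degree_def)

lemma mon_degree_insert:
  "finite S \<Longrightarrow> p \<notin> S \<Longrightarrow> mon_degree n (insert p S) = mon_degree n S + (n p - 1)"
  by (simp add: mon_degree_def)

text \<open>Each generator has odd degree \<open>n s - 1\<close>, so parities of degrees can be
  replaced by cardinalities, in which the sign of the differential is expressed.\<close>

lemma even_mon_degree:
  assumes "finite U" "\<And>s. s \<in> U \<Longrightarrow> 0 < n s \<and> even (n s)"
  shows "even (mon_degree n U) \<longleftrightarrow> even (card U)"
  using assms
proof (induction U rule: finite_induct)
  case (insert s U)
  have IH: "even (mon_degree n U) \<longleftrightarrow> even (card U)"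
    by (rule insert.IH) (use insert.prems in blast)
  have "0 < n s" "even (n s)" using insert.prems by blast+
  then show ?case using insert.hyps IH by (simp add: mon_degree_insert)
qed simp

text \<open>Splitting the subsets by whether they contain \<open>p\<close> mirrors the splitting of
  an element as \<open>a + b t\<close>.\<close>

lemma (in abelian_monoid) finsum_Pow_insert:
  assumes "finite V" "p \<notin> V" "\<And>S. S \<subseteq> insert p V \<Longrightarrow> F S \<in> carrier G"
  shows "finsum G F (Pow (insert p V)) = finsum G F (Pow V) \<oplus> (\<Oplus>S\<in>Pow V. F (insert p S))"
proof -
  have "finsum G F (Pow (insert p V)) = finsum G F (Pow V) \<oplus> finsum G F (insert p ` Pow V)"
    unfolding Pow_insert
    by (rule finsum_Un_disjoint) (use assms(1,2) in \<open>auto intro!: assms(3)\<close>)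
  also have "finsum G F (insert p ` Pow V) = (\<Oplus>S\<in>Pow V. F (insert p S))"
  proof (rule finsum_reindex)
    show "inj_on (insert p) (Pow V)"
      using assms(2) by (intro inj_onI) (auto dest: insert_ident[THEN iffD1, rotated 2])
  qed (auto intro!: assms(3))
  finally show ?thesis .
qed

section \<open>The Hirsch extension through its coefficients\<close>

locale even_sequence = graded H K for H (structure) and K +
  fixes e :: "nat \<Rightarrow> 'c" and n :: "nat \<Rightarrow> nat" and r :: nat
  assumes degree_pos: "\<alpha> \<in> {1..r} \<Longrightarrow> 0 < n \<alpha>"
    and degree_even: "\<alpha> \<in> {1..r} \<Longrightarrow> even (n \<alpha>)"
    and e_grade: "\<alpha> \<in> {1..r} \<Longrightarrow> e \<alpha> \<in> grade H (n \<alpha>)"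
begin

abbreviation \<Lambda> where "\<Lambda> \<equiv> hirsch_extension H r e n"

definition incl :: "'c \<Rightarrow> nat set \<Rightarrow> 'c" where
  "incl h = (\<lambda>U\<in>Pow {1..r}. if U = {} then h else \<zero>)"

lemma e_carrier [simp]: "\<alpha> \<in> {1..r} \<Longrightarrow> e \<alpha> \<in> carrier H"
  using e_grade grade_carrier by blast

lemma e_central: "\<lbrakk>\<alpha> \<in> {1..r}; x \<in> carrier H\<rbrakk> \<Longrightarrow> x \<otimes> e \<alpha> = e \<alpha> \<otimes> x"
  using graded_commute_even[OF e_grade degree_even] by simp

lemma koszul_e: "\<alpha> \<in> {1..r} \<Longrightarrow> koszul H k (e \<alpha>) = e \<alpha>"
  using koszul_homogeneous[OF e_grade] degree_even by (simp add: sgn_pow_def)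

lemma even_mon_degree':
  assumes "U \<subseteq> {1..r}"
  shows "even (mon_degree n U) \<longleftrightarrow> even (card U)"
proof (rule even_mon_degree)
  show "finite U" using assms by (rule finite_subset) simp
  show "0 < n s \<and> even (n s)" if "s \<in> U" for s
    using degree_pos[of s] degree_even[of s] subsetD[OF assms that] by simp
qed

lemma incl_closed: "h \<in> carrier H \<Longrightarrow> incl h \<in> carrier \<Lambda>"
  by (auto simp: incl_def hirsch_extension_simps)

lemma incl_grade: "h \<in> grade H i \<Longrightarrow> incl h \<in> grade \<Lambda> i"
  by (auto simp: incl_def hirsch_extension_simps)

lemma incl_empty [simp]: "incl h {} = h"
  by (simp add: incl_def)

lemma hirsch_apply_closed: "\<lbrakk>f \<in> carrier \<Lambda>; U \<subseteq> {1..r}\<rbrakk> \<Longrightarrow> f U \<in> carrier H"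
  unfolding hirsch_extension_simps by (erule PiE_mem) simp

lemma hirsch_eq_zero_iff:
  assumes "f \<in> carrier \<Lambda>"
  shows "f = \<zero>\<^bsub>\<Lambda>\<^esub> \<longleftrightarrow> (\<forall>U\<in>Pow {1..r}. f U = \<zero>)"
proof
  assume "\<forall>U\<in>Pow {1..r}. f U = \<zero>"
  then have "restrict f (Pow {1..r}) = \<zero>\<^bsub>\<Lambda>\<^esub>"
    unfolding hirsch_extension_simps by (intro restrict_ext) simp
  then show "f = \<zero>\<^bsub>\<Lambda>\<^esub>" using assms by (simp add: hirsch_extension_simps PiE_restrict)
qed (simp add: hirsch_extension_simps)

lemma hirsch_grade_iff:
  "f \<in> carrier \<Lambda> \<Longrightarrow> f \<in> grade \<Lambda> i \<longleftrightarrow> (\<forall>U\<in>Pow {1..r}.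
    if mon_degree n U \<le> i then f U \<in> grade H (i - mon_degree n U) else f U = \<zero>)"
  unfolding hirsch_extension_simps by (simp only: mem_Collect_eq simp_thms)

text \<open>Only \<open>S = U\<close> contributes, since \<open>incl h\<close> is supported on the
  empty set. The sign of moving \<open>h\<close> across the monomial of \<open>U\<close> remains;
  with \<open>incl h\<close> on the left there is none.\<close>

lemma mult_incl_right:
  assumes f: "f \<in> carrier \<Lambda>" and h: "h \<in> carrier H" and U: "U \<subseteq> {1..r}"
  shows "(f \<otimes>\<^bsub>\<Lambda>\<^esub> incl h) U = f U \<otimes> koszul H (mon_degree n U) h"
proof -
  have fU: "f S \<in> carrier H" if "S \<subseteq> U" for S
    using f U that by (intro hirsch_apply_closed) auto
  have "(f \<otimes>\<^bsub>\<Lambda>\<^esub> incl h) U = (\<Oplus>S\<in>Pow U. sgn_pow H (inversions S (U - S))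
                        (f S \<otimes> koszul H (mon_degree n S) (incl h (U - S))))"
    using U by (simp add: hirsch_extension_simps)
  also have "\<dots> = (\<Oplus>S\<in>Pow U. if U = S then f S \<otimes> koszul H (mon_degree n S) h else \<zero>)"
    by (rule finsum_cong') (use U h fU in \<open>auto simp: incl_def sgn_pow_def\<close>)
  also have "\<dots> = f U \<otimes> koszul H (mon_degree n U) h"
    using finite_subset[OF U] fU h by (intro finsum_singleton) auto
  finally show ?thesis .
qed

lemma mult_incl_left:
  assumes f: "f \<in> carrier \<Lambda>" and h: "h \<in> carrier H" and U: "U \<subseteq> {1..r}"
  shows "(incl h \<otimes>\<^bsub>\<Lambda>\<^esub> f) U = h \<otimes> f U"
proof -
  have fU: "f S \<in> carrier H" if "S \<subseteq> U" for S
    using f U that by (intro hirsch_apply_closed) auto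
  have "(incl h \<otimes>\<^bsub>\<Lambda>\<^esub> f) U = (\<Oplus>S\<in>Pow U. sgn_pow H (inversions S (U - S))
                        (incl h S \<otimes> koszul H (mon_degree n S) (f (U - S))))"
    using U by (simp add: hirsch_extension_simps)
  also have "\<dots> = (\<Oplus>S\<in>Pow U. if {} = S then h \<otimes> f (U - S) else \<zero>)"
    by (rule finsum_cong') (use U h fU in \<open>auto simp: incl_def koszul_even sgn_pow_def\<close>)
  also have "\<dots> = h \<otimes> f (U - {})"
    using finite_subset[OF U] fU h by (intro finsum_singleton) auto
  finally show ?thesis by simp
qed

text \<open>The differential reads off coefficients at sets \<open>insert s U\<close>, which are
  never empty, whereas \<open>incl h\<close> is supported on the empty set.\<close>

lemma differential_incl: "h \<in> carrier H \<Longrightarrow> differential \<Lambda> (incl h) = \<zero>\<^bsub>\<Lambda>\<^esub>"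
  unfolding hirsch_extension_simps
  by (rule restrict_ext, rule add.finprod_one_eqI) (auto simp: incl_def)

text \<open>The term of \<open>U\<close> has the degree of its coefficient plus an amount with the
  parity of \<open>card U\<close>. The involution is defined through decompositions in the
  extension, so their uniqueness must be known beforehand; in the induction this lemma is applied to
  the previous stage.\<close>

lemma koszul_hirsch:
  assumes "is_cdga K \<Lambda>" and f: "f \<in> carrier \<Lambda>"
  shows "koszul \<Lambda> (Suc 0) f = (\<lambda>U\<in>Pow {1..r}. sgn_pow H (card U) (koszul H (Suc 0) (f U)))"
proof -
  interpret L: cdga \<Lambda> K by (rule cdga.intro) fact
  have minus: "\<ominus>\<^bsub>\<Lambda>\<^esub> f = (\<lambda>U\<in>Pow {1..r}. \<ominus> f U)" if f: "f \<in> carrier \<Lambda>" for f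
  proof (rule L.minus_equality)
    show "(\<lambda>U\<in>Pow {1..r}. \<ominus> f U) \<oplus>\<^bsub>\<Lambda>\<^esub> f = \<zero>\<^bsub>\<Lambda>\<^esub>"
      unfolding hirsch_extension_simps
      by (rule restrict_ext) (simp add: l_neg hirsch_apply_closed[OF f])
    show "(\<lambda>U\<in>Pow {1..r}. \<ominus> f U) \<in> carrier \<Lambda>"
      using hirsch_apply_closed[OF f] by (auto simp: hirsch_extension_simps)
  qed (rule f)
  show ?thesis
    using f
  proof (induction f rule: L.homogeneous_induct)
    case (homogeneous i f)
    have f: "f \<in> carrier \<Lambda>" using homogeneous by (rule L.grade_carrier)
    have ext: "f = (\<lambda>U\<in>Pow {1..r}. f U)" using f by (simp add: hirsch_extension_simps)
    have "koszul \<Lambda> (Suc 0) f = sgn_pow \<Lambda> i f"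
      using L.koszul_homogeneous[OF homogeneous, of "Suc 0"] by simp
    also have "\<dots> = (\<lambda>U\<in>Pow {1..r}. sgn_pow H i (f U))"
      using minus[OF f] ext by (auto simp: sgn_pow_def)
    also have "\<dots> = (\<lambda>U\<in>Pow {1..r}. sgn_pow H (card U) (koszul H (Suc 0) (f U)))"
    proof (rule restrict_ext)
      fix U assume "U \<in> Pow {1..r}"
      then have U: "U \<subseteq> {1..r}" by simp
      show "sgn_pow H i (f U) = sgn_pow H (card U) (koszul H (Suc 0) (f U))"
      proof (cases "mon_degree n U \<le> i")
        case True
        then have g: "f U \<in> grade H (i - mon_degree n U)"
          using homogeneous U by (auto simp: hirsch_extension_simps)
        have "sgn_pow H (card U) (koszul H (Suc 0) (f U))
            = sgn_pow H (card U + (i - mon_degree n U)) (f U)"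
          using g by (simp add: koszul_homogeneous[OF g] sgn_pow_sgn_pow)
        also have "\<dots> = sgn_pow H i (f U)"
          using True even_mon_degree'[OF U] by (intro sgn_pow_cong) auto
        finally show ?thesis by simp
      next
        case False
        then have "f U = \<zero>"
          using homogeneous U by (auto simp: hirsch_extension_simps)
        then show ?thesis by simp
      qed
    qed
    finally show ?case .
  next
    case (add f g)
    have cl: "f U \<in> carrier H" "g U \<in> carrier H" if "U \<subseteq> {1..r}" for U
      using hirsch_apply_closed[OF add.hyps(1) that] hirsch_apply_closed[OF add.hyps(2) that] by auto
    have "koszul \<Lambda> (Suc 0) (f \<oplus>\<^bsub>\<Lambda>\<^esub> g) = koszul \<Lambda> (Suc 0) f \<oplus>\<^bsub>\<Lambda>\<^esub> koszul \<Lambda> (Suc 0) g"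
      using add.hyps by (rule L.koszul_add)
    also have "\<dots> = (\<lambda>U\<in>Pow {1..r}. sgn_pow H (card U) (koszul H (Suc 0) ((f \<oplus>\<^bsub>\<Lambda>\<^esub> g) U)))"
      unfolding add.IH hirsch_extension_simps
      by (rule restrict_ext) (simp add: koszul_add sgn_pow_add cl)
    finally show ?case .
  qed
qed

end

section \<open>Induction on the number of generators\<close>

context graded
begin

text \<open>Without generators the extension is \<open>H\<close> with zero differential, its
  elements written as functions on the single set \<open>{}\<close>.\<close>

lemma is_cdga_hirsch_0: "is_cdga K (hirsch_extension A 0 e n)"
proof (rule is_cdga_image)
  let ?f = "\<lambda>h. \<lambda>U\<in>Pow {1..0::nat}. h"
  show cd: "is_cdga K (with_zero_diff A)"
    by (rule is_cdga_with_zero_diff) (rule comm_graded_algebra_axioms)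
  interpret W: cdga "with_zero_diff A" K by (rule cdga.intro) fact
  have Pow: "Pow {1..0::nat} = {{}}" by simp
  have c: "carrier (hirsch_extension A 0 e n) = ?f ` carrier A"
    unfolding hirsch_extension_simps Pow PiE_over_singleton_iff by blast
  then show "?f ` carrier (with_zero_diff A) = carrier (hirsch_extension A 0 e n)"
    by simp
  have "grade (hirsch_extension A 0 e n) i = {f \<in> ?f ` carrier A. f {} \<in> grade A i}" for i
    unfolding c[symmetric] by (simp add: hirsch_extension_simps)
  then show "?f ` grade (with_zero_diff A) i = grade (hirsch_extension A 0 e n) i" for i
    using grade_carrier by force
  show "?f (hom_part (with_zero_diff A) x i) = \<zero>\<^bsub>hirsch_extension A 0 e n\<^esub>"
    if "?f x = \<zero>\<^bsub>hirsch_extension A 0 e n\<^esub>" for x i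
  proof -
    have "x = \<zero>" using that by (auto simp: hirsch_extension_simps dest: fun_cong[of _ _ "{}"])
    then show ?thesis using W.hom_part_zero by (simp add: hirsch_extension_simps)
  qed
qed (auto simp: hirsch_extension_simps koszul_even sgn_pow_def intro!: restrict_ext)

end

text \<open>
  The element \<open>a + b t\<close> of the extension of the \<open>r\<close>-th stage by \<open>t = t\<^bsub>r+1\<^esub>\<close>, as an element of the
  next stage.
\<close>

definition hirsch_join :: "nat \<Rightarrow> (nat set \<Rightarrow> 'a) \<times> (nat set \<Rightarrow> 'a) \<Rightarrow> nat set \<Rightarrow> 'a" where
  "hirsch_join r x = (\<lambda>U\<in>Pow {1..Suc r}. if Suc r \<in> U then snd x (U - {Suc r}) else fst x U)"

lemma subset_Suc_cases:
  assumes "U \<subseteq> {1..Suc r}"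
  obtains (old) "U \<subseteq> {1..r}" "Suc r \<notin> U"
    | (new) V where "V \<subseteq> {1..r}" "Suc r \<notin> V" "U = insert (Suc r) V" "finite V"
proof (cases "Suc r \<in> U")
  case True
  have "U - {Suc r} \<subseteq> {1..r}" using assms by (auto simp: le_Suc_eq)
  then show ?thesis
    using True finite_subset[OF \<open>U - {Suc r} \<subseteq> {1..r}\<close>] by (intro new[of "U - {Suc r}"]) auto
next
  case False
  then show ?thesis using assms by (intro old) (auto simp: le_Suc_eq)
qed

lemma hirsch_join_old: "\<lbrakk>U \<subseteq> {1..r}\<rbrakk> \<Longrightarrow> hirsch_join r x U = fst x U"
  by (auto simp: hirsch_join_def)

lemma hirsch_join_new:
  assumes "V \<subseteq> {1..r}"
  shows "hirsch_join r x (insert (Suc r) V) = snd x V"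
proof -
  have "Suc r \<notin> V" using assms by auto
  then have "insert (Suc r) V - {Suc r} = V" by blast
  then show ?thesis using assms by (auto simp: hirsch_join_def)
qed

text \<open>The operations of the next stage are restrictions of functions \<open>g\<close>, so
  every compatibility of \<open>hirsch_join\<close> comes down to the coefficients without and with
  the last generator.\<close>

lemma hirsch_join_eqI:
  assumes "\<And>U. \<lbrakk>U \<subseteq> {1..r}; Suc r \<notin> U; finite U\<rbrakk> \<Longrightarrow> fst x U = g U"
    and "\<And>V. \<lbrakk>V \<subseteq> {1..r}; Suc r \<notin> V; finite V\<rbrakk> \<Longrightarrow> snd x V = g (insert (Suc r) V)"
  shows "hirsch_join r x = restrict g (Pow {1..Suc r})"
  unfolding hirsch_join_def[of r x]
proof (rule restrict_ext)
  fix U assume "U \<in> Pow {1..Suc r}"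
  then have "U \<subseteq> {1..Suc r}" by simp
  then show "(if Suc r \<in> U then snd x (U - {Suc r}) else fst x U) = g U"
  proof (cases rule: subset_Suc_cases)
    case old
    then show ?thesis using assms(1) finite_subset[OF old(1)] by simp
  next
    case (new V)
    then show ?thesis using assms(2) by simp
  qed
qed

text \<open>Two consecutive stages at once: unqualified names such as \<open>\<Lambda>\<close> and
  \<open>I\<close> belong to the stage with \<open>Suc r\<close> generators, the prefix
  \<open>old\<close> and the name \<open>A\<close> to the one with \<open>r\<close>.\<close>

locale even_sequence_Suc = even_sequence H K e n "Suc r" for H (structure) and K and e n r
begin

sublocale old: even_sequence H K e n r
  by unfold_locales (auto intro: degree_pos degree_even e_grade)

abbreviation p where "p \<equiv> Suc r"

abbreviation A where "A \<equiv> hirsch_extension H r e n"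

context
  assumes cdga_A: "is_cdga K A"
begin

interpretation A: cdga A K by (rule cdga.intro) (rule cdga_A)

abbreviation m where "m \<equiv> n p - 1"

abbreviation e' where "e' \<equiv> old.incl (e p)"

lemma m: "odd m" "n p = Suc m"
  using degree_pos[of p] degree_even[of p] by auto

lemma e': "e' \<in> grade A (Suc m)" "differential A e' = \<zero>\<^bsub>A\<^esub>"
  using old.incl_grade[OF e_grade[of p]] m(2) old.differential_incl[of "e p"] by simp_all

abbreviation "E \<equiv> adjoin_odd A m e'"

lemma is_cdga_E: "is_cdga K E"
  by (rule A.is_cdga_adjoin_odd) (use m e' in auto)

lemma closed_old: "\<lbrakk>a \<in> carrier A; U \<subseteq> {1..r}\<rbrakk> \<Longrightarrow> a U \<in> carrier H"
  by (rule old.hirsch_apply_closed)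

lemma hirsch_join_carrier: "hirsch_join r ` carrier E = carrier \<Lambda>"
proof
  show "hirsch_join r ` carrier E \<subseteq> carrier \<Lambda>"
  proof clarify
    fix a b assume "(a, b) \<in> carrier E"
    then have ab: "a \<in> carrier A" "b \<in> carrier A" by auto
    show "hirsch_join r (a, b) \<in> carrier \<Lambda>"
      unfolding hirsch_extension_simps
    proof (rule PiE_I)
      fix U assume "U \<in> Pow {1..Suc r}"
      then have "U \<subseteq> {1..Suc r}" by simp
      then show "hirsch_join r (a, b) U \<in> carrier H"
        by (cases rule: subset_Suc_cases) (use ab closed_old in \<open>simp_all add: hirsch_join_old hirsch_join_new\<close>)
    qed (simp add: hirsch_join_def)
  qed
  show "carrier \<Lambda> \<subseteq> hirsch_join r ` carrier E"
  proof
    fix f assume f: "f \<in> carrier \<Lambda>"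
    let ?a = "\<lambda>U\<in>Pow {1..r}. f U" and ?b = "\<lambda>U\<in>Pow {1..r}. f (insert p U)"
    have "f = restrict f (Pow {1..Suc r})"
      using f by (simp add: hirsch_extension_simps PiE_restrict)
    also have "\<dots> = hirsch_join r (?a, ?b)"
      by (rule hirsch_join_eqI[symmetric]) simp_all
    finally have eq: "f = hirsch_join r (?a, ?b)" .
    have "?a \<in> carrier A" "?b \<in> carrier A"
      using hirsch_apply_closed[OF f] by (auto simp: hirsch_extension_simps(1) intro!: hirsch_apply_closed[OF f])
    then have "(?a, ?b) \<in> carrier E" by (simp only: adjoin_odd_simps mem_Sigma_iff simp_thms)
    with eq show "f \<in> hirsch_join r ` carrier E" by (rule image_eqI)
  qed
qed

text \<open>Monomials containing \<open>p\<close> have degree larger by \<open>m\<close>, in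
  agreement with the shift in the second component of \<open>E\<close>. The backward direction makes
  \<open>hirsch_join\<close> onto in each degree.\<close>

lemma hirsch_join_mem_grade_iff:
  assumes "a \<in> carrier A" "b \<in> carrier A"
  shows "hirsch_join r (a, b) \<in> grade \<Lambda> i \<longleftrightarrow> (a, b) \<in> grade E i"
proof -
  have c: "hirsch_join r (a, b) \<in> carrier \<Lambda>" using assms hirsch_join_carrier by force
  have Pow: "(\<forall>U\<in>Pow {1..Suc r}. P U) \<longleftrightarrow> (\<forall>U\<in>Pow {1..r}. P U) \<and> (\<forall>V\<in>Pow {1..r}. P (insert p V))" for P
  proof -
    have "Pow {1..Suc r} = Pow {1..r} \<union> insert p ` Pow {1..r}"
      using Pow_insert[of p "{1..r}"] by (simp add: atLeastAtMostSuc_conv)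
    then show ?thesis by (simp add: ball_Un)
  qed
  have deg: "mon_degree n (insert p V) = mon_degree n V + m" if "V \<subseteq> {1..r}" for V
    using that finite_subset[OF that] by (intro mon_degree_insert) auto
  have b: "(\<forall>V\<in>Pow {1..r}. if mon_degree n V + m \<le> i then b V \<in> grade H (i - (mon_degree n V + m)) else b V = \<zero>)
      \<longleftrightarrow> b \<in> (if m \<le> i then grade A (i - m) else {\<zero>\<^bsub>A\<^esub>})"
  proof (cases "m \<le> i")
    case True
    then have "mon_degree n V + m \<le> i \<longleftrightarrow> mon_degree n V \<le> i - m"
      "i - (mon_degree n V + m) = i - m - mon_degree n V" for V
      by linarith+
    then show ?thesis
      by (simp only: True if_True old.hirsch_grade_iff[OF assms(2)])
  next
    case False
    then have "\<not> mon_degree n V + m \<le> i" for V by linarith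
    moreover have "b = \<zero>\<^bsub>A\<^esub> \<longleftrightarrow> (\<forall>V\<in>Pow {1..r}. b V = \<zero>)"
      using assms(2) by (rule old.hirsch_eq_zero_iff)
    ultimately show ?thesis by (simp only: False if_False singleton_iff)
  qed
  have "hirsch_join r (a, b) \<in> grade \<Lambda> i \<longleftrightarrow>
      (\<forall>U\<in>Pow {1..r}. if mon_degree n U \<le> i then a U \<in> grade H (i - mon_degree n U) else a U = \<zero>) \<and>
      (\<forall>V\<in>Pow {1..r}. if mon_degree n V + m \<le> i then b V \<in> grade H (i - (mon_degree n V + m)) else b V = \<zero>)"
    unfolding hirsch_grade_iff[OF c] Pow
    by (intro conj_cong ball_cong refl) (simp_all only: Pow_iff hirsch_join_old hirsch_join_new deg fst_conv snd_conv)
  then show ?thesis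
    unfolding b old.hirsch_grade_iff[OF assms(1), symmetric] by (simp only: adjoin_odd_simps mem_Sigma_iff)
qed

lemma hirsch_join_grade: "hirsch_join r ` grade E i = grade \<Lambda> i"
proof
  interpret E: cdga E K by (rule cdga.intro) (rule is_cdga_E)
  show "hirsch_join r ` grade E i \<subseteq> grade \<Lambda> i"
  proof clarify
    fix a b assume ab: "(a, b) \<in> grade E i"
    then have "(a, b) \<in> carrier E" by (rule E.grade_carrier)
    then show "hirsch_join r (a, b) \<in> grade \<Lambda> i"
      using ab hirsch_join_mem_grade_iff by simp
  qed
  show "grade \<Lambda> i \<subseteq> hirsch_join r ` grade E i"
  proof
    fix f assume f: "f \<in> grade \<Lambda> i"
    then have "f \<in> carrier \<Lambda>" unfolding hirsch_extension_simps by (simp only: mem_Collect_eq)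
    then have "f \<in> hirsch_join r ` carrier E" unfolding hirsch_join_carrier .
    then obtain a b where ab: "a \<in> carrier A" "b \<in> carrier A" and f_eq: "f = hirsch_join r (a, b)"
      unfolding adjoin_odd_simps by blast
    have "(a, b) \<in> grade E i"
      using f unfolding f_eq hirsch_join_mem_grade_iff[OF ab] .
    with f_eq show "f \<in> hirsch_join r ` grade E i" by (rule image_eqI)
  qed
qed

text \<open>The signs of the two descriptions meet here. At a set with the last generator, the
  factor containing it is either the right one, which gives \<open>a\<close> times \<open>b'\<close>
  without a new sign, or the left one, which gives \<open>b\<close> times the twisted
  \<open>a'\<close>.\<close>

lemma hirsch_join_mult:
  assumes "x \<in> carrier E" "y \<in> carrier E"
  shows "hirsch_join r (x \<otimes>\<^bsub>E\<^esub> y) = hirsch_join r x \<otimes>\<^bsub>\<Lambda>\<^esub> hirsch_join r y"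
proof -
  obtain a b a' b' where xy: "x = (a, b)" "y = (a', b')"
    and cl: "a \<in> carrier A" "b \<in> carrier A" "a' \<in> carrier A" "b' \<in> carrier A"
    using assms by (cases x, cases y) auto
  show ?thesis
    unfolding xy adjoin_odd_simps hirsch_extension_simps(2)[of H "Suc r"]
  proof (rule hirsch_join_eqI)
    fix U assume U: "U \<subseteq> {1..r}" "p \<notin> U" "finite U"
    have sub: "S \<subseteq> {1..r}" "U - S \<subseteq> {1..r}" if "S \<subseteq> U" for S using that U by auto
    show "fst (a \<otimes>\<^bsub>A\<^esub> a', a \<otimes>\<^bsub>A\<^esub> b' \<oplus>\<^bsub>A\<^esub> b \<otimes>\<^bsub>A\<^esub> koszul A (Suc 0) a') U =
        (\<Oplus>S\<in>Pow U. sgn_pow H (inversions S (U - S)) (hirsch_join r (a, b) S \<otimes>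
              koszul H (mon_degree n S) (hirsch_join r (a', b') (U - S))))"
      using U sub
      by (simp add: hirsch_extension_simps(2))
        (intro finsum_cong', auto simp: hirsch_join_old closed_old cl)
  next
    fix V assume V: "V \<subseteq> {1..r}" "p \<notin> V" "finite V"
    let ?F = "\<lambda>S. sgn_pow H (inversions S (insert p V - S)) (hirsch_join r (a, b) S \<otimes>
              koszul H (mon_degree n S) (hirsch_join r (a', b') (insert p V - S)))"
    let ?G = "\<lambda>S. sgn_pow H (inversions S (V - S)) (a S \<otimes> koszul H (mon_degree n S) (b' (V - S)))"
    let ?k = "koszul A (Suc 0) a'"
    let ?G' = "\<lambda>S. sgn_pow H (inversions S (V - S)) (b S \<otimes> koszul H (mon_degree n S) (?k (V - S)))"
    have sub: "S \<subseteq> {1..r}" "V - S \<subseteq> {1..r}" "finite S" "finite (V - S)" "p \<notin> S" "p \<notin> V - S"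
      if "S \<subseteq> V" for S using that V finite_subset by auto
    have k: "?k \<in> carrier A" using cl by simp
    have G: "?G S \<in> carrier H" "?G' S \<in> carrier H" if "S \<subseteq> V" for S
      using sub[OF that] cl k closed_old by simp_all
    have F: "?F S = ?G S" if "S \<subseteq> V" for S
    proof -
      have "insert p V - S = insert p (V - S)" using sub[OF that] by auto
      moreover have "inversions S (insert p (V - S)) = inversions S (V - S)"
        using sub(1)[OF that] by (intro inversions_insert_right) (auto simp: le_imp_less_Suc)
      ultimately show ?thesis
        using sub[OF that] by (simp add: hirsch_join_old hirsch_join_new)
    qed
    \<comment> \<open>Two new signs arise: \<open>card ?T\<close> from moving the last generator
      across the monomial of \<open>?T\<close>, and one more twist of the coefficient because
      \<open>m\<close> is odd. By \<open>koszul_hirsch\<close> they amount to the involution of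
      \<open>A\<close> applied to \<open>a'\<close>.\<close>
    have F': "?F (insert p S) = ?G' S" if "S \<subseteq> V" for S
    proof -
      let ?T = "V - S"
      have "insert p V - insert p S = ?T" using sub[OF that] V by auto
      moreover have "inversions (insert p S) ?T = inversions S ?T + card ?T"
        using sub[OF that] by (intro inversions_insert_left) (auto simp: le_imp_less_Suc)
      moreover have "mon_degree n (insert p S) = mon_degree n S + m"
        using sub[OF that] by (intro mon_degree_insert)
      ultimately have "?F (insert p S)
          = sgn_pow H (inversions S ?T + card ?T) (b S \<otimes> koszul H (mon_degree n S + m) (a' ?T))"
        using sub[OF that] by (simp add: hirsch_join_old hirsch_join_new)
      also have "koszul H (mon_degree n S + m) (a' ?T) = koszul H (mon_degree n S) (koszul H (Suc 0) (a' ?T))"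
        using koszul_koszul[of "a' ?T" "mon_degree n S" m] koszul_odd[OF m(1)] closed_old[OF cl(3)] sub[OF that]
        by simp
      also have "sgn_pow H (inversions S ?T + card ?T)
            (b S \<otimes> koszul H (mon_degree n S) (koszul H (Suc 0) (a' ?T))) = ?G' S"
        unfolding old.koszul_hirsch[OF cdga_A cl(3)]
        using sub[OF that] cl closed_old
        by (simp add: koszul_sgn_pow sgn_pow_r_mult sgn_pow_sgn_pow)
      finally show ?thesis .
    qed
    have Fc: "?F S \<in> carrier H" if "S \<subseteq> insert p V" for S
    proof (cases "p \<in> S")
      case True
      then have "S = insert p (S - {p})" "S - {p} \<subseteq> V" using that by auto
      then show ?thesis using F'[of "S - {p}"] G(2)[of "S - {p}"] by metis
    next
      case False
      then have "S \<subseteq> V" using that by auto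
      then show ?thesis using F G(1) by simp
    qed
    have "finsum H ?F (Pow (insert p V)) = finsum H ?F (Pow V) \<oplus> (\<Oplus>S\<in>Pow V. ?F (insert p S))"
      by (rule finsum_Pow_insert) (use V Fc in auto)
    also have "finsum H ?F (Pow V) = finsum H ?G (Pow V)"
      by (rule finsum_cong') (use F G in auto)
    also have "(\<Oplus>S\<in>Pow V. ?F (insert p S)) = finsum H ?G' (Pow V)"
      by (rule finsum_cong') (use F' G in auto)
    also have "finsum H ?G (Pow V) \<oplus> finsum H ?G' (Pow V) = (a \<otimes>\<^bsub>A\<^esub> b' \<oplus>\<^bsub>A\<^esub> b \<otimes>\<^bsub>A\<^esub> ?k) V"
      using V by (simp add: hirsch_extension_simps)
    finally show "snd (a \<otimes>\<^bsub>A\<^esub> a', a \<otimes>\<^bsub>A\<^esub> b' \<oplus>\<^bsub>A\<^esub> b \<otimes>\<^bsub>A\<^esub> ?k) V = finsum H ?F (Pow (insert p V))"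
      by simp
  qed
qed

text \<open>At a set without \<open>p\<close>, the summand for \<open>s = p\<close> is the product
  of the twisted \<open>b\<close> with \<open>e'\<close>, and the others form the differential of
  \<open>a\<close>. At a set with \<open>p\<close>, every remaining \<open>s\<close> is below
  \<open>p\<close>, so \<open>p\<close> does not affect the signs and the differential of
  \<open>b\<close> appears.\<close>

lemma hirsch_join_differential:
  assumes "x \<in> carrier E"
  shows "hirsch_join r (differential E x) = differential \<Lambda> (hirsch_join r x)"
proof -
  obtain a b where x: "x = (a, b)" and cl: "a \<in> carrier A" "b \<in> carrier A"
    using assms by (cases x) auto
  let ?dx = "(differential A a \<oplus>\<^bsub>A\<^esub> koszul A (Suc 0) b \<otimes>\<^bsub>A\<^esub> e', differential A b)"
  let ?F = "\<lambda>U s. sgn_pow H (card {u \<in> U. u < s}) (koszul H 1 (hirsch_join r (a, b) (insert s U)) \<otimes> e s)"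
  show ?thesis
    unfolding x adjoin_odd_simps hirsch_extension_simps(8)[of H "Suc r"]
  proof (rule hirsch_join_eqI)
    fix U assume U: "U \<subseteq> {1..r}" "p \<notin> U" "finite U"
    let ?G = "\<lambda>s. sgn_pow H (card {u \<in> U. u < s}) (koszul H 1 (a (insert s U)) \<otimes> e s)"
    have sub: "insert s U \<subseteq> {1..r}" "s \<in> {1..r}" "s \<in> {1..p}" if "s \<in> {1..r} - U" for s
      using that U by auto
    have ec: "e s \<in> carrier H" if "s \<in> {1..p}" for s using e_carrier[OF that] .
    have Gc: "?G s \<in> carrier H" if "s \<in> {1..r} - U" for s
      using sub[OF that] ec closed_old[OF cl(1)] by simp
    have FG: "?F U s = ?G s" if "s \<in> {1..r} - U" for s
      using hirsch_join_old[OF sub(1)[OF that], of "(a, b)"] by simp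
    \<comment> \<open>All generators of \<open>U\<close> precede \<open>p\<close>, so the sign is
      \<open>card U\<close>; together with the twist of the coefficient it is the involution of
      \<open>A\<close>.\<close>
    have "{u \<in> U. u < p} = U" using U by (auto simp: le_imp_less_Suc)
    then have Fp: "?F U p = sgn_pow H (card U) (koszul H 1 (b U) \<otimes> e p)"
      using hirsch_join_new[OF U(1), of "(a, b)"] by simp
    have bU: "b U \<in> carrier H" using closed_old[OF cl(2) U(1)] .
    have "{1..p} - U = insert p ({1..r} - U)" using U by (auto simp: le_Suc_eq)
    moreover have "finsum H (?F U) (insert p ({1..r} - U)) = ?F U p \<oplus> finsum H (?F U) ({1..r} - U)"
    proof (rule finsum_insert)
      show "?F U p \<in> carrier H" unfolding Fp using bU ec[of p] by simp
      show "?F U \<in> {1..r} - U \<rightarrow> carrier H" using FG Gc by (intro Pi_I) simp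
    qed simp_all
    ultimately have "finsum H (?F U) ({1..p} - U) = ?F U p \<oplus> finsum H (?F U) ({1..r} - U)"
      by simp
    also have "finsum H (?F U) ({1..r} - U) = finsum H ?G ({1..r} - U)"
      by (rule finsum_cong') (use FG Gc in auto)
    also have "\<dots> = differential A a U"
      using U by (simp add: hirsch_extension_simps)
    also have "?F U p = (koszul A (Suc 0) b \<otimes>\<^bsub>A\<^esub> e') U"
    proof -
      have "(koszul A (Suc 0) b \<otimes>\<^bsub>A\<^esub> e') U = koszul A (Suc 0) b U \<otimes> koszul H (mon_degree n U) (e p)"
        by (rule old.mult_incl_right) (use cl ec[of p] U in simp_all)
      also have "\<dots> = ?F U p"
        unfolding Fp old.koszul_hirsch[OF cdga_A cl(2)]
        using U ec[of p] bU by (simp add: koszul_e sgn_pow_l_mult)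
      finally show ?thesis by simp
    qed
    also have "(koszul A (Suc 0) b \<otimes>\<^bsub>A\<^esub> e') U \<oplus> differential A a U
        = (differential A a \<oplus>\<^bsub>A\<^esub> koszul A (Suc 0) b \<otimes>\<^bsub>A\<^esub> e') U"
    proof -
      have "differential A a \<in> carrier A" "koszul A (Suc 0) b \<otimes>\<^bsub>A\<^esub> e' \<in> carrier A"
        using cl A.d_closed e'(1) by (auto intro: A.m_closed)
      then show ?thesis using U closed_old by (simp add: hirsch_extension_simps(5) a_comm)
    qed
    finally show "fst ?dx U = finsum H (?F U) ({1..p} - U)"
      by simp
  next
    fix V assume V: "V \<subseteq> {1..r}" "p \<notin> V" "finite V"
    let ?G = "\<lambda>s. sgn_pow H (card {u \<in> V. u < s}) (koszul H 1 (b (insert s V)) \<otimes> e s)"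
    have eq: "{1..p} - insert p V = {1..r} - V" using V by (auto simp: le_Suc_eq)
    have sub: "insert s V \<subseteq> {1..r}" "s < p" "s \<in> {1..p}" if "s \<in> {1..r} - V" for s
      using that V by auto
    have Gc: "?G s \<in> carrier H" if "s \<in> {1..r} - V" for s
      using sub[OF that] e_carrier[of s] closed_old[OF cl(2)] by simp
    have FG: "?F (insert p V) s = ?G s" if "s \<in> {1..r} - V" for s
    proof -
      have "{u \<in> insert p V. u < s} = {u \<in> V. u < s}" using sub[OF that] by auto
      then show ?thesis
        using hirsch_join_new[OF sub(1)[OF that], of "(a, b)"] by (simp add: insert_commute)
    qed
    have "finsum H (?F (insert p V)) ({1..p} - insert p V) = finsum H ?G ({1..r} - V)"
      unfolding eq by (rule finsum_cong') (use FG Gc in auto)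
    also have "\<dots> = differential A b V" using V by (simp add: hirsch_extension_simps)
    finally show "snd ?dx V = finsum H (?F (insert p V)) ({1..p} - insert p V)"
      by simp
  qed
qed

text \<open>Injectivity disposes of the kernel condition in \<open>is_cdga_image\<close>, and later
  splits the cocycle equation into its two components.\<close>

lemma hirsch_join_eq_zero:
  assumes "x \<in> carrier E" "hirsch_join r x = \<zero>\<^bsub>\<Lambda>\<^esub>"
  shows "x = \<zero>\<^bsub>E\<^esub>"
proof -
  obtain a b where x: "x = (a, b)" and cl: "a \<in> carrier A" "b \<in> carrier A"
    using assms(1) by (cases x) auto
  have "a U = \<zero>" "b U = \<zero>" if "U \<subseteq> {1..r}" for U
  proof -
    have "U \<subseteq> {1..p}" "insert p U \<subseteq> {1..p}" using that by auto
    then show "a U = \<zero>" "b U = \<zero>"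
      using hirsch_join_old[OF that, of x] hirsch_join_new[OF that, of x] assms(2) x
      by (simp_all add: hirsch_extension_simps)
  qed
  then show ?thesis
    unfolding x using old.hirsch_eq_zero_iff[OF cl(1)] old.hirsch_eq_zero_iff[OF cl(2)] by simp
qed

lemma is_cdga_hirsch_Suc: "is_cdga K \<Lambda>"
proof (rule is_cdga_image[OF is_cdga_E hirsch_join_carrier hirsch_join_grade])
  interpret E: cdga E K by (rule cdga.intro) (rule is_cdga_E)
  show zero: "hirsch_join r \<zero>\<^bsub>E\<^esub> = \<zero>\<^bsub>\<Lambda>\<^esub>"
    unfolding hirsch_extension_simps by (rule hirsch_join_eqI) (simp_all add: hirsch_extension_simps)
  show "hirsch_join r \<one>\<^bsub>E\<^esub> = \<one>\<^bsub>\<Lambda>\<^esub>"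
    unfolding hirsch_extension_simps by (rule hirsch_join_eqI) (simp_all add: hirsch_extension_simps)
  show "hirsch_join r (hom_part E x i) = \<zero>\<^bsub>\<Lambda>\<^esub>"
    if "x \<in> carrier E" "hirsch_join r x = \<zero>\<^bsub>\<Lambda>\<^esub>" for x i
    using hirsch_join_eq_zero[OF that] E.hom_part_zero[of i] zero by simp
  show "hirsch_join r (x \<oplus>\<^bsub>E\<^esub> y) = hirsch_join r x \<oplus>\<^bsub>\<Lambda>\<^esub> hirsch_join r y" for x y
    unfolding hirsch_extension_simps by (rule hirsch_join_eqI; cases x; cases y)
      (simp_all add: hirsch_join_old hirsch_join_new hirsch_extension_simps)
  show "hirsch_join r (a \<odot>\<^bsub>E\<^esub> x) = a \<odot>\<^bsub>\<Lambda>\<^esub> hirsch_join r x" for a x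
    unfolding hirsch_extension_simps by (rule hirsch_join_eqI; cases x)
      (simp_all add: hirsch_join_old hirsch_join_new hirsch_extension_simps)
qed (fact hirsch_join_mult hirsch_join_differential)+

end

end

section \<open>Acyclicity in low degrees\<close>

text \<open>The component of any primitive in degree \<open>j - 1\<close> is again a primitive. In
  degree 0 there is no room for one, and the only coboundary is zero.\<close>

lemma (in cdga) homogeneous_coboundary:
  assumes "b \<in> coboundaries A" "b \<in> grade A j"
  obtains c where "c \<in> (if j = 0 then {\<zero>} else grade A (j - 1))" "d c = b"
proof -
  obtain w where w: "w \<in> carrier A" "b = d w" using assms(1) by (auto simp: coboundaries_def)
  have "hom_part A b j = b" using hom_part_homogeneous[OF assms(2)] by simp
  then have b: "b = (if j = 0 then \<zero> else d (hom_part A w (j - 1)))"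
    using hom_part_d[OF w(1)] w(2) by metis
  show ?thesis
    by (rule that[of "if j = 0 then \<zero> else hom_part A w (j - 1)"]) (use b w in auto)
qed

lemma is_cdga_hirsch:
  assumes "even_sequence H K e n r"
  shows "is_cdga K (hirsch_extension H r e n)"
  using assms
proof (induction r)
  case 0
  then interpret even_sequence H K e n 0 .
  show ?case by (rule is_cdga_hirsch_0)
next
  case (Suc r)
  interpret even_sequence H K e n "Suc r" by fact
  interpret even_sequence_Suc H K e n r by unfold_locales
  show ?case
    by (rule is_cdga_hirsch_Suc) (rule Suc.IH, rule old.even_sequence_axioms)
qed

section \<open>The ideal generated by the sequence\<close>

context even_sequence
begin

abbreviation I where "I \<equiv> sum_ideal H e {1..r}"

lemma sum_idealI: "h \<in> {1..r} \<rightarrow> carrier H \<Longrightarrow> (\<Oplus>\<beta>\<in>{1..r}. e \<beta> \<otimes> h \<beta>) \<in> I"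
  unfolding sum_ideal_def by blast

lemma sum_idealE:
  assumes "x \<in> I"
  obtains h where "h \<in> {1..r} \<rightarrow> carrier H" "x = (\<Oplus>\<beta>\<in>{1..r}. e \<beta> \<otimes> h \<beta>)"
  using assms unfolding sum_ideal_def by blast

lemma sum_ideal_closed: "x \<in> I \<Longrightarrow> x \<in> carrier H"
  by (erule sum_idealE) (auto intro!: finsum_closed m_closed e_carrier)

lemma sum_ideal_r_mult:
  assumes "x \<in> I" "y \<in> carrier H"
  shows "x \<otimes> y \<in> I"
proof -
  obtain h where h: "h \<in> {1..r} \<rightarrow> carrier H" "x = (\<Oplus>\<beta>\<in>{1..r}. e \<beta> \<otimes> h \<beta>)"
    using assms(1) by (rule sum_idealE)
  note hc = funcset_mem[OF h(1)]
  have "x \<otimes> y = (\<Oplus>\<beta>\<in>{1..r}. e \<beta> \<otimes> h \<beta> \<otimes> y)"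
    unfolding h(2) by (rule finsum_ldistr) (use assms hc e_carrier in auto)
  also have "\<dots> = (\<Oplus>\<beta>\<in>{1..r}. e \<beta> \<otimes> (h \<beta> \<otimes> y))"
    by (rule finsum_cong') (use assms hc e_carrier m_assoc in auto)
  also have "\<dots> \<in> I" by (rule sum_idealI) (use hc assms in auto)
  finally show ?thesis .
qed

lemma sum_ideal_l_mult:
  assumes "x \<in> I" "y \<in> carrier H"
  shows "y \<otimes> x \<in> I"
proof -
  obtain h where h: "h \<in> {1..r} \<rightarrow> carrier H" "x = (\<Oplus>\<beta>\<in>{1..r}. e \<beta> \<otimes> h \<beta>)"
    using assms(1) by (rule sum_idealE)
  note hc = funcset_mem[OF h(1)]
  have "y \<otimes> x = (\<Oplus>\<beta>\<in>{1..r}. y \<otimes> (e \<beta> \<otimes> h \<beta>))"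
    unfolding h(2) by (rule finsum_rdistr) (use assms hc e_carrier in auto)
  also have "\<dots> = (\<Oplus>\<beta>\<in>{1..r}. e \<beta> \<otimes> (y \<otimes> h \<beta>))"
  proof (rule finsum_cong')
    fix \<beta> assume \<beta>: "\<beta> \<in> {1..r}"
    show "y \<otimes> (e \<beta> \<otimes> h \<beta>) = e \<beta> \<otimes> (y \<otimes> h \<beta>)"
      using e_central[OF \<beta> assms(2)] e_carrier[OF \<beta>] hc[OF \<beta>] assms(2) by (metis m_assoc)
  qed (use assms hc e_carrier in auto)
  also have "\<dots> \<in> I" by (rule sum_idealI) (use hc assms in auto)
  finally show ?thesis .
qed

text \<open>Centrality of the \<open>e \<beta>\<close> makes the set of their right multiples
  two-sided. It is homogeneous because a component of \<open>e \<beta> \<otimes> h \<beta>\<close>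
  is \<open>e \<beta>\<close> times a component of \<open>h \<beta>\<close>.\<close>

lemma homogeneous_ideal_sum_ideal: "homogeneous_ideal H K I"
proof -
  have add: "x \<oplus> y \<in> I" if x: "x \<in> I" and y: "y \<in> I" for x y
  proof -
    obtain h where h: "h \<in> {1..r} \<rightarrow> carrier H" "x = (\<Oplus>\<beta>\<in>{1..r}. e \<beta> \<otimes> h \<beta>)"
      using x by (rule sum_idealE)
    note hc = funcset_mem[OF h(1)]
    obtain k where k: "k \<in> {1..r} \<rightarrow> carrier H" "y = (\<Oplus>\<beta>\<in>{1..r}. e \<beta> \<otimes> k \<beta>)"
      using y by (rule sum_idealE)
    note kc = funcset_mem[OF k(1)]
    have "x \<oplus> y = (\<Oplus>\<beta>\<in>{1..r}. e \<beta> \<otimes> h \<beta> \<oplus> e \<beta> \<otimes> k \<beta>)"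
      unfolding h(2) k(2) by (rule finsum_addf[symmetric]) (use hc kc e_carrier in auto)
    also have "\<dots> = (\<Oplus>\<beta>\<in>{1..r}. e \<beta> \<otimes> (h \<beta> \<oplus> k \<beta>))"
      by (rule finsum_cong') (use hc kc e_carrier r_distr in auto)
    also have "\<dots> \<in> I" by (rule sum_idealI) (use hc kc in auto)
    finally show ?thesis .
  qed
  have "(\<Oplus>\<beta>\<in>{1..r}. e \<beta> \<otimes> \<zero>) \<in> I" by (rule sum_idealI) simp
  moreover have "(\<Oplus>\<beta>\<in>{1..r}. e \<beta> \<otimes> \<zero>) = \<zero>"
    by (rule add.finprod_one_eqI) (use e_carrier in auto)
  ultimately have zero: "\<zero> \<in> I" by simp
  have minus: "\<ominus> x \<in> I" if "x \<in> I" for x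
    using sum_ideal_r_mult[OF that, of "\<ominus> \<one>"] sum_ideal_closed[OF that] by (simp add: r_minus)
  have ideal: "ideal I H"
  proof (rule idealI)
    show "ring H" by unfold_locales
    show "subgroup I (add_monoid H)"
      by (rule subgroup.intro) (use add zero minus sum_ideal_closed in \<open>auto simp: a_inv_def\<close>)
  qed (use sum_ideal_l_mult sum_ideal_r_mult in auto)
  have hom: "hom_part H x i \<in> I" if x: "x \<in> I" for x i
  proof -
    obtain h where h: "h \<in> {1..r} \<rightarrow> carrier H" "x = (\<Oplus>\<beta>\<in>{1..r}. e \<beta> \<otimes> h \<beta>)"
      using x by (rule sum_idealE)
    note hc = funcset_mem[OF h(1)]
    let ?h = "\<lambda>\<beta>. if n \<beta> \<le> i then hom_part H (h \<beta>) (i - n \<beta>) else \<zero>"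
    have "hom_part H x i = (\<Oplus>\<beta>\<in>{1..r}. hom_part H (e \<beta> \<otimes> h \<beta>) i)"
      unfolding h(2) by (rule hom_part_finsum) (use hc e_carrier in auto)
    also have "\<dots> = (\<Oplus>\<beta>\<in>{1..r}. e \<beta> \<otimes> ?h \<beta>)"
    proof (rule finsum_cong')
      show "hom_part H (e \<beta> \<otimes> h \<beta>) i = e \<beta> \<otimes> ?h \<beta>" if "\<beta> \<in> {1..r}" for \<beta>
        using hom_part_mult_homogeneous[OF e_grade[OF that] hc[OF that]] e_carrier[OF that] by simp
      show "(\<lambda>\<beta>. e \<beta> \<otimes> ?h \<beta>) \<in> {1..r} \<rightarrow> carrier H"
        using hc e_carrier by (auto intro!: m_closed)
    qed simp
    also have "\<dots> \<in> I" by (rule sum_idealI) (use hc in auto)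
    finally show ?thesis .
  qed
  show ?thesis
    by (intro homogeneous_ideal.intro homogeneous_ideal_axioms.intro graded_axioms ideal hom)
qed

text \<open>Only terms with a single generator reach the constant coefficient under the
  differential. Hence the projection to \<open>H/I\<close> is compatible with the zero
  differential.\<close>

lemma differential_empty_mem:
  assumes f: "f \<in> carrier \<Lambda>"
  shows "differential \<Lambda> f {} \<in> I"
proof -
  have f1: "f {s} \<in> carrier H" if "s \<in> {1..r}" for s
    using hirsch_apply_closed[OF f] that by simp
  have "differential \<Lambda> f {} = (\<Oplus>s\<in>{1..r}. koszul H (Suc 0) (f {s}) \<otimes> e s)"
    by (simp add: hirsch_extension_simps sgn_pow_def)
  also have "\<dots> = (\<Oplus>s\<in>{1..r}. e s \<otimes> koszul H (Suc 0) (f {s}))"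
    by (rule finsum_cong') (use f1 e_carrier e_central in auto)
  also have "\<dots> \<in> I" by (rule sum_idealI) (use f1 in auto)
  finally show ?thesis .
qed

lemma incl_sum_ideal:
  assumes "x \<in> I"
  shows "incl x \<in> coboundaries \<Lambda>"
proof -
  obtain h where h: "h \<in> {1..r} \<rightarrow> carrier H" "x = (\<Oplus>\<beta>\<in>{1..r}. e \<beta> \<otimes> h \<beta>)"
    using assms by (rule sum_idealE)
  note hc = funcset_mem[OF h(1)]
  \<comment> \<open>The sum of the twisted \<open>h \<beta>\<close> times the generators of index
    \<open>\<beta>\<close>; the twist cancels the one in the differential.\<close>
  define w where "w = (\<lambda>U\<in>Pow {1..r}. if card U = 1 then koszul H (Suc 0) (h (the_elem U)) else \<zero>)"
  have w: "w \<in> carrier \<Lambda>"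
    unfolding hirsch_extension_simps w_def
    using hc by (auto simp: card_1_singleton_iff)
  have "incl x = differential \<Lambda> w"
    unfolding incl_def hirsch_extension_simps
  proof (rule restrict_ext)
    fix U assume U: "U \<in> Pow {1..r}"
    let ?F = "\<lambda>s. sgn_pow H (card {u \<in> U. u < s}) (koszul H 1 (w (insert s U)) \<otimes> e s)"
    show "(if U = {} then x else \<zero>) = finsum H ?F ({1..r} - U)"
    proof (cases "U = {}")
      case True
      have "x = finsum H ?F {1..r}"
        unfolding h(2) using True hc e_carrier e_central
        by (intro finsum_cong') (auto simp: w_def sgn_pow_def)
      then show ?thesis using True by simp
    next
      case False
      have "?F s = \<zero>" if s: "s \<in> {1..r} - U" for s
      proof -
        have "finite U" using U finite_subset[of U] by auto
        then have "card (insert s U) \<noteq> 1" using False s by simp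
        then have "w (insert s U) = \<zero>" using U s by (simp add: w_def)
        then show ?thesis using s e_carrier by simp
      qed
      then have "finsum H ?F ({1..r} - U) = \<zero>" by (rule add.finprod_one_eqI)
      then show ?thesis using False by simp
    qed
  qed
  then show ?thesis using w by (simp add: coboundaries_def)
qed

lemma mult_empty:
  assumes "f \<in> carrier \<Lambda>" "g \<in> carrier \<Lambda>"
  shows "(f \<otimes>\<^bsub>\<Lambda>\<^esub> g) {} = f {} \<otimes> g {}"
  using assms hirsch_apply_closed[of _ "{}"]
  by (simp add: hirsch_extension_simps(2) sgn_pow_def koszul_even)

lemma grade_empty: "f \<in> grade \<Lambda> i \<Longrightarrow> f {} \<in> grade H i"
  unfolding hirsch_extension_simps by (auto dest!: bspec[of _ _ "{}"])

lemma hirsch_eqI: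
  assumes "f \<in> carrier \<Lambda>" "g \<in> carrier \<Lambda>" "\<And>U. U \<subseteq> {1..r} \<Longrightarrow> f U = g U"
  shows "f = g"
  using assms(1,2) unfolding hirsch_extension_simps
  by (rule PiE_ext) (use assms(3) in simp)

end

context even_sequence_Suc
begin

lemma sum_ideal_SucE:
  assumes "x \<in> I"
  obtains y h where "y \<in> old.I" "h \<in> carrier H" "x = y \<oplus> e p \<otimes> h"
proof -
  obtain h where h: "h \<in> {1..p} \<rightarrow> carrier H" "x = (\<Oplus>\<beta>\<in>{1..p}. e \<beta> \<otimes> h \<beta>)"
    using assms by (rule sum_idealE)
  note hc = funcset_mem[OF h(1)]
  have cl: "e \<beta> \<otimes> h \<beta> \<in> carrier H" if "\<beta> \<in> {1..p}" for \<beta>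
    using that hc e_carrier by simp
  have hp: "h p \<in> carrier H" "e p \<in> carrier H" using hc e_carrier by auto
  let ?y = "\<Oplus>\<beta>\<in>{1..r}. e \<beta> \<otimes> h \<beta>"
  have y: "?y \<in> old.I" by (rule old.sum_idealI) (use hc in auto)
  have "x = (\<Oplus>\<beta>\<in>insert p {1..r}. e \<beta> \<otimes> h \<beta>)"
    unfolding h(2) by (simp add: atLeastAtMostSuc_conv)
  also have "\<dots> = e p \<otimes> h p \<oplus> ?y"
    by (rule finsum_insert) (use cl in auto)
  also have "\<dots> = ?y \<oplus> e p \<otimes> h p"
    using hp old.sum_ideal_closed[OF y] by (simp add: a_comm)
  finally show ?thesis using y hp(1) that by blast
qed

lemma e_mult_mem: "h \<in> carrier H \<Longrightarrow> e p \<otimes> h \<in> I"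
proof -
  assume h: "h \<in> carrier H"
  let ?h = "\<lambda>\<beta>. if \<beta> = p then \<one> else \<zero>"
  have "(\<Oplus>\<beta>\<in>{1..p}. e \<beta> \<otimes> ?h \<beta>) = (\<Oplus>\<beta>\<in>{1..p}. if p = \<beta> then e \<beta> else \<zero>)"
    by (rule finsum_cong') (use e_carrier in auto)
  also have "\<dots> = e p" by (rule finsum_singleton) (use e_carrier in auto)
  finally have "e p \<in> I" using sum_idealI[of ?h] by force
  then show ?thesis using h by (rule sum_ideal_r_mult)
qed

text \<open>Regularity at the last index in terms of elements: the ideal divided out there is the
  one of the previous stage, and injectivity is used for the classes of \<open>b\<close> and of
  zero.\<close>

lemma regular_cancel:
  assumes reg: "q_regular H q p e n" and b: "b \<in> grade H j"
    and j: "int j \<le> int q - int (n p) + 2" and eb: "e p \<otimes> b \<in> old.I"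
  shows "b \<in> old.I"
proof -
  interpret J: homogeneous_ideal H K old.I by (rule old.homogeneous_ideal_sum_ideal)
  let ?Q = "quot_alg H old.I"
  have "p \<in> {1..p}" "{1..<p} = {1..r}" by auto
  then have inj: "inj_on (\<lambda>X. (old.I +> e p) \<otimes>\<^bsub>?Q\<^esub> X) (grade ?Q j)"
    using reg j unfolding q_regular_def Let_def by metis
  have ep: "e p \<in> carrier H" "b \<in> carrier H" using e_carrier b by auto
  have mult: "(old.I +> e p) \<otimes>\<^bsub>?Q\<^esub> (old.I +> x) = old.I +> e p \<otimes> x" if "x \<in> carrier H" for x
    using ring_hom_mult[OF J.rcos_ring_hom ep(1) that] by (simp add: quot_alg_def)
  have "old.I +> b = old.I +> \<zero>"
  proof (rule inj_onD[OF inj])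
    show "(old.I +> e p) \<otimes>\<^bsub>?Q\<^esub> (old.I +> b) = (old.I +> e p) \<otimes>\<^bsub>?Q\<^esub> (old.I +> \<zero>)"
      unfolding mult[OF ep(2)] mult[OF zero_closed]
      using ep eb J.coset_eq_iff[of "e p \<otimes> b" \<zero>] by (simp add: minus_eq)
  qed (use b in \<open>auto simp: quot_alg_def\<close>)
  then show ?thesis using J.coset_eq_iff[of b \<zero>] ep by (simp add: minus_eq)
qed

text \<open>
  For a cocycle \<open>a + b t\<close>, the constant term of \<open>b\<close> is killed by \<open>e\<^sub>p\<close> modulo the previous \<open>e\<^sub>\<beta>\<close>.
  Since \<open>|b| \<le> q - n\<^sub>p + 2\<close>, regularity and the induction hypothesis give \<open>b = d c\<close>; subtracting
  \<open>d (c t)\<close> and then \<open>d (h t)\<close> for a suitable \<open>h\<close> in \<open>H\<close> leads back to the previous stage.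
\<close>

lemma acyclic_Suc:
  assumes cdga_A: "is_cdga K A" and reg: "q_regular H q p e n"
    and IH: "\<And>i z. \<lbrakk>i \<le> Suc q; z \<in> grade A i; differential A z = \<zero>\<^bsub>A\<^esub>; z {} \<in> old.I\<rbrakk>
        \<Longrightarrow> z \<in> coboundaries A"
    and i: "i \<le> Suc q" and z: "z \<in> grade \<Lambda> i" "differential \<Lambda> z = \<zero>\<^bsub>\<Lambda>\<^esub>" "z {} \<in> I"
  shows "z \<in> coboundaries \<Lambda>"
proof -
  interpret A: cdga A K by (rule cdga.intro) (rule cdga_A)
  interpret J: homogeneous_ideal H K old.I by (rule old.homogeneous_ideal_sum_ideal)
  interpret I: homogeneous_ideal H K I by (rule homogeneous_ideal_sum_ideal)
  let ?m = "n p - 1" and ?e = "old.incl (e p)" and ?\<sigma> = "koszul A (Suc 0)"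
  let ?E = "adjoin_odd A ?m ?e"
  have m: "odd ?m" "n p = Suc ?m"
    using degree_pos[of p] degree_even[of p] by auto
  have ep: "e p \<in> carrier H" using e_carrier by simp
  have e: "?e \<in> grade A (Suc ?m)" "differential A ?e = \<zero>\<^bsub>A\<^esub>" "?e \<in> carrier A"
    using e'[OF cdga_A] old.incl_closed[OF ep] by auto
  have mult_e: "(x \<otimes>\<^bsub>A\<^esub> ?e) {} = x {} \<otimes> e p" if "x \<in> carrier A" for x
    using old.mult_empty[OF that e(3)] by simp
  have add0: "(x \<oplus>\<^bsub>A\<^esub> y) {} = x {} \<oplus> y {}" for x y by (simp add: hirsch_extension_simps)
  have cl0: "x {} \<in> carrier H" if "x \<in> carrier A" for x using old.hirsch_apply_closed[OF that] by simp
  have \<sigma>0: "(?\<sigma> x) {} = koszul H (Suc 0) (x {})" if "x \<in> carrier A" for x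
    unfolding old.koszul_hirsch[OF cdga_A that] by (simp add: sgn_pow_def)
  have "z \<in> hirsch_join r ` grade ?E i" using z(1) unfolding hirsch_join_grade[OF cdga_A] .
  then obtain a b where z_eq: "z = hirsch_join r (a, b)" and a: "a \<in> grade A i"
    and b: "b \<in> (if ?m \<le> i then grade A (i - ?m) else {\<zero>\<^bsub>A\<^esub>})"
    unfolding adjoin_odd_simps by blast
  have cl: "a \<in> carrier A" "b \<in> carrier A"
    using a b by (auto split: if_splits)
  have "hirsch_join r (differential ?E (a, b)) = \<zero>\<^bsub>\<Lambda>\<^esub>"
    using hirsch_join_differential[OF cdga_A, of "(a, b)"] cl z(2) z_eq by simp
  moreover have "differential ?E (a, b) \<in> carrier ?E" using cl e A.d_closed by simp
  ultimately have "differential ?E (a, b) = \<zero>\<^bsub>?E\<^esub>"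
    using hirsch_join_eq_zero[OF cdga_A] by blast
  then have da: "differential A a \<oplus>\<^bsub>A\<^esub> ?\<sigma> b \<otimes>\<^bsub>A\<^esub> ?e = \<zero>\<^bsub>A\<^esub>" and db: "differential A b = \<zero>\<^bsub>A\<^esub>"
    by simp_all
  have b0: "b {} \<in> old.I" if mi: "?m \<le> i"
  proof (rule regular_cancel[OF reg])
    show bj: "b {} \<in> grade H (i - ?m)" using b mi by (intro old.grade_empty) simp
    \<comment> \<open>With \<open>i\<close> at most \<open>Suc q\<close> and
      \<open>?m = n p - 1\<close>, the degree \<open>i - ?m\<close> stays within the range of the
      regularity assumption; for \<open>i = Suc q\<close> it is its upper end.\<close>
    show "int (i - ?m) \<le> int q - int (n p) + 2" using mi i m(2) by linarith
    have "differential A a {} \<oplus> koszul H (Suc 0) (b {}) \<otimes> e p = \<zero>"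
      using arg_cong[OF da, of "\<lambda>f. f {}"] cl
      by (simp add: add0 mult_e \<sigma>0) (simp add: hirsch_extension_simps)
    then have "koszul H (Suc 0) (b {}) \<otimes> e p = \<ominus> (differential A a {})"
      using cl0[OF cl(2)] cl0[OF A.d_closed[OF cl(1)]] ep
      by (metis koszul_closed m_closed a_comm minus_equality)
    then have "koszul H (Suc 0) (b {}) \<otimes> e p \<in> old.I"
      using old.differential_empty_mem[OF cl(1)] J.a_inv_closed by simp
    \<comment> \<open>On the homogeneous \<open>b {}\<close> the involution is a sign; applying the
      same sign once more removes it, and the ideal is stable under signs.\<close>
    then have "sgn_pow H (i - ?m) (koszul H (Suc 0) (b {}) \<otimes> e p) \<in> old.I"
      using J.a_inv_closed by (simp add: sgn_pow_def)
    moreover have "sgn_pow H (i - ?m) (koszul H (Suc 0) (b {}) \<otimes> e p) = b {} \<otimes> e p"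
      using cl0[OF cl(2)] ep koszul_homogeneous[OF bj, of "Suc 0"]
      by (simp add: sgn_pow_l_mult sgn_pow_sgn_pow) (simp add: sgn_pow_def)
    ultimately have "b {} \<otimes> e p \<in> old.I" by simp
    then show "e p \<otimes> b {} \<in> old.I"
      using e_central[of p "b {}"] cl0[OF cl(2)] by simp
  qed
  have "b \<in> coboundaries A"
  proof (cases "?m \<le> i")
    case True
    then show ?thesis using b b0 db i by (intro IH[of "i - ?m"]) auto
  next
    case False
    then show ?thesis using b A.d_zero by (auto simp: coboundaries_def intro: rev_image_eqI[of "\<zero>\<^bsub>A\<^esub>"])
  qed
  \<comment> \<open>A homogeneous primitive \<open>c\<close> is wanted, so that its contribution
    stays in degree \<open>i\<close>. If \<open>i\<close> equals \<open>?m\<close>, then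
    \<open>b\<close> is a coboundary in degree 0 and \<open>c\<close> is zero; if \<open>i\<close>
    is smaller, then \<open>b\<close> itself is zero.\<close>
  obtain c where c: "?\<sigma> c \<otimes>\<^bsub>A\<^esub> ?e \<in> grade A i" "differential A c = b" "c \<in> carrier A"
  proof (cases "?m \<le> i")
    case True
    then have "b \<in> grade A (i - ?m)" using b by simp
    with \<open>b \<in> coboundaries A\<close> obtain c
      where c: "c \<in> (if i - ?m = 0 then {\<zero>\<^bsub>A\<^esub>} else grade A (i - ?m - 1))" "differential A c = b"
      by (rule A.homogeneous_coboundary)
    have "?\<sigma> c \<otimes>\<^bsub>A\<^esub> ?e \<in> grade A i"
    proof (cases "i - ?m = 0")
      case True
      then show ?thesis using c(1) e(3) by simp
    next
      case False
      then show ?thesis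
        using c(1) A.mult_grade[OF A.koszul_grade e(1), of c "i - ?m - 1" "Suc 0"] by simp
    qed
    moreover have "c \<in> carrier A" using c(1) by (auto split: if_splits)
    ultimately show ?thesis using c(2) by (intro that)
  next
    case False
    then show ?thesis using b e(3) by (intro that[of "\<zero>\<^bsub>A\<^esub>"]) simp_all
  qed
  \<comment> \<open>The first component of \<open>(a, b)\<close> minus the differential of
    \<open>(0, c)\<close>; the second component has become zero.\<close>
  let ?a1 = "a \<ominus>\<^bsub>A\<^esub> ?\<sigma> c \<otimes>\<^bsub>A\<^esub> ?e"
  have a1: "?a1 \<in> grade A i" using a c(1) by (auto simp: A.minus_eq)
  have neg0: "(\<ominus>\<^bsub>A\<^esub> x) {} = \<ominus> (x {})" if x: "x \<in> carrier A" for x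
  proof -
    have "(\<ominus>\<^bsub>A\<^esub> x) {} \<oplus> x {} = \<zero>"
      using arg_cong[OF A.l_neg[OF x], of "\<lambda>f. f {}"] by (simp add: add0) (simp add: hirsch_extension_simps)
    then show ?thesis using cl0 x by (metis A.a_inv_closed minus_equality)
  qed
  have sub0: "(x \<ominus>\<^bsub>A\<^esub> y) {} = x {} \<ominus> y {}" if "y \<in> carrier A" for x y
    using neg0[OF that] by (simp add: A.minus_eq add0 minus_eq)
  have \<sigma>c: "?\<sigma> c \<in> carrier A" "?\<sigma> c \<otimes>\<^bsub>A\<^esub> ?e \<in> carrier A" using c(3) e(3) by auto
  have "z {} = a {}" unfolding z_eq by (simp add: hirsch_join_def)
  then have "a {} \<in> I" using z(3) by simp
  moreover have "(?\<sigma> c \<otimes>\<^bsub>A\<^esub> ?e) {} \<in> I"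
    using e_mult_mem[of "?\<sigma> c {}"] cl0[OF \<sigma>c(1)] e_central[of p "?\<sigma> c {}"] by (simp add: mult_e[OF \<sigma>c(1)])
  ultimately have "?a1 {} \<in> I"
    unfolding sub0[OF \<sigma>c(2)] minus_eq by (intro I.a_closed I.a_inv_closed)
  then obtain y h where y: "y \<in> old.I" and h: "h \<in> carrier H" and a1_eq: "?a1 {} = y \<oplus> e p \<otimes> h"
    by (rule sum_ideal_SucE)
  \<comment> \<open>Only the part of \<open>h\<close> in degree \<open>i - n p\<close> matters,
    since \<open>?a1 {}\<close> has degree \<open>i\<close>. For \<open>i < n p\<close> that part is
    zero, and the truncated difference must not be used.\<close>
  define h' where "h' = (if n p \<le> i then hom_part H h (i - n p) else \<zero>)"
  have h': "h' \<in> carrier H" using h by (simp add: h'_def)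
  have yc: "y \<in> carrier H" using y by (rule J.a_Hcarr)
  have "?a1 {} = hom_part H (y \<oplus> e p \<otimes> h) i"
    using hom_part_homogeneous[OF old.grade_empty[OF a1]] unfolding a1_eq by simp
  also have "\<dots> = hom_part H y i \<oplus> e p \<otimes> h'"
    using yc h ep hom_part_mult_homogeneous[OF e_grade[of p] h]
    by (simp add: hom_part_add h'_def)
  finally have a1_0: "?a1 {} = hom_part H y i \<oplus> e p \<otimes> h'" .
  let ?g = "old.incl h'"
  have g: "?g \<in> carrier A" "differential A ?g = \<zero>\<^bsub>A\<^esub>"
    using h' old.incl_closed old.differential_incl by auto
  have ge: "?g \<otimes>\<^bsub>A\<^esub> ?e \<in> grade A i"
  proof (cases "n p \<le> i")
    case True
    then have "?g \<in> grade A (i - n p)" using h by (intro old.incl_grade) (simp add: h'_def)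
    then show ?thesis using A.mult_grade[OF _ e(1), of ?g "i - n p"] True m(2) by simp
  next
    case False
    then have "?g = \<zero>\<^bsub>A\<^esub>" by (simp add: h'_def old.incl_def hirsch_extension_simps)
    then show ?thesis using e(3) by simp
  qed
  \<comment> \<open>Subtracts the differential of \<open>(0, koszul A (Suc 0) ?g)\<close>, which
    removes the multiple of \<open>e p\<close> from the constant coefficient and leaves an element
    of the old ideal.\<close>
  let ?a2 = "?a1 \<ominus>\<^bsub>A\<^esub> ?g \<otimes>\<^bsub>A\<^esub> ?e"
  have gec: "?g \<otimes>\<^bsub>A\<^esub> ?e \<in> carrier A" using g e by simp
  have "?a2 \<in> coboundaries A"
  proof (rule IH[OF i])
    show "?a2 \<in> grade A i" using a1 ge by (auto simp: A.minus_eq)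
    \<comment> \<open>Both \<open>a\<close> and \<open>?\<sigma> c\<close> times \<open>?e\<close>
      have the differential \<open>\<ominus> (?\<sigma> b \<otimes> ?e)\<close>, by the cocycle
      equation and by anticommutation, so the difference is closed.\<close>
    have "\<ominus>\<^bsub>A\<^esub> differential A (?\<sigma> c) = ?\<sigma> b"
      using A.koszul_d[OF c(3)] c(2) by simp
    then have "\<ominus>\<^bsub>A\<^esub> differential A (?\<sigma> c \<otimes>\<^bsub>A\<^esub> ?e) = ?\<sigma> b \<otimes>\<^bsub>A\<^esub> ?e"
      using \<sigma>c e A.d_closed by (simp add: A.d_mult A.l_minus[symmetric])
    moreover have "differential A (?g \<otimes>\<^bsub>A\<^esub> ?e) = \<zero>\<^bsub>A\<^esub>"
      using g e by (simp add: A.d_mult)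
    ultimately show "differential A ?a2 = \<zero>\<^bsub>A\<^esub>"
      using cl \<sigma>c gec da by (simp add: A.minus_eq A.d_add A.d_minus)
    have "?a2 {} = hom_part H y i"
    proof -
      have "?a2 {} = (hom_part H y i \<oplus> e p \<otimes> h') \<ominus> h' \<otimes> e p"
        unfolding sub0[OF gec] mult_e[OF g(1)] a1_0 by simp
      also have "\<dots> = hom_part H y i"
        using yc h' ep e_central[of p h'] by (simp add: minus_eq a_assoc r_neg)
      finally show ?thesis .
    qed
    then show "?a2 {} \<in> old.I" using J.hom_part_mem[OF y] by simp
  qed
  then obtain u where u: "u \<in> carrier A" "differential A u = ?a2"
    by (auto simp: coboundaries_def)
  \<comment> \<open>The differential twists the coefficient of \<open>t\<close>, so
    \<open>?g\<close> is twisted in advance. The primitive of \<open>(a, b)\<close> is then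
    \<open>(u, c + ?x)\<close>.\<close>
  let ?x = "?\<sigma> ?g"
  have x: "?x \<in> carrier A" "?\<sigma> ?x = ?g" using g by simp_all
  have "\<ominus>\<^bsub>A\<^esub> differential A ?x = \<zero>\<^bsub>A\<^esub>" using A.koszul_d[OF g(1)] g(2) by simp
  then have dx: "differential A ?x = \<zero>\<^bsub>A\<^esub>" using A.d_closed[OF x(1)] by (metis A.minus_minus A.minus_zero)
  have "differential ?E (u, c \<oplus>\<^bsub>A\<^esub> ?x) = (a, b)"
  proof -
    have "?a2 \<oplus>\<^bsub>A\<^esub> (?\<sigma> c \<otimes>\<^bsub>A\<^esub> ?e \<oplus>\<^bsub>A\<^esub> ?g \<otimes>\<^bsub>A\<^esub> ?e) = a"
      using cl(1) \<sigma>c(2) gec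
      by (simp add: A.minus_eq A.a_ac A.r_neg1 A.r_neg2 A.l_neg A.r_neg)
    then show ?thesis
      using u c x dx e \<sigma>c g cl by (simp add: A.koszul_add A.d_add A.l_distr)
  qed
  then have "z = differential \<Lambda> (hirsch_join r (u, c \<oplus>\<^bsub>A\<^esub> ?x))"
    using hirsch_join_differential[OF cdga_A, of "(u, c \<oplus>\<^bsub>A\<^esub> ?x)"] u c x by (simp add: z_eq)
  moreover have "hirsch_join r (u, c \<oplus>\<^bsub>A\<^esub> ?x) \<in> carrier \<Lambda>"
    unfolding hirsch_join_carrier[OF cdga_A, symmetric] using u c x by (intro imageI) simp
  ultimately show ?thesis by (auto simp: coboundaries_def)
qed

end

text \<open>Without generators the ideal is zero, which forces \<open>z\<close> to vanish. The bound
  \<open>Suc q\<close> is the same at every stage: the induction hypothesis is applied in degree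
  \<open>i\<close> and in the smaller degree of the coefficient of the last generator, so
  \<open>i\<close> and \<open>z\<close> vary.\<close>

lemma acyclic_hirsch:
  assumes "even_sequence H K e n r" "q_regular H q r e n"
    and "i \<le> Suc q" "z \<in> grade (hirsch_extension H r e n) i"
    and "differential (hirsch_extension H r e n) z = \<zero>\<^bsub>hirsch_extension H r e n\<^esub>"
    and "z {} \<in> sum_ideal H e {1..r}"
  shows "z \<in> coboundaries (hirsch_extension H r e n)"
  using assms
proof (induction r arbitrary: i z)
  case 0
  interpret even_sequence H K e n 0 by fact
  interpret L: cdga \<Lambda> K by (rule cdga.intro) (rule is_cdga_hirsch, fact)
  have z: "z \<in> carrier \<Lambda>" using "0.prems"(4) by (rule L.grade_carrier)
  have "z {} = \<zero>\<^bsub>H\<^esub>" using "0.prems"(6) by (simp add: sum_ideal_def)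
  then have "z = \<zero>\<^bsub>\<Lambda>\<^esub>" unfolding hirsch_eq_zero_iff[OF z] by simp
  then show ?case
    using L.d_zero by (auto simp: coboundaries_def intro: rev_image_eqI[of "\<zero>\<^bsub>\<Lambda>\<^esub>"])
next
  case (Suc r)
  interpret even_sequence H K e n "Suc r" by fact
  interpret even_sequence_Suc H K e n r by unfold_locales
  have reg: "q_regular H q r e n"
    using Suc.prems(2) unfolding q_regular_def by auto
  show ?case
  proof (rule acyclic_Suc[OF _ Suc.prems(2) _ Suc.prems(3-6)])
    show "is_cdga K A" by (rule is_cdga_hirsch) (rule old.even_sequence_axioms)
    show "z \<in> coboundaries A" if "i \<le> Suc q" "z \<in> grade A i" "differential A z = \<zero>\<^bsub>A\<^esub>" "z {} \<in> old.I" for i z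
      by (rule Suc.IH[OF old.even_sequence_axioms reg that])
  qed
qed

section \<open>The q-equivalences\<close>

context even_sequence
begin

lemma is_cdga_\<Lambda>: "is_cdga K \<Lambda>"
  by (rule is_cdga_hirsch) (rule even_sequence_axioms)

interpretation L: cdga \<Lambda> K by (rule cdga.intro) (rule is_cdga_\<Lambda>)

interpretation I: homogeneous_ideal H K I by (rule homogeneous_ideal_sum_ideal)

lemma incl_cocycle: "h \<in> grade H i \<Longrightarrow> incl h \<in> cocycles \<Lambda> \<inter> grade \<Lambda> i"
  using incl_grade incl_closed[OF grade_carrier] differential_incl by (simp add: cocycles_def)

text \<open>Every homogeneous class of \<open>H/I\<close> lifts to \<open>H\<close> and so to a
  cocycle, in all degrees; the bound on degrees comes from \<open>acyclic_hirsch\<close>, which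
  gives injectivity.\<close>

lemma q_equivalence_quotient:
  assumes "q_regular H q r e n"
  shows "q_equivalence K q \<Lambda> (with_zero_diff (quot_alg H I)) (\<lambda>f. I +> f {})"
proof (rule L.q_equivalence_zero_diffI)
  let ?B = "quot_alg H I"
  show "comm_graded_algebra K ?B" by (rule I.comm_graded_algebra_quot)
  have cl: "f {} \<in> carrier H" if "f \<in> carrier \<Lambda>" for f using hirsch_apply_closed[OF that] by simp
  have "(\<lambda>f. I +> f {}) \<in> ring_hom \<Lambda> (with_zero_diff ?B)"
  proof (rule ring_hom_memI)
    fix f assume f: "f \<in> carrier \<Lambda>"
    show "I +> f {} \<in> carrier (with_zero_diff ?B)"
      using ring_hom_closed[OF I.rcos_ring_hom cl[OF f]] by (simp add: quot_alg_def)
    fix g assume g: "g \<in> carrier \<Lambda>"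
    show "I +> (f \<otimes>\<^bsub>\<Lambda>\<^esub> g) {} = (I +> f {}) \<otimes>\<^bsub>with_zero_diff ?B\<^esub> (I +> g {})"
      using ring_hom_mult[OF I.rcos_ring_hom cl[OF f] cl[OF g]] mult_empty[OF f g]
      by (simp add: quot_alg_def)
    show "I +> (f \<oplus>\<^bsub>\<Lambda>\<^esub> g) {} = (I +> f {}) \<oplus>\<^bsub>with_zero_diff ?B\<^esub> (I +> g {})"
      using ring_hom_add[OF I.rcos_ring_hom cl[OF f] cl[OF g]]
      by (simp add: quot_alg_def hirsch_extension_simps)
  next
    show "I +> \<one>\<^bsub>\<Lambda>\<^esub> {} = \<one>\<^bsub>with_zero_diff ?B\<^esub>"
      by (simp add: quot_alg_def FactRing_def hirsch_extension_simps)
  qed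
  moreover have "I +> (k \<odot>\<^bsub>\<Lambda>\<^esub> f) {} = k \<odot>\<^bsub>with_zero_diff ?B\<^esub> (I +> f {})"
    if "k \<in> carrier K" "f \<in> carrier \<Lambda>" for k f
    using I.quot_smult[OF that(1) cl[OF that(2)]] by (simp add: quot_alg_def hirsch_extension_simps)
  moreover have "(\<lambda>f. I +> f {}) ` grade \<Lambda> i \<subseteq> grade (with_zero_diff ?B) i" for i
    using grade_empty by (auto simp: quot_alg_def)
  moreover have "I +> differential \<Lambda> f {} = \<zero>\<^bsub>?B\<^esub>" if "f \<in> carrier \<Lambda>" for f
    using differential_empty_mem[OF that] I.coset_eq_self_iff[OF sum_ideal_closed]
    by (simp add: quot_alg_def FactRing_def)
  ultimately show "(\<lambda>f. I +> f {}) \<in> cdga_hom K \<Lambda> (with_zero_diff ?B)"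
    by (simp add: cdga_hom_def)
  show "\<exists>f\<in>cocycles \<Lambda> \<inter> grade \<Lambda> i. I +> f {} = y" if y: "y \<in> grade ?B i" for i y
  proof -
    obtain x where "x \<in> grade H i" "y = I +> x" using y by (auto simp: quot_alg_def)
    then show ?thesis using incl_cocycle by (intro bexI[of _ "incl x"]) simp_all
  qed
  show "f \<in> coboundaries \<Lambda>"
    if "i \<le> Suc q" "f \<in> cocycles \<Lambda> \<inter> grade \<Lambda> i" "I +> f {} = \<zero>\<^bsub>?B\<^esub>" for i f
  proof (rule acyclic_hirsch[OF even_sequence_axioms assms that(1)])
    show "f {} \<in> I"
      using that I.coset_eq_self_iff[OF cl, of f] by (simp add: quot_alg_def FactRing_def cocycles_def)
  qed (use that in \<open>simp_all add: cocycles_def\<close>)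
qed

text \<open>The class of the constant coefficient is defined for all elements, closed or not. It is
  zero on differentials because \<open>I\<close> consists of coboundaries. Conversely, a constant
  coefficient that is a coboundary lies in \<open>I\<close>, so the kernel is controlled as for the
  quotient.\<close>

lemma q_equivalence_cohomology:
  assumes "q_regular H q r e n"
  shows "q_equivalence K q \<Lambda> (with_zero_diff (cohomology \<Lambda>)) (\<lambda>f. coboundaries \<Lambda> +>\<^bsub>\<Lambda>\<^esub> incl (f {}))"
proof (rule L.q_equivalence_zero_diffI)
  let ?C = "cohomology \<Lambda>" and ?Z = "L.cocycle_alg" and ?c = "\<lambda>z. coboundaries \<Lambda> +>\<^bsub>\<Lambda>\<^esub> z"
  show "comm_graded_algebra K ?C" by (rule L.comm_graded_algebra_cohomology)
  interpret Z: homogeneous_ideal ?Z K "coboundaries \<Lambda>"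
    by (rule L.homogeneous_ideal_coboundaries)
  have cl: "f {} \<in> carrier H" if "f \<in> carrier \<Lambda>" for f using hirsch_apply_closed[OF that] by simp
  have inclZ: "incl h \<in> carrier ?Z" if "h \<in> carrier H" for h
    using that incl_closed differential_incl by (simp add: cocycles_def)
  have incl_add: "incl (x \<oplus> y) = incl x \<oplus>\<^bsub>\<Lambda>\<^esub> incl y" if "x \<in> carrier H" "y \<in> carrier H" for x y
    unfolding incl_def hirsch_extension_simps by (rule restrict_ext) simp
  have incl_mult: "incl (x \<otimes> y) = incl x \<otimes>\<^bsub>\<Lambda>\<^esub> incl y" if "x \<in> carrier H" "y \<in> carrier H" for x y
  proof (rule hirsch_eqI)
    show "incl (x \<otimes> y) U = (incl x \<otimes>\<^bsub>\<Lambda>\<^esub> incl y) U" if U: "U \<subseteq> {1..r}" for U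
      unfolding mult_incl_left[OF incl_closed[OF \<open>y \<in> carrier H\<close>] \<open>x \<in> carrier H\<close> U]
      using U that \<open>x \<in> carrier H\<close> by (simp add: incl_def)
  qed (use that incl_closed L.m_closed in auto)
  have incl_smult: "incl (k \<odot> x) = k \<odot>\<^bsub>\<Lambda>\<^esub> incl x" if "k \<in> carrier K" for k x
    unfolding incl_def hirsch_extension_simps by (rule restrict_ext) (use that in simp)
  have incl_one: "incl \<one> = \<one>\<^bsub>\<Lambda>\<^esub>" by (simp add: incl_def hirsch_extension_simps)
  have C: "\<And>x y. x \<otimes>\<^bsub>?C\<^esub> y = x \<otimes>\<^bsub>?Z Quot coboundaries \<Lambda>\<^esub> y"
      "\<And>x y. x \<oplus>\<^bsub>?C\<^esub> y = x \<oplus>\<^bsub>?Z Quot coboundaries \<Lambda>\<^esub> y"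
      "carrier ?C = carrier (?Z Quot coboundaries \<Lambda>)" "\<one>\<^bsub>?C\<^esub> = \<one>\<^bsub>?Z Quot coboundaries \<Lambda>\<^esub>"
      "\<zero>\<^bsub>?C\<^esub> = coboundaries \<Lambda>"
    by (simp_all add: cohomology_def quot_alg_def FactRing_def)
  have "(\<lambda>f. ?c (incl (f {}))) \<in> ring_hom \<Lambda> (with_zero_diff ?C)"
  proof (rule ring_hom_memI)
    fix f assume f: "f \<in> carrier \<Lambda>"
    show "?c (incl (f {})) \<in> carrier (with_zero_diff ?C)"
      using ring_hom_closed[OF Z.rcos_ring_hom inclZ[OF cl[OF f]]]
      by (simp add: C L.coset_cocycle_alg)
    fix g assume g: "g \<in> carrier \<Lambda>"
    show "?c (incl ((f \<otimes>\<^bsub>\<Lambda>\<^esub> g) {})) = ?c (incl (f {})) \<otimes>\<^bsub>with_zero_diff ?C\<^esub> ?c (incl (g {}))"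
      using ring_hom_mult[OF Z.rcos_ring_hom inclZ[OF cl[OF f]] inclZ[OF cl[OF g]]]
      by (simp add: C L.coset_cocycle_alg mult_empty[OF f g] incl_mult[OF cl[OF f] cl[OF g]])
    have "(f \<oplus>\<^bsub>\<Lambda>\<^esub> g) {} = f {} \<oplus> g {}" by (simp add: hirsch_extension_simps)
    then show "?c (incl ((f \<oplus>\<^bsub>\<Lambda>\<^esub> g) {})) = ?c (incl (f {})) \<oplus>\<^bsub>with_zero_diff ?C\<^esub> ?c (incl (g {}))"
      using ring_hom_add[OF Z.rcos_ring_hom inclZ[OF cl[OF f]] inclZ[OF cl[OF g]]]
      by (simp add: C L.coset_cocycle_alg incl_add[OF cl[OF f] cl[OF g]])
  next
    have "\<one>\<^bsub>\<Lambda>\<^esub> {} = \<one>" by (simp add: hirsch_extension_simps)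
    then show "?c (incl (\<one>\<^bsub>\<Lambda>\<^esub> {})) = \<one>\<^bsub>with_zero_diff ?C\<^esub>"
      using ring_hom_one[OF Z.rcos_ring_hom] by (simp add: C L.coset_cocycle_alg incl_one)
  qed
  moreover have "?c (incl ((k \<odot>\<^bsub>\<Lambda>\<^esub> f) {})) = k \<odot>\<^bsub>with_zero_diff ?C\<^esub> ?c (incl (f {}))"
    if "k \<in> carrier K" "f \<in> carrier \<Lambda>" for k f
  proof -
    have "(k \<odot>\<^bsub>\<Lambda>\<^esub> f) {} = k \<odot> f {}" by (simp add: hirsch_extension_simps)
    then show ?thesis
      using Z.quot_smult[OF that(1) inclZ[OF cl[OF that(2)]]]
      by (simp add: cohomology_def quot_alg_def L.coset_cocycle_alg incl_smult[OF that(1)])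
  qed
  moreover have "(\<lambda>f. ?c (incl (f {}))) ` grade \<Lambda> i \<subseteq> grade (with_zero_diff ?C) i" for i
    unfolding with_zero_diff_simps L.grade_cohomology using incl_cocycle grade_empty by blast
  moreover have "?c (incl (differential \<Lambda> f {})) = \<zero>\<^bsub>?C\<^esub>" if "f \<in> carrier \<Lambda>" for f
  proof -
    have "incl (differential \<Lambda> f {}) \<in> coboundaries \<Lambda>"
      by (rule incl_sum_ideal) (rule differential_empty_mem[OF that])
    then show ?thesis
      using Z.coset_eq_self_iff[OF inclZ[OF cl[OF L.d_closed[OF that]]]]
      by (simp add: C L.coset_cocycle_alg)
  qed
  ultimately show "(\<lambda>f. ?c (incl (f {}))) \<in> cdga_hom K \<Lambda> (with_zero_diff ?C)"
    by (simp add: cdga_hom_def)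
  have ker: "f \<in> coboundaries \<Lambda>"
    if "i \<le> Suc q" "f \<in> cocycles \<Lambda> \<inter> grade \<Lambda> i" "f {} \<in> I" for i f
    by (rule acyclic_hirsch[OF even_sequence_axioms assms that(1)])
      (use that(2,3) in \<open>simp_all add: cocycles_def\<close>)
  show "\<exists>f\<in>cocycles \<Lambda> \<inter> grade \<Lambda> i. ?c (incl (f {})) = y" if i: "i \<le> q" and y: "y \<in> grade ?C i" for i y
  proof -
    obtain f where f: "f \<in> cocycles \<Lambda>" "f \<in> grade \<Lambda> i" and y_eq: "y = ?c f"
      using y unfolding L.grade_cohomology by blast
    have fc: "f \<in> carrier \<Lambda>" using f(2) by (rule L.grade_carrier)
    let ?g = "incl (f {})"
    have g: "?g \<in> cocycles \<Lambda>" "?g \<in> grade \<Lambda> i" using incl_cocycle[OF grade_empty[OF f(2)]] by auto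
    have gc: "?g \<in> carrier \<Lambda>" using g(2) by (rule L.grade_carrier)
    \<comment> \<open>A cocycle and its constant part differ by a cocycle with zero constant
      coefficient, hence by a coboundary: the class of \<open>f\<close> is hit by the constant part
      of \<open>f\<close>.\<close>
    have "?g \<ominus>\<^bsub>\<Lambda>\<^esub> f \<in> coboundaries \<Lambda>"
    proof (rule ker)
      show "?g \<ominus>\<^bsub>\<Lambda>\<^esub> f \<in> cocycles \<Lambda> \<inter> grade \<Lambda> i"
        using f g fc gc by (auto simp: L.minus_eq cocycles_def L.d_add L.d_minus)
      \<comment> \<open>Negation in \<open>\<Lambda>\<close> is not given by a formula for
        coefficients, so the constant coefficient of the difference is determined by adding
        \<open>f\<close> back.\<close>
      have "(?g \<ominus>\<^bsub>\<Lambda>\<^esub> f \<oplus>\<^bsub>\<Lambda>\<^esub> f) {} = ?g {}"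
        using fc gc by (simp add: L.minus_eq L.a_assoc L.l_neg)
      then have "(?g \<ominus>\<^bsub>\<Lambda>\<^esub> f) {} \<oplus> f {} = \<zero> \<oplus> f {}"
        using cl[OF fc] by (simp add: hirsch_extension_simps(5))
      then have "(?g \<ominus>\<^bsub>\<Lambda>\<^esub> f) {} = \<zero>"
        using cl[OF fc] cl[of "?g \<ominus>\<^bsub>\<Lambda>\<^esub> f"] fc gc by (metis L.minus_closed add.right_cancel zero_closed)
      then show "(?g \<ominus>\<^bsub>\<Lambda>\<^esub> f) {} \<in> I" using I.zero_closed by metis
    qed (use i in simp)
    then have "?c ?g = ?c f" using L.coboundaries_coset_eq_iff g f by blast
    then show ?thesis using f y_eq by blast
  qed
  show "f \<in> coboundaries \<Lambda>"
    if "i \<le> Suc q" "f \<in> cocycles \<Lambda> \<inter> grade \<Lambda> i" "?c (incl (f {})) = \<zero>\<^bsub>?C\<^esub>" for i f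
  proof (rule ker[OF that(1,2)])
    have f: "f \<in> carrier \<Lambda>" using that(2) by (simp add: cocycles_def)
    have "incl (f {}) \<in> coboundaries \<Lambda>"
      using Z.coset_eq_self_iff[OF inclZ[OF cl[OF f]]] that(3) by (simp add: C L.coset_cocycle_alg)
    then obtain w where w: "w \<in> carrier \<Lambda>" "incl (f {}) = differential \<Lambda> w"
      by (auto simp: coboundaries_def)
    then have "f {} = differential \<Lambda> w {}" by (metis incl_empty)
    then show "f {} \<in> I" using differential_empty_mem[OF w(1)] by metis
  qed
qed

end

theorem theorem1p2:
  fixes K :: "'k ring" and H :: "('k, 'a) graded_alg"
    and q r :: nat and e :: "nat \<Rightarrow> 'a" and n :: "nat \<Rightarrow> nat"
  assumes "field K"
    and char_0: "\<And>m::nat. m > 0 \<Longrightarrow> [m] \<cdot>\<^bsub>K\<^esub> \<one>\<^bsub>K\<^esub> \<noteq> \<zero>\<^bsub>K\<^esub>"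
    and "comm_graded_algebra K H"
    and "connected_alg K H"
    and "q_regular H q r e n"
    and "\<And>\<alpha>. \<alpha> \<in> {1..r} \<Longrightarrow> even (n \<alpha>)"
  shows "same_q_type K q (hirsch_extension H r e n)
           (with_zero_diff (quot_alg H (sum_ideal H e {1..r}))) \<and>
         q_formal K q (hirsch_extension H r e n)"
proof -
  interpret even_sequence H K e n r
  \<comment> \<open>Positivity of the degrees and homogeneity are part of q-regularity; evenness is
    the separate hypothesis.\<close>
  proof (intro even_sequence.intro even_sequence_axioms.intro graded.intro)
    show "0 < n \<alpha>" "e \<alpha> \<in> grade H (n \<alpha>)" if "\<alpha> \<in> {1..r}" for \<alpha>
      using assms(5) that unfolding q_regular_def by auto
  qed (use assms in auto)
  interpret L: cdga \<Lambda> K by (rule cdga.intro) (rule is_cdga_\<Lambda>)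
  have "q_linked K q \<Lambda> (with_zero_diff (quot_alg H I))"
    unfolding q_linked_def
    using is_cdga_\<Lambda> q_equivalence_quotient[OF assms(5)]
      is_cdga_with_zero_diff[OF homogeneous_ideal.comm_graded_algebra_quot[OF homogeneous_ideal_sum_ideal]]
    by blast
  moreover have "q_linked K q \<Lambda> (with_zero_diff (cohomology \<Lambda>))"
    unfolding q_linked_def
    using is_cdga_\<Lambda> q_equivalence_cohomology[OF assms(5)]
      is_cdga_with_zero_diff[OF L.comm_graded_algebra_cohomology]
    by blast
  ultimately show ?thesis
    unfolding q_formal_def same_q_type_def by blast
qed

end
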